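(* Let $K$, $\Gamma$, $S$, $b$ satisfy hypotheses (H1)--(H6) and the standing assumptions listed in the context, and let $f_0\in X^+$. Then the continuous coagulation equation with multiple fragmentation $$\frac{\partial f(x,t)}{\partial t} = \frac12\int_0^x K(x-y,y)f(x-y,t)f(y,t)\,dy-\int_0^\infty K(x,y)f(x,t)f(y,t)\,dy+\int_x^\infty b(x,y)S(y)f(y,t)\,dy-S(x)f(x,t),$$ with initial condition $f(x,0)=f_0(x)$, has a weak solution $f$ on $]0,\infty[$ (that is, a weak solution in the sense defined in the context with $T=\infty$). Furthermore, $\|f(t)\|_x\le\|f_0\|_x$ for all $t\ge 0$.
   Context: Notation: $]a,b[$ denotes the open interval. $X=\{f\in L^1(0,\infty):\|f\|<\infty\}$ with $\|f\|=\int_0^\infty(1+x)|f(x)|\,dx$; $X^+=\{f\in X: f\ge 0 \text{ a.e.}\}$; and for $f\in X$, $\|f\|_x=\int_0^\infty x|f(x)|\,dx$. $|E|$ is the Lebesgue measure of $E$ and $\mathbf 1_E$ its indicator function. Hypotheses. (H1) $K$ is a non-negative measurable function on $[0,\infty[\times[0,\infty[$ and is symmetric: $K(x,y)=K(y,x)$ for all $x,y\in]0,\infty[$. (H2) $K(x,y)\le\phi(x)\phi(y)$ for all $x,y\in]0,\infty[$, where $\phi$ is a non-negative function with $\phi(x)\le k_1(1+x)^\mu$ for some $0\le\mu<1$ and some constant $k_1>0$. (H3) $\Gamma$ is a non-negative measurable function on $]0,\infty[\times]0,\infty[$ such that $\Gamma(x,y)=0$ if $0<x<y$. The selection function $S$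 and the breakage function $b$ are defined by $$S(x)=\int_0^x\frac{y}{x}\,\Gamma(x,y)\,dy,\qquad b(x,y)=\Gamma(y,x)/S(y),$$ and it is assumed that $\int_0^y x\,b(x,y)\,dx=y$ for all $y>0$. Moreover there are $\theta\in[0,1[$ and two non-negative functions $k:]0,\infty[\to[0,\infty[$ and $\omega:]0,\infty[^2\to[0,\infty[$ such that, for each $R\ge1$, the following (H4)--(H6) hold: (H4) $\Gamma(y,x)\le k(R)\,y^\theta$ for $y>R$ and $x\in]0,R[$. (H5) For $y\in]0,R[$ and any measurable subset $E$ of $]0,R[$, $\int_0^y\mathbf 1_E(x)\Gamma(y,x)\,dx\le\omega(R,|E|)$, and in addition $\lim_{\delta\to0}\omega(R,\delta)=0$. (If $|E|=0$ the left-hand side is $0$ and nothing is required.) (H6) $S\in L^\infty]0,R[$. Standing assumption on the breakage function: there is a finite constant $N$, independent of $y$, such that $\int_0^y b(x,y)\,dx=N$ for all $y>0$, and $b(x,y)=0$ for $x>y$. Definition of weak solution. Let $T\in]0,\infty]$. A (weak) solution $f$ of the initial value problem consisting of the continuous coagulation equation with multiple fragmentation $$\frac{\partial f(x,t)}{\partial t} = \frac12\int_0^x K(x-y,y)f(x-y,t)f(y,t)\,dy-\int_0^\infty K(x,y)f(x,t)f(y,t)\,dy+\int_x^\infty b(x,y)S(y)f(y,t)\,dy-S(x)f(x,t)$$ with initial condition $f(x,0)=f_0(x)$ is a non-negative function $f:[0,T[\to X^+$ such that, for a.e. $x\in]0,\infty[$ and all $t\in[0,T[$: (i) $s\mapsto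 f(x,s)$ is continuous on $[0,T[$; (ii) the following integrals are finite: $\int_0^t\int_0^\infty K(x,y)f(y,s)\,dy\,ds<\infty$ and $\int_0^t\int_x^\infty b(x,y)S(y)f(y,s)\,dy\,ds<\infty$; (iii) $f$ satisfies $$f(x,t)=f_0(x)+\int_0^t\Big\{\frac12\int_0^xK(x-y,y)f(x-y,s)f(y,s)\,dy-\int_0^\infty K(x,y)f(x,s)f(y,s)\,dy+\int_x^\infty b(x,y)S(y)f(y,s)\,dy-S(x)f(x,s)\Big\}ds.$$ Here $f(x,s)$ denotes $f(s)$ evaluated at $x$. *)

theory Defs
  imports "HOL-Analysis.Analysis"
begin

text \<open>
  Functions on \<open>]0,\<infinity>[\<close> are total functions on the reals whose values outside the domain are
  never used; elements of \<open>L\<^sup>1\<close> are represented by functions rather than by classes modulo null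
  sets. ``Measurable'' means Lebesgue measurable. The solution is written \<open>f t x\<close> for \<open>f(x,t)\<close>.
\<close>

definition X_norm :: "(real \<Rightarrow> real) \<Rightarrow> ennreal" where
  "X_norm f = (\<integral>\<^sup>+x\<in>{0<..}. ennreal ((1 + x) * \<bar>f x\<bar>) \<partial>lebesgue)"

definition X_space :: "(real \<Rightarrow> real) set" where
  "X_space = {f. set_integrable lebesgue {0<..} f \<and> X_norm f < \<infinity>}"

definition X_pos :: "(real \<Rightarrow> real) set" where
  "X_pos = {f \<in> X_space. AE x in lebesgue_on {0<..}. 0 \<le> f x}"

definition norm_x :: "(real \<Rightarrow> real) \<Rightarrow> ennreal" where
  "norm_x f = (\<integral>\<^sup>+x\<in>{0<..}. ennreal (x * \<bar>f x\<bar>) \<partial>lebesgue)"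

definition Linfty_on :: "real set \<Rightarrow> (real \<Rightarrow> real) set" where
  "Linfty_on A = {g. g \<in> borel_measurable (lebesgue_on A) \<and>
     (\<exists>C. AE x in lebesgue_on A. \<bar>g x\<bar> \<le> C)}"

definition selection :: "(real \<Rightarrow> real \<Rightarrow> real) \<Rightarrow> real \<Rightarrow> real" where
  "selection \<Gamma> x = (LINT y:{0<..<x}|lebesgue. y / x * \<Gamma> x y)"

definition breakage :: "(real \<Rightarrow> real \<Rightarrow> real) \<Rightarrow> real \<Rightarrow> real \<Rightarrow> real" where
  "breakage \<Gamma> x y = \<Gamma> y x / selection \<Gamma> y"

text \<open>The right-hand side of the equation at size \<open>x\<close>, for a size distribution \<open>g\<close>.\<close>

definition coag_frag_rhs ::
  "(real \<Rightarrow> real \<Rightarrow> real) \<Rightarrow> (real \<Rightarrow> real) \<Rightarrow> (real \<Rightarrow> real \<Rightarrow> real) \<Rightarrow> (real \<Rightarrow> real) \<Rightarrow> real \<Rightarrow> real"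
where
  "coag_frag_rhs K S b g x =
     1 / 2 * (LINT y:{0<..<x}|lebesgue. K (x - y) y * g (x - y) * g y)
     - (LINT y:{0<..}|lebesgue. K x y * g x * g y)
     + (LINT y:{x<..}|lebesgue. b x y * S y * g y)
     - S x * g x"

text \<open>
  The first three finiteness conditions below ensure that the Bochner integrals in the last
  clause, which default to \<open>0\<close> for non-integrable functions, are proper integrals. The second and
  third are condition (ii) of the definition. The first one, for the coagulation gain term, is
  implicit in condition (iii): all other terms there are integrable over \<open>]0,t[\<close> by (i) and (ii), so
  equality with the real number \<open>f(x,t)\<close> forces the integral of the (non-negative) gain term to be
  finite.
\<close>

definition weak_solution ::
  "(real \<Rightarrow> real \<Rightarrow> real) \<Rightarrow> (real \<Rightarrow> real) \<Rightarrow> (real \<Rightarrow> real \<Rightarrow> real) \<Rightarrow> (real \<Rightarrow> real) \<Rightarrow> ereal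
   \<Rightarrow> (real \<Rightarrow> real \<Rightarrow> real) \<Rightarrow> bool"
where
  "weak_solution K S b f0 T f \<longleftrightarrow>
     0 < T \<and>
     (\<forall>t. 0 \<le> t \<and> ereal t < T \<longrightarrow> f t \<in> X_pos) \<and>
     (AE x in lebesgue_on {0<..}.
        continuous_on {t. 0 \<le> t \<and> ereal t < T} (\<lambda>s. f s x) \<and>
        (\<forall>t. 0 \<le> t \<and> ereal t < T \<longrightarrow>
           0 \<le> f t x \<and>
           (\<integral>\<^sup>+s\<in>{0<..<t}. (\<integral>\<^sup>+y\<in>{0<..<x}.
              ennreal (K (x - y) y * f s (x - y) * f s y) \<partial>lebesgue) \<partial>lebesgue) < \<infinity> \<and>
           (\<integral>\<^sup>+s\<in>{0<..<t}. (\<integral>\<^sup>+y\<in>{0<..}. ennreal (K x y * f s y) \<partial>lebesgue) \<partial>lebesgue) < \<infinity> \<and>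
           (\<integral>\<^sup>+s\<in>{0<..<t}. (\<integral>\<^sup>+y\<in>{x<..}. ennreal (b x y * S y * f s y) \<partial>lebesgue) \<partial>lebesgue) < \<infinity> \<and>
           f t x = f0 x + (LINT s:{0<..<t}|lebesgue. coag_frag_rhs K S b (f s) x)))"

end

theory Submission
  imports Defs "HOL-Analysis.Analysis" "HOL-Library.Diagonal_Subsequence"
begin

text \<open>
  The solution is a limit of explicit Euler polygons for the equation with truncated coefficients
  \<open>K(x,y) 1\<^bsub>x+y<n\<^esub>\<close> and \<open>\<Gamma>(y,x) 1\<^bsub>y<n\<^esub>\<close>. For a step size that is small compared with the (bounded)
  truncated rates the scheme preserves positivity and the mass \<open>\<integral> x f\<close>. Since coagulation does not
  create particles of size below \<open>1\<close> and (H4) bounds the number of small fragments of a large particle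
  sublinearly, a discrete Gronwall argument bounds \<open>\<integral> (1 + x) f\<close> uniformly in \<open>n\<close>; the same argument
  applied to \<open>sup {\<integral>\<^bsub>E\<^esub> f | |E| \<le> \<delta>}\<close> yields uniform integrability from (H5).

  A diagonal subsequence converges on a countable generator of the Borel sets at all rational times.
  Uniform integrability extends this to all Borel sets (Dynkin's lemma) and makes the limit an
  absolutely continuous measure; the Lipschitz estimate in time extends it to all times. The quadratic
  terms pass to the limit because the inner integral converges pointwise and is dominated by
  \<open>(1 + y)\<^sup>l\<close> with \<open>l = max \<mu> \<theta> < 1\<close>, so that large sizes are controlled by the mass.
  Finally \<open>f\<^sub>0 + \<integral>\<^sub>0\<^sup>t gain - \<integral>\<^sub>0\<^sup>t loss\<close> is the version of the limit that is continuous in time.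
\<close>

section \<open>Setwise limits of measures\<close>

text \<open>The scheme is explicit, so the truncated problems need no existence theory of their own;
  the price is the step \<open>tau n\<close>, which depends on the truncation. Densities and fluxes
  live in \<open>ennreal\<close>, with losses on the opposite side of each balance: Tonelli applies
  without integrability conditions, and a term is cancelled only once it is known to be finite. The
  quadratic terms are the main obstacle, since weak convergence does not pass to products.
  Convergence on every Borel set is strong enough to allow test functions that vary with the index
  and converge only pointwise; so one factor, already integrated against the kernel, serves as test
  function for the other. To allow test functions of growth \<open>l\<close>, compactness is sought
  for the measures with density (1 + x)^l f; the moment pays for their tails because l < 1. Null
  sets are the second obstacle. Radon-Nikodym gives each limit density up to a null set depending on
  the time, while the equation is required for almost every size and all times at once. Moreover the
  given coefficients are only Lebesgue measurable, and the selection function is only essentially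
  bounded.\<close>

lemma convergent_if_approximated:
  fixes x :: "nat \<Rightarrow> real"
  assumes "\<And>e. 0 < e \<Longrightarrow> \<exists>y. convergent y \<and> (\<forall>\<^sub>F n in sequentially. \<bar>x n - y n\<bar> \<le> e)"
  shows "convergent x"
proof -
  have "Cauchy x"
  proof (rule metric_CauchyI)
    fix e :: real assume "0 < e"
    then obtain y where y: "convergent y" and xy: "\<forall>\<^sub>F n in sequentially. \<bar>x n - y n\<bar> \<le> e / 4"
      using assms[of "e / 4"] by auto
    obtain M1 where M1: "\<And>n. n \<ge> M1 \<Longrightarrow> \<bar>x n - y n\<bar> \<le> e / 4"
      using xy by (auto simp: eventually_sequentially)
    have "Cauchy y" using y by (rule convergent_Cauchy)
    then obtain M2 where M2: "\<And>m n. m \<ge> M2 \<Longrightarrow> n \<ge> M2 \<Longrightarrow> dist (y m) (y n) < e / 4"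
      using \<open>0 < e\<close> metric_CauchyD[of y "e / 4"] by (metis divide_pos_pos zero_less_numeral)
    have "dist (x m) (x n) < e" if "m \<ge> max M1 M2" "n \<ge> max M1 M2" for m n
      using M1[of m] M1[of n] M2[of m n] that \<open>0 < e\<close> unfolding dist_real_def by linarith
    then show "\<exists>M. \<forall>m\<ge>M. \<forall>n\<ge>M. dist (x m) (x n) < e" by blast
  qed
  then show ?thesis by (rule Cauchy_convergent)
qed

lemma countable_diagonal_subsequence:
  fixes X :: "'i \<Rightarrow> nat \<Rightarrow> real"
  assumes "countable I" and bdd: "\<And>i. i \<in> I \<Longrightarrow> bounded (range (X i))"
  shows "\<exists>r. strict_mono r \<and> (\<forall>i\<in>I. convergent (\<lambda>n. X i (r n)))"
proof (cases "I = {}")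
  case True
  then show ?thesis using strict_mono_id by blast
next
  case False
  define c where "c = from_nat_into I"
  interpret subseqs "\<lambda>k s. convergent (\<lambda>n. X (c k) (s n))"
  proof
    fix k and s :: "nat \<Rightarrow> nat"
    have "bounded (range (\<lambda>n. X (c k) (s n)))"
      using bdd[OF from_nat_into[OF False, of k]] unfolding c_def
      by (rule bounded_subset) auto
    from bounded_imp_convergent_subsequence[OF this] obtain l r'
      where "strict_mono r'" "((\<lambda>n. X (c k) (s n)) \<circ> r') \<longlonglongrightarrow> l" by blast
    then show "\<exists>r'. strict_mono r' \<and> convergent (\<lambda>n. X (c k) ((s \<circ> r') n))"
      by (intro exI[of _ r'] conjI) (simp_all add: o_def convergentI)
  qed
  have "convergent (\<lambda>n. X i (diagseq n))" if i: "i \<in> I" for i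
  proof -
    obtain k where k: "c k = i"
      using from_nat_into_surj[OF \<open>countable I\<close> i] unfolding c_def by blast
    \<comment> \<open>\<open>diagseq\<close> is a subsequence of the \<open>k\<close>-th extraction
      only after its first \<open>Suc k\<close> terms; the shift is discarded afterwards.\<close>
    have "convergent (\<lambda>n. X (c k) ((diagseq \<circ> (+) (Suc k)) n))"
    proof (rule diagseq_holds)
      fix r s :: "nat \<Rightarrow> nat" and n
      assume "strict_mono r" "convergent (\<lambda>m. X (c n) (s m))"
      then show "convergent (\<lambda>m. X (c n) ((s \<circ> r) m))"
        using convergent_subseq_convergent[of "\<lambda>m. X (c n) (s m)" r] by (simp add: o_def)
    qed
    then have "convergent (\<lambda>n. X i (diagseq (n + Suc k)))"
      by (simp add: k o_def add.commute)
    then show ?thesis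
      using convergent_ignore_initial_segment[of "\<lambda>n. X i (diagseq n)" "Suc k"] by simp
  qed
  then show ?thesis using subseq_diagseq by blast
qed

text \<open>The uniform smallness \<open>uc\<close> is used twice: it closes the class of sets with
  convergent masses under countable disjoint unions, and it makes the limit set function continuous
  at the empty set, hence countably additive. The whole space appears in \<open>conv\<close> because
  complements are treated by subtraction from the total mass and \<open>G\<close> need not contain
  the space.\<close>

lemma setwise_convergence_limit:
  fixes \<mu> :: "nat \<Rightarrow> 'a measure"
  assumes sets: "\<And>n. sets (\<mu> n) = sets M"
    and G: "Int_stable G" "G \<subseteq> Pow (space M)" "sets M = sigma_sets (space M) G"
    and fin: "\<And>n. finite_measure (\<mu> n)"
    and uc: "\<And>A e. range A \<subseteq> sets M \<Longrightarrow> decseq A \<Longrightarrow> (\<Inter>i. A i) = {} \<Longrightarrow> 0 < e \<Longrightarrow>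
      \<exists>k. \<forall>n. measure (\<mu> n) (A k) \<le> e"
    and conv: "\<And>E. E \<in> G \<or> E = space M \<Longrightarrow> convergent (\<lambda>n. measure (\<mu> n) E)"
  obtains \<nu> where "finite_measure \<nu>" "sets \<nu> = sets M"
    "\<And>E. E \<in> sets M \<Longrightarrow> (\<lambda>n. emeasure (\<mu> n) E) \<longlonglongrightarrow> emeasure \<nu> E"
proof -
  have sp: "space (\<mu> n) = space M" for n
    using sets by (rule sets_eq_imp_space_eq)
  note fm = finite_measure.finite_measure_Diff[OF fin] finite_measure.finite_measure_mono[OF fin]
  have cv: "convergent (\<lambda>n. measure (\<mu> n) E)" if "E \<in> sets M" for E
    using G(1,2) that[unfolded G(3)]
  proof (induction rule: sigma_sets_induct_disjoint)
    case (basic E)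
    then show ?case using conv by auto
  next
    case empty
    then show ?case by (simp add: convergent_const)
  next
    case (compl E)
    then have E: "E \<in> sets M" by (simp add: G(3))
    have "(\<lambda>n. measure (\<mu> n) (space M - E)) = (\<lambda>n. measure (\<mu> n) (space M) - measure (\<mu> n) E)"
      using fm(1) E sets.sets_into_space[OF E] sets sp by (metis sets.top)
    then show ?case
      using convergent_diff[OF conv compl.IH] by simp
  next
    case (union A)
    have A: "A i \<in> sets M" for i using union by (auto simp: G(3))
    show ?case
    proof (rule convergent_if_approximated)
      fix e :: real assume "0 < e"
      \<comment> \<open>What is left of the union after \<open>k\<close> members decreases to the
        empty set, so the mass of the union is uniformly close to a finite partial sum.\<close>
      define B where "B k = (\<Union>i. A i) - (\<Union>i<k. A i)" for k
      have "range B \<subseteq> sets M" unfolding B_def using A by auto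
      moreover have "decseq B" unfolding B_def decseq_def by force
      moreover have "(\<Inter>k. B k) = {}" unfolding B_def by auto
      ultimately obtain k where k: "\<And>n. measure (\<mu> n) (B k) \<le> e"
        using uc \<open>0 < e\<close> by blast
      have "\<bar>measure (\<mu> n) (\<Union>i. A i) - (\<Sum>i<k. measure (\<mu> n) (A i))\<bar> \<le> e" for n
      proof -
        have "measure (\<mu> n) (\<Union>i<k. A i) = (\<Sum>i<k. measure (\<mu> n) (A i))"
          using union(1) A sets
          by (intro finite_measure.finite_measure_finite_Union[OF fin])
             (auto simp: disjoint_family_on_def)
        moreover have "measure (\<mu> n) (B k) = measure (\<mu> n) (\<Union>i. A i) - measure (\<mu> n) (\<Union>i<k. A i)"
          unfolding B_def using A sets by (intro fm(1)) auto
        ultimately show ?thesis using k[of n] measure_nonneg[of "\<mu> n" "B k"] by linarith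
      qed
      moreover have "convergent (\<lambda>n. \<Sum>i<k. measure (\<mu> n) (A i))"
        using union.IH by (intro convergent_sum) auto
      ultimately show "\<exists>y. convergent y \<and>
          (\<forall>\<^sub>F n in sequentially. \<bar>measure (\<mu> n) (\<Union>i. A i) - y n\<bar> \<le> e)" by force
    qed
  qed
  define m where "m E = lim (\<lambda>n. measure (\<mu> n) E)" for E
  have m: "(\<lambda>n. measure (\<mu> n) E) \<longlonglongrightarrow> m E" if "E \<in> sets M" for E
    using cv[OF that] unfolding m_def by (simp add: convergent_LIMSEQ_iff)
  have m0: "0 \<le> m E" if "E \<in> sets M" for E
    by (rule LIMSEQ_le_const[OF m[OF that]]) auto
  define \<nu> where "\<nu> = measure_of (space M) (sets M) (\<lambda>E. ennreal (m E))"
  have pos: "positive (sets M) (\<lambda>E. ennreal (m E))"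
    unfolding positive_def m_def by simp
  have "additive (sets M) (\<lambda>E. ennreal (m E))"
    unfolding additive_def
  proof (intro ballI impI)
    fix E F assume EF: "E \<in> sets M" "F \<in> sets M" "E \<inter> F = {}"
    have "(\<lambda>n. measure (\<mu> n) (E \<union> F)) = (\<lambda>n. measure (\<mu> n) E + measure (\<mu> n) F)"
      using finite_measure.finite_measure_Union[OF fin] EF sets by auto
    then have "(\<lambda>n. measure (\<mu> n) (E \<union> F)) \<longlonglongrightarrow> m E + m F"
      using tendsto_add[OF m m] EF by auto
    then have "m (E \<union> F) = m E + m F"
      using m[of "E \<union> F"] EF LIMSEQ_unique by blast
    then show "ennreal (m (E \<union> F)) = ennreal (m E) + ennreal (m F)"
      using m0 EF by (simp add: ennreal_plus)
  qed
  \<comment> \<open>For a finite additive set function, continuity at the empty set yields countable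
    additivity.\<close>
  moreover have "(\<lambda>i. ennreal (m (A i))) \<longlonglongrightarrow> 0"
    if A: "range A \<subseteq> sets M" "decseq A" "(\<Inter>i. A i) = {}" for A
  proof -
    have "(\<lambda>i. m (A i)) \<longlonglongrightarrow> 0"
    proof (rule LIMSEQ_I)
      fix e :: real assume "0 < e"
      then obtain k where k: "\<And>n. measure (\<mu> n) (A k) \<le> e / 2"
        using uc[OF A, of "e / 2"] by auto
      have "norm (m (A i) - 0) < e" if "i \<ge> k" for i
      proof -
        have "measure (\<mu> n) (A i) \<le> e / 2" for n
          using k[of n] fm(2)[of "A i" "A k" n] A that sets by (force simp: decseq_def)
        then have "m (A i) \<le> e / 2"
          using m[of "A i"] A(1) by (intro LIMSEQ_le_const2) auto
        then show ?thesis using m0[of "A i"] A(1) \<open>0 < e\<close> by auto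
      qed
      then show "\<exists>no. \<forall>n\<ge>no. norm (m (A n) - 0) < e" by blast
    qed
    then show ?thesis using tendsto_ennrealI by fastforce
  qed
  ultimately have "countably_additive (sets M) (\<lambda>E. ennreal (m E))"
    using sets.empty_continuous_imp_countably_additive[OF pos] by auto
  then have em: "emeasure \<nu> E = ennreal (m E)" if "E \<in> sets M" for E
    using pos that unfolding \<nu>_def
    by (intro emeasure_measure_of_sigma) (auto simp: sets.sigma_algebra_axioms)
  have s\<nu>: "sets \<nu> = sets M" "space \<nu> = space M" unfolding \<nu>_def by auto
  show ?thesis
  proof (rule that)
    show "finite_measure \<nu>" by standard (simp add: em s\<nu>)
    show "sets \<nu> = sets M" by fact
    show "(\<lambda>n. emeasure (\<mu> n) E) \<longlonglongrightarrow> emeasure \<nu> E" if "E \<in> sets M" for E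
      using tendsto_ennrealI[OF m[OF that]] that
      by (simp add: em finite_measure.emeasure_eq_measure[OF fin])
  qed
qed

section \<open>Integration against setwise convergent measures\<close>

lemma nn_integral_layer_cake:
  fixes u :: "'a \<Rightarrow> ennreal"
  assumes "finite_measure M" and [measurable]: "u \<in> borel_measurable M"
    and le: "\<And>x. u x \<le> ennreal C"
  shows "(\<integral>\<^sup>+x. u x \<partial>M) =
    (\<integral>\<^sup>+s\<in>{0<..<C}. emeasure M {x \<in> space M. ennreal s < u x} \<partial>lborel)"
proof -
  interpret finite_measure M by fact
  interpret pair_sigma_finite M "lborel :: real measure" ..
  have "u x = (\<integral>\<^sup>+s. indicator {0<..<C} s * indicator {s. ennreal s < u x} s \<partial>lborel)" for x
  proof (cases "0 \<le> C")
    case False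
    then show ?thesis using le[of x] by (simp add: ennreal_neg)
  next
    case True
    obtain a where a: "u x = ennreal a" "0 \<le> a"
      using le[of x] by (metis ennreal_cases ennreal_less_top not_less top_unique order.strict_trans1)
    have "{0<..<C} \<inter> {s. ennreal s < u x} = {0<..<min a C}"
      using a by (auto simp: ennreal_less_iff)
    then have "(\<integral>\<^sup>+s. indicator {0<..<C} s * indicator {s. ennreal s < u x} s \<partial>lborel)
        = emeasure lborel {0<..<min a C}"
      by (subst nn_integral_indicator[symmetric]) (auto simp: indicator_inter_arith[symmetric])
    also have "min a C = a"
      using True le[of x] a by auto
    finally show ?thesis using a by simp
  qed
  then have "(\<integral>\<^sup>+x. u x \<partial>M) =
      (\<integral>\<^sup>+x. \<integral>\<^sup>+s. indicator {0<..<C} s * indicator {s. ennreal s < u x} s \<partial>lborel \<partial>M)"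
    by simp
  also have "\<dots> = (\<integral>\<^sup>+s. \<integral>\<^sup>+x. indicator {0<..<C} s * indicator {s. ennreal s < u x} s \<partial>M \<partial>lborel)"
    unfolding indicator_def by (rule Fubini'[symmetric]) measurable
  also have "\<dots> = (\<integral>\<^sup>+s\<in>{0<..<C}. emeasure M {x \<in> space M. ennreal s < u x} \<partial>lborel)"
  proof (rule nn_integral_cong)
    fix s :: real
    have "(\<integral>\<^sup>+x. indicator {s. ennreal s < u x} s \<partial>M) =
        (\<integral>\<^sup>+x. indicator {x \<in> space M. ennreal s < u x} x \<partial>M)"
      by (rule nn_integral_cong) (auto simp: indicator_def)
    then show "(\<integral>\<^sup>+x. indicator {0<..<C} s * indicator {s. ennreal s < u x} s \<partial>M) =
        emeasure M {x \<in> space M. ennreal s < u x} * indicator {0<..<C} s"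
      by (auto split: split_indicator)
  qed
  finally show ?thesis .
qed

text \<open>By the layer-cake formula the integral of \<open>u\<close> is an integral over levels
  \<open>s\<close> in ]0,C[ of the masses of superlevel sets. These sets do not depend on
  \<open>n\<close>, so the masses converge at every level, and \<open>L\<close> dominates
  them.\<close>

lemma nn_integral_setwise_tendsto:
  fixes \<mu> :: "nat \<Rightarrow> 'a measure" and u :: "'a \<Rightarrow> ennreal"
  assumes sets: "\<And>n. sets (\<mu> n) = sets \<nu>"
    and bd: "\<And>n. emeasure (\<mu> n) (space \<nu>) \<le> ennreal L" and fin: "finite_measure \<nu>"
    and conv: "\<And>E. E \<in> sets \<nu> \<Longrightarrow> (\<lambda>n. emeasure (\<mu> n) E) \<longlonglongrightarrow> emeasure \<nu> E"
    and u: "u \<in> borel_measurable \<nu>" and le: "\<And>x. u x \<le> ennreal C"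
  shows "(\<lambda>n. \<integral>\<^sup>+x. u x \<partial>\<mu> n) \<longlonglongrightarrow> (\<integral>\<^sup>+x. u x \<partial>\<nu>)"
proof -
  have sp: "space (\<mu> n) = space \<nu>" for n
    using sets by (rule sets_eq_imp_space_eq)
  have fin': "finite_measure (\<mu> n)" for n
    using bd[of n] by (intro finite_measureI) (auto simp: sp top_unique)
  have u': "u \<in> borel_measurable (\<mu> n)" for n
    using u measurable_cong_sets[OF sets refl] by auto
  have mono: "(\<lambda>s. emeasure M {x \<in> space M. ennreal s < u x}) \<in> borel_measurable lborel"
    if "finite_measure M" "u \<in> borel_measurable M" for M
  proof -
    interpret finite_measure M by fact
    have [measurable]: "u \<in> borel_measurable M" by fact
    have "(\<lambda>s. emeasure M {x \<in> space M. ennreal s < u x}) =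
      (\<lambda>s. \<integral>\<^sup>+x. indicator {p. ennreal (fst p) < u (snd p)} (s, x) \<partial>M)"
    proof
      fix s :: real
      have "(\<integral>\<^sup>+x. indicator {p. ennreal (fst p) < u (snd p)} (s, x) \<partial>M) =
        (\<integral>\<^sup>+x. indicator {x \<in> space M. ennreal s < u x} x \<partial>M)"
        by (rule nn_integral_cong) (auto simp: indicator_def)
      then show "emeasure M {x \<in> space M. ennreal s < u x} =
        (\<integral>\<^sup>+x. indicator {p. ennreal (fst p) < u (snd p)} (s, x) \<partial>M)" by simp
    qed
    also have "\<dots> \<in> borel_measurable lborel"
      unfolding indicator_def by measurable
    finally show ?thesis .
  qed
  note [measurable] = mono[OF fin' u'] mono[OF fin u]
  have le_L: "emeasure (\<mu> n) E \<le> ennreal L" if "E \<subseteq> space \<nu>" for n E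
    using emeasure_mono[of E "space \<nu>" "\<mu> n"] bd[of n] that sp sets.top[of "\<mu> n"] by auto
  show ?thesis
    unfolding nn_integral_layer_cake[OF fin' u' le] nn_integral_layer_cake[OF fin u le]
  proof (rule nn_integral_dominated_convergence[where w = "\<lambda>s. ennreal L * indicator {0<..<C} s"])
    show "(\<integral>\<^sup>+s. ennreal L * indicator {0<..<C} s \<partial>lborel) < \<infinity>"
      by (cases "0 \<le> C") (auto simp: nn_integral_cmult_indicator ennreal_mult_less_top)
    show "AE s in lborel. emeasure (\<mu> n) {x \<in> space (\<mu> n). ennreal s < u x} * indicator {0<..<C} s
        \<le> ennreal L * indicator {0<..<C} s" for n
      using le_L by (auto simp: indicator_def sp)
    have "{x \<in> space \<nu>. ennreal s < u x} \<in> sets \<nu>" for s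
      using u by measurable
    then show "AE s in lborel. (\<lambda>n. emeasure (\<mu> n) {x \<in> space (\<mu> n). ennreal s < u x}
        * indicator {0<..<C} s) \<longlonglongrightarrow> emeasure \<nu> {x \<in> space \<nu>. ennreal s < u x} * indicator {0<..<C} s"
      by (intro AE_I2) (auto simp: indicator_def sp intro: conv)
  qed measurable
qed

text \<open>For n >= k the function \<open>u n\<close> lies between the tail infimum
  \<open>lo k\<close> and the tail supremum \<open>hi k\<close>, which are fixed test functions.
  First n tends to infinity with k fixed, then monotone convergence under the limit measure closes
  the gap. Only pointwise convergence of \<open>u n\<close> is required, which is what the nonlinear
  terms can offer.\<close>

lemma nn_integral_setwise_tendsto_varying:
  fixes \<mu> :: "nat \<Rightarrow> 'a measure" and u :: "nat \<Rightarrow> 'a \<Rightarrow> ennreal"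
  assumes sets: "\<And>n. sets (\<mu> n) = sets \<nu>"
    and bd: "\<And>n. emeasure (\<mu> n) (space \<nu>) \<le> ennreal L" and fin: "finite_measure \<nu>"
    and conv: "\<And>E. E \<in> sets \<nu> \<Longrightarrow> (\<lambda>n. emeasure (\<mu> n) E) \<longlonglongrightarrow> emeasure \<nu> E"
    and u [measurable]: "\<And>n. u n \<in> borel_measurable \<nu>" and le: "\<And>n x. u n x \<le> ennreal C"
    and lim: "\<And>x. x \<in> space \<nu> \<Longrightarrow> (\<lambda>n. u n x) \<longlonglongrightarrow> v x"
  shows "(\<lambda>n. \<integral>\<^sup>+x. u n x \<partial>\<mu> n) \<longlonglongrightarrow> (\<integral>\<^sup>+x. v x \<partial>\<nu>)"
proof -
  interpret finite_measure \<nu> by fact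
  note fixed = nn_integral_setwise_tendsto[OF sets bd fin conv]
  define lo where "lo k x = (INF n\<in>{k..}. u n x)" for k x
  define hi where "hi k x = (SUP n\<in>{k..}. u n x)" for k x
  have [measurable]: "lo k \<in> borel_measurable \<nu>" "hi k \<in> borel_measurable \<nu>" for k
    unfolding lo_def hi_def by auto
  have lo_le: "lo k x \<le> ennreal C" and hi_le: "hi k x \<le> ennreal C" for k x
    unfolding lo_def hi_def using le by (auto intro: INF_lower2 SUP_least)
  have lo_u: "lo k x \<le> u n x" and hi_u: "u n x \<le> hi k x" if "k \<le> n" for k n x
    unfolding lo_def hi_def using that by (auto intro: INF_lower SUP_upper)
  have lo_lim: "(SUP k. lo k x) = v x" and hi_lim: "(INF k. hi k x) = v x" if "x \<in> space \<nu>" for x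
    using lim_imp_Liminf[OF _ lim[OF that]] lim_imp_Limsup[OF _ lim[OF that]]
    unfolding lo_def hi_def liminf_SUP_INF limsup_INF_SUP by auto
  have "(SUP k. \<integral>\<^sup>+x. lo k x \<partial>\<nu>) = (\<integral>\<^sup>+x. (SUP k. lo k x) \<partial>\<nu>)"
    by (rule nn_integral_monotone_convergence_SUP[symmetric])
       (auto simp: lo_def incseq_def le_fun_def intro!: INF_superset_mono)
  also have "\<dots> = (\<integral>\<^sup>+x. v x \<partial>\<nu>)" by (rule nn_integral_cong) (simp add: lo_lim)
  finally have SUP: "(SUP k. \<integral>\<^sup>+x. lo k x \<partial>\<nu>) = (\<integral>\<^sup>+x. v x \<partial>\<nu>)" .
  \<comment> \<open>Monotone convergence along a decreasing sequence needs a finite first integral,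
    supplied by the bound \<open>C\<close> and the finiteness of \<open>\<nu>\<close>.\<close>
  have "(\<integral>\<^sup>+x. hi 0 x \<partial>\<nu>) \<le> (\<integral>\<^sup>+x. ennreal C \<partial>\<nu>)"
    by (rule nn_integral_mono) (rule hi_le)
  also have "\<dots> < \<infinity>"
    by (simp add: ennreal_mult_less_top emeasure_eq_measure)
  finally have fin_hi: "(\<integral>\<^sup>+x. hi 0 x \<partial>\<nu>) < \<infinity>" .
  have "decseq hi"
  proof (intro decseq_SucI le_funI)
    show "hi (Suc k) x \<le> hi k x" for k x
      unfolding hi_def by (rule SUP_subset_mono) auto
  qed
  then have "(INF k. \<integral>\<^sup>+x. hi k x \<partial>\<nu>) = (\<integral>\<^sup>+x. (INF k. hi k x) \<partial>\<nu>)"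
    by (rule nn_integral_monotone_convergence_INF_decseq[of hi \<nu> 0, symmetric, OF _ _ fin_hi]) simp
  also have "\<dots> = (\<integral>\<^sup>+x. v x \<partial>\<nu>)" by (rule nn_integral_cong) (simp add: hi_lim)
  finally have INF: "(INF k. \<integral>\<^sup>+x. hi k x \<partial>\<nu>) = (\<integral>\<^sup>+x. v x \<partial>\<nu>)" .
  have lo_tendsto: "(\<lambda>n. \<integral>\<^sup>+x. lo k x \<partial>\<mu> n) \<longlonglongrightarrow> (\<integral>\<^sup>+x. lo k x \<partial>\<nu>)" for k
    by (rule fixed[where u = "lo k" and C = C]) (simp_all add: lo_le)
  have hi_tendsto: "(\<lambda>n. \<integral>\<^sup>+x. hi k x \<partial>\<mu> n) \<longlonglongrightarrow> (\<integral>\<^sup>+x. hi k x \<partial>\<nu>)" for k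
    by (rule fixed[where u = "hi k" and C = C]) (simp_all add: hi_le)
  show ?thesis
  proof (rule order_tendstoI)
    fix a assume "a < (\<integral>\<^sup>+x. v x \<partial>\<nu>)"
    then have "a < (SUP k. \<integral>\<^sup>+x. lo k x \<partial>\<nu>)" by (simp only: SUP)
    then obtain k where "a < (\<integral>\<^sup>+x. lo k x \<partial>\<nu>)" by (auto simp: less_SUP_iff)
    with lo_tendsto have "\<forall>\<^sub>F n in sequentially. a < (\<integral>\<^sup>+x. lo k x \<partial>\<mu> n)"
      by (rule order_tendstoD)
    then show "\<forall>\<^sub>F n in sequentially. a < (\<integral>\<^sup>+x. u n x \<partial>\<mu> n)"
      using eventually_ge_at_top[of k]
    proof eventually_elim
      case (elim n)
      then show ?case using nn_integral_mono[of "\<mu> n" "lo k" "u n"] lo_u by (meson order.strict_trans2)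
    qed
  next
    fix a assume "(\<integral>\<^sup>+x. v x \<partial>\<nu>) < a"
    then have "(INF k. \<integral>\<^sup>+x. hi k x \<partial>\<nu>) < a" by (simp only: INF)
    then obtain k where "(\<integral>\<^sup>+x. hi k x \<partial>\<nu>) < a" by (auto simp: INF_less_iff)
    with hi_tendsto have "\<forall>\<^sub>F n in sequentially. (\<integral>\<^sup>+x. hi k x \<partial>\<mu> n) < a"
      by (rule order_tendstoD)
    then show "\<forall>\<^sub>F n in sequentially. (\<integral>\<^sup>+x. u n x \<partial>\<mu> n) < a"
      using eventually_ge_at_top[of k]
    proof eventually_elim
      case (elim n)
      then show ?case using nn_integral_mono[of "\<mu> n" "u n" "hi k"] hi_u by (meson order.strict_trans1)
    qed
  qed
qed

section \<open>The kernels and their test-function identities\<close>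

text \<open>The \<open>max 0 x\<close> keeps the base at least 1, so that \<open>wt_ge_1\<close> and
  \<open>wt_mono\<close> hold on the whole line without a case distinction at the boundary of the
  domain.\<close>

definition wt :: "real \<Rightarrow> real \<Rightarrow> ennreal" where
  "wt l x = ennreal ((1 + max 0 x) powr l)"

definition vt :: "real \<Rightarrow> ennreal" where
  "vt x = ennreal (1 + max 0 x)"

lemma wt_measurable [measurable]: "wt l \<in> borel_measurable borel"
  unfolding wt_def by measurable

lemma vt_measurable [measurable]: "vt \<in> borel_measurable borel"
  unfolding vt_def by measurable

lemma wt_ge_1: "0 \<le> l \<Longrightarrow> 1 \<le> wt l x"
  unfolding wt_def by (auto intro!: ge_one_powr_ge_zero simp flip: ennreal_1)

lemma vt_ge_1: "1 \<le> vt x"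
  unfolding vt_def by (auto simp flip: ennreal_1)

lemma wt_le_vt: "0 \<le> l \<Longrightarrow> l \<le> 1 \<Longrightarrow> wt l x \<le> vt x"
  unfolding wt_def vt_def using powr_mono[of l 1 "1 + max 0 x"] by (intro ennreal_leI) auto

lemma wt_mono: "0 \<le> l \<Longrightarrow> x \<le> y \<Longrightarrow> wt l x \<le> wt l y"
  unfolding wt_def by (auto intro!: ennreal_leI powr_mono2)

lemma wt_less_top [simp]: "wt l x < top" "wt l x \<noteq> top"
  unfolding wt_def by auto

lemma vt_less_top [simp]: "vt x < top" "vt x \<noteq> top"
  unfolding vt_def by auto

definition moment :: "(real \<Rightarrow> ennreal) \<Rightarrow> ennreal" where
  "moment f = (\<integral>\<^sup>+x. vt x * f x \<partial>lborel)"

definition mass :: "(real \<Rightarrow> ennreal) \<Rightarrow> ennreal" where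
  "mass f = (\<integral>\<^sup>+x. ennreal x * f x \<partial>lborel)"

definition rate ::
  "(real \<Rightarrow> real \<Rightarrow> ennreal) \<Rightarrow> (real \<Rightarrow> ennreal) \<Rightarrow> (real \<Rightarrow> ennreal) \<Rightarrow> real \<Rightarrow> ennreal" where
  "rate K S f x = (\<integral>\<^sup>+y. K x y * f y \<partial>lborel) + S x"

text \<open>Integrating over the whole line is harmless: the kernels used here vanish unless both
  sizes are positive, which leaves exactly 0 < y < x.\<close>

definition coag :: "(real \<Rightarrow> real \<Rightarrow> ennreal) \<Rightarrow> (real \<Rightarrow> ennreal) \<Rightarrow> real \<Rightarrow> ennreal" where
  "coag K f x = (\<integral>\<^sup>+y. K (x - y) y * f (x - y) * f y \<partial>lborel)"

definition frag :: "(real \<Rightarrow> real \<Rightarrow> ennreal) \<Rightarrow> (real \<Rightarrow> ennreal) \<Rightarrow> real \<Rightarrow> ennreal" where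
  "frag G f x = (\<integral>\<^sup>+y. G y x * f y \<partial>lborel)"

definition gain ::
  "(real \<Rightarrow> real \<Rightarrow> ennreal) \<Rightarrow> (real \<Rightarrow> real \<Rightarrow> ennreal) \<Rightarrow> (real \<Rightarrow> ennreal) \<Rightarrow> real \<Rightarrow> ennreal" where
  "gain K G f x = ennreal (1 / 2) * coag K f x + frag G f x"

text \<open>
  Subtraction on \<^typ>\<open>ennreal\<close> is truncated at \<open>0\<close>; the step sizes used below satisfy
  \<open>h * rate \<le> 1\<close>, so that no mass is lost by the truncation.
\<close>

definition euler ::
  "(real \<Rightarrow> real \<Rightarrow> ennreal) \<Rightarrow> (real \<Rightarrow> real \<Rightarrow> ennreal) \<Rightarrow> (real \<Rightarrow> ennreal) \<Rightarrow> ennreal \<Rightarrow>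
    (real \<Rightarrow> ennreal) \<Rightarrow> real \<Rightarrow> ennreal" where
  "euler K G S h f x = (1 - h * rate K S f x) * f x + h * gain K G f x"

definition density_fun :: "(real \<Rightarrow> ennreal) \<Rightarrow> bool" where
  "density_fun f \<longleftrightarrow> f \<in> borel_measurable borel \<and> (\<forall>x\<le>0. f x = 0)"

lemma density_fun_measurable [measurable_dest]: "density_fun f \<Longrightarrow> f \<in> borel_measurable borel"
  by (simp add: density_fun_def)

lemma density_fun_zero: "density_fun f \<Longrightarrow> x \<le> 0 \<Longrightarrow> f x = 0"
  by (simp add: density_fun_def)

lemma nn_integral_le_moment:
  "0 \<le> l \<Longrightarrow> l \<le> 1 \<Longrightarrow> (\<integral>\<^sup>+x. wt l x * f x \<partial>lborel) \<le> moment f"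
  unfolding moment_def by (intro nn_integral_mono mult_right_mono wt_le_vt) auto

lemma nn_integral_le_moment': "(\<integral>\<^sup>+x. f x \<partial>lborel) \<le> moment f"
  unfolding moment_def using mult_right_mono[OF vt_ge_1] by (intro nn_integral_mono) auto

lemma nn_integral_indicator_le: "(\<integral>\<^sup>+x. indicator E x * f x \<partial>M) \<le> (\<integral>\<^sup>+x. f x \<partial>M)"
  by (intro nn_integral_mono) (auto split: split_indicator)

lemma half_double_ennreal: "ennreal (1 / 2) * (a + a) = a"
proof -
  have "ennreal (1 / 2) * (a + a) = (ennreal (1 / 2) + ennreal (1 / 2)) * a"
    by (simp only: distrib_left distrib_right)
  also have "ennreal (1 / 2) + ennreal (1 / 2) = ennreal (1 / 2 + 1 / 2)"
    by (rule ennreal_plus[symmetric]) auto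
  finally show ?thesis by simp
qed

text \<open>
  Borel coefficients with values in \<^typ>\<open>ennreal\<close> that vanish outside the domain; \<open>G y x\<close> is
  \<open>\<Gamma>(y,x) = b(x,y) S(y)\<close>. The bounds \<open>C\<close>, \<open>N\<close>, \<open>s\<close>, \<open>k\<close>, \<open>d\<close> are parameters because the truncated
  coefficients have to satisfy the assumptions with the same bounds.
\<close>

locale coag_frag_kernels =
  fixes K G :: "real \<Rightarrow> real \<Rightarrow> ennreal" and S :: "real \<Rightarrow> ennreal" and l :: real and C N :: ennreal
    and s k :: "real \<Rightarrow> ennreal" and d :: "real \<Rightarrow> real \<Rightarrow> real"
  assumes K_pair: "case_prod K \<in> borel_measurable (borel \<Otimes>\<^sub>M borel)"
    and G_pair: "case_prod G \<in> borel_measurable (borel \<Otimes>\<^sub>M borel)"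
    and S_measurable [measurable]: "S \<in> borel_measurable borel"
    and l: "0 \<le> l" "l < 1"
    and C_fin: "C < top" and N_fin: "N < top" and s_fin: "\<And>R. s R < top" and k_fin: "\<And>R. k R < top"
    and K_sym: "\<And>x y. K x y = K y x"
    and K_zero: "\<And>x y. x \<le> 0 \<Longrightarrow> K x y = 0"
    and K_le: "\<And>x y. K x y \<le> C * wt l x * wt l y"
    and G_zero: "\<And>x y. x \<le> 0 \<or> y < x \<Longrightarrow> G y x = 0"
    and G_mass: "\<And>y. (\<integral>\<^sup>+x. ennreal x * G y x \<partial>lborel) = ennreal y * S y"
    and G_num: "\<And>y. (\<integral>\<^sup>+x. G y x \<partial>lborel) = N * S y"
    and S_le: "\<And>R y. 1 \<le> R \<Longrightarrow> y < R \<Longrightarrow> S y \<le> s R"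
    and G_tail: "\<And>R y x. 1 \<le> R \<Longrightarrow> R < y \<Longrightarrow> x < R \<Longrightarrow> G y x \<le> k R * wt l y"
    and G_ui: "\<And>R e y E. 1 \<le> R \<Longrightarrow> 0 < e \<Longrightarrow> y < R \<Longrightarrow> E \<in> sets borel \<Longrightarrow> E \<subseteq> {0<..<R} \<Longrightarrow>
      emeasure lborel E \<le> ennreal (d R e) \<Longrightarrow> (\<integral>\<^sup>+x. indicator E x * G y x \<partial>lborel) \<le> ennreal e"
    and d_pos: "\<And>R e. 1 \<le> R \<Longrightarrow> 0 < e \<Longrightarrow> 0 < d R e"
begin

lemma K_measurable [measurable (raw)]:
  "f \<in> borel_measurable M \<Longrightarrow> g \<in> borel_measurable M \<Longrightarrow> (\<lambda>x. K (f x) (g x)) \<in> borel_measurable M"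
  using measurable_compose[OF measurable_Pair K_pair] by simp

lemma G_measurable [measurable (raw)]:
  "f \<in> borel_measurable M \<Longrightarrow> g \<in> borel_measurable M \<Longrightarrow> (\<lambda>x. G (f x) (g x)) \<in> borel_measurable M"
  using measurable_compose[OF measurable_Pair G_pair] by simp

lemma K_zero': "y \<le> 0 \<Longrightarrow> K x y = 0"
  using K_sym K_zero by metis

lemma rate_measurable [measurable]:
  assumes [measurable]: "f \<in> borel_measurable borel"
  shows "rate K S f \<in> borel_measurable borel"
  unfolding rate_def by measurable

lemma coag_measurable [measurable]:
  assumes [measurable]: "f \<in> borel_measurable borel"
  shows "coag K f \<in> borel_measurable borel"
  unfolding coag_def by measurable

lemma frag_measurable [measurable]:
  assumes [measurable]: "f \<in> borel_measurable borel"
  shows "frag G f \<in> borel_measurable borel"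
  unfolding frag_def by measurable

lemma gain_measurable [measurable]:
  assumes [measurable]: "f \<in> borel_measurable borel"
  shows "gain K G f \<in> borel_measurable borel"
  unfolding gain_def by measurable

lemma euler_measurable [measurable]:
  assumes [measurable]: "f \<in> borel_measurable borel"
  shows "euler K G S h f \<in> borel_measurable borel"
  unfolding euler_def by measurable

lemma gain_zero:
  assumes "x \<le> 0"
  shows "gain K G f x = 0"
proof -
  have "K (x - y) y = 0" for y
    using assms K_zero[of "x - y" y] K_zero'[of y "x - y"] by (cases "y \<le> 0") auto
  then show ?thesis
    using assms by (simp add: gain_def coag_def frag_def G_zero)
qed

lemma density_fun_euler: "density_fun f \<Longrightarrow> density_fun (euler K G S h f)"
  using euler_measurable[of f h] by (auto simp: density_fun_def euler_def gain_zero)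

section \<open>Weak forms of gain and loss against a test function\<close>

lemma coag_test:
  assumes [measurable]: "f \<in> borel_measurable borel" "g \<in> borel_measurable borel"
  shows "(\<integral>\<^sup>+x. g x * coag K f x \<partial>lborel) =
    (\<integral>\<^sup>+y. \<integral>\<^sup>+x. g (x + y) * (K x y * f x * f y) \<partial>lborel \<partial>lborel)"
proof -
  have "(\<integral>\<^sup>+x. g x * coag K f x \<partial>lborel) =
      (\<integral>\<^sup>+x. \<integral>\<^sup>+y. g x * (K (x - y) y * f (x - y) * f y) \<partial>lborel \<partial>lborel)"
    unfolding coag_def by (subst nn_integral_cmult) auto
  also have "\<dots> = (\<integral>\<^sup>+y. \<integral>\<^sup>+x. g x * (K (x - y) y * f (x - y) * f y) \<partial>lborel \<partial>lborel)"
    by (rule lborel_pair.Fubini') measurable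
  also have "\<dots> = (\<integral>\<^sup>+y. \<integral>\<^sup>+x. g (x + y) * (K x y * f x * f y) \<partial>lborel \<partial>lborel)"
  proof (rule nn_integral_cong)
    fix y :: real
    show "(\<integral>\<^sup>+x. g x * (K (x - y) y * f (x - y) * f y) \<partial>lborel) =
        (\<integral>\<^sup>+x. g (x + y) * (K x y * f x * f y) \<partial>lborel)"
      by (subst nn_integral_real_affine[where c = 1 and t = y]) (auto simp: add.commute)
  qed
  finally show ?thesis .
qed

lemma frag_test:
  assumes [measurable]: "f \<in> borel_measurable borel" "g \<in> borel_measurable borel"
  shows "(\<integral>\<^sup>+x. g x * frag G f x \<partial>lborel) =
    (\<integral>\<^sup>+y. f y * (\<integral>\<^sup>+x. g x * G y x \<partial>lborel) \<partial>lborel)"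
proof -
  have "(\<integral>\<^sup>+x. g x * frag G f x \<partial>lborel) = (\<integral>\<^sup>+x. \<integral>\<^sup>+y. g x * (G y x * f y) \<partial>lborel \<partial>lborel)"
    unfolding frag_def by (subst nn_integral_cmult) auto
  also have "\<dots> = (\<integral>\<^sup>+y. \<integral>\<^sup>+x. g x * (G y x * f y) \<partial>lborel \<partial>lborel)"
    by (rule lborel_pair.Fubini') measurable
  also have "\<dots> = (\<integral>\<^sup>+y. f y * (\<integral>\<^sup>+x. g x * G y x \<partial>lborel) \<partial>lborel)"
    by (subst nn_integral_cmult[symmetric]) (auto simp: ac_simps)
  finally show ?thesis .
qed

lemma gain_test:
  assumes [measurable]: "f \<in> borel_measurable borel" "g \<in> borel_measurable borel"
  shows "(\<integral>\<^sup>+x. g x * gain K G f x \<partial>lborel) =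
    ennreal (1 / 2) * (\<integral>\<^sup>+y. \<integral>\<^sup>+x. g (x + y) * (K x y * f x * f y) \<partial>lborel \<partial>lborel) +
    (\<integral>\<^sup>+y. f y * (\<integral>\<^sup>+x. g x * G y x \<partial>lborel) \<partial>lborel)"
proof -
  have "(\<integral>\<^sup>+x. g x * gain K G f x \<partial>lborel) =
      (\<integral>\<^sup>+x. ennreal (1 / 2) * (g x * coag K f x) + g x * frag G f x \<partial>lborel)"
    unfolding gain_def by (simp add: distrib_left ac_simps)
  also have "\<dots> = ennreal (1 / 2) * (\<integral>\<^sup>+x. g x * coag K f x \<partial>lborel) + (\<integral>\<^sup>+x. g x * frag G f x \<partial>lborel)"
    by (subst nn_integral_add) (auto simp: nn_integral_cmult)
  finally show ?thesis by (simp add: coag_test frag_test)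
qed

lemma rate_test:
  assumes [measurable]: "f \<in> borel_measurable borel" "g \<in> borel_measurable borel"
  shows "(\<integral>\<^sup>+x. g x * (rate K S f x * f x) \<partial>lborel) =
    (\<integral>\<^sup>+y. \<integral>\<^sup>+x. g x * (K x y * f x * f y) \<partial>lborel \<partial>lborel) + (\<integral>\<^sup>+x. g x * (S x * f x) \<partial>lborel)"
proof -
  have "(\<integral>\<^sup>+x. g x * (rate K S f x * f x) \<partial>lborel) =
      (\<integral>\<^sup>+x. (\<integral>\<^sup>+y. g x * (K x y * f x * f y) \<partial>lborel) + g x * (S x * f x) \<partial>lborel)"
  proof (rule nn_integral_cong)
    fix x
    have "(\<integral>\<^sup>+y. g x * (K x y * f x * f y) \<partial>lborel) = (\<integral>\<^sup>+y. (g x * f x) * (K x y * f y) \<partial>lborel)"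
      by (simp add: ac_simps)
    also have "\<dots> = (g x * f x) * (\<integral>\<^sup>+y. K x y * f y \<partial>lborel)"
      by (rule nn_integral_cmult) auto
    finally show "g x * (rate K S f x * f x) =
        (\<integral>\<^sup>+y. g x * (K x y * f x * f y) \<partial>lborel) + g x * (S x * f x)"
      unfolding rate_def by (simp add: algebra_simps)
  qed
  also have "\<dots> = (\<integral>\<^sup>+x. \<integral>\<^sup>+y. g x * (K x y * f x * f y) \<partial>lborel \<partial>lborel) + (\<integral>\<^sup>+x. g x * (S x * f x) \<partial>lborel)"
    by (rule nn_integral_add) auto
  also have "(\<integral>\<^sup>+x. \<integral>\<^sup>+y. g x * (K x y * f x * f y) \<partial>lborel \<partial>lborel) =
      (\<integral>\<^sup>+y. \<integral>\<^sup>+x. g x * (K x y * f x * f y) \<partial>lborel \<partial>lborel)"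
    by (rule lborel_pair.Fubini') measurable
  finally show ?thesis .
qed

text \<open>The weight x is additive under coagulation: x + y splits into two terms that agree by
  symmetry of \<open>K\<close>, and the factor 1/2 absorbs the doubling. Breakage balances by
  \<open>G_mass\<close>. As an identity in \<open>ennreal\<close> it needs no finiteness.\<close>

lemma mass_balance:
  assumes f [measurable]: "f \<in> borel_measurable borel"
  shows "(\<integral>\<^sup>+x. ennreal x * gain K G f x \<partial>lborel) = (\<integral>\<^sup>+x. ennreal x * (rate K S f x * f x) \<partial>lborel)"
proof -
  let ?A = "\<integral>\<^sup>+y. \<integral>\<^sup>+x. ennreal x * (K x y * f x * f y) \<partial>lborel \<partial>lborel"
  have "(\<integral>\<^sup>+y. \<integral>\<^sup>+x. ennreal y * (K x y * f x * f y) \<partial>lborel \<partial>lborel) =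
      (\<integral>\<^sup>+x. \<integral>\<^sup>+y. ennreal y * (K x y * f x * f y) \<partial>lborel \<partial>lborel)"
    by (rule lborel_pair.Fubini') measurable
  also have "\<dots> = ?A"
    by (subst K_sym) (simp add: ac_simps)
  finally have sym: "(\<integral>\<^sup>+y. \<integral>\<^sup>+x. ennreal y * (K x y * f x * f y) \<partial>lborel \<partial>lborel) = ?A" .
  \<comment> \<open>\<open>ennreal\<close> sends negative reals to 0, so the sum splits only for
    nonnegative sizes; elsewhere the kernel vanishes.\<close>
  have "ennreal (x + y) * (K x y * f x * f y) =
      ennreal x * (K x y * f x * f y) + ennreal y * (K x y * f x * f y)" for x y
    by (cases "x \<le> 0 \<or> y \<le> 0") (auto simp: K_zero K_zero' distrib_right ennreal_plus)
  then have "(\<integral>\<^sup>+y. \<integral>\<^sup>+x. ennreal (x + y) * (K x y * f x * f y) \<partial>lborel \<partial>lborel) = ?A + ?A"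
    by (simp add: nn_integral_add sym)
  moreover have "(\<integral>\<^sup>+y. f y * (\<integral>\<^sup>+x. ennreal x * G y x \<partial>lborel) \<partial>lborel) =
      (\<integral>\<^sup>+x. ennreal x * (S x * f x) \<partial>lborel)"
    by (simp add: G_mass ac_simps)
  moreover have m: "ennreal \<in> borel_measurable borel" by measurable
  ultimately show ?thesis
    by (simp only: gain_test[OF f m] rate_test[OF f m] half_double_ennreal)
qed

text \<open>Parents below R + 1 yield at most \<open>N * s (R + 1)\<close> fragments in total;
  larger parents yield density at most \<open>k R * wt l y\<close> on an interval of length R.
  Splitting at R + 1 is due to the strict inequalities in \<open>S_le\<close> and
  \<open>G_tail\<close>, which at R would leave out a parent of size exactly R.\<close>

definition frag_const :: "real \<Rightarrow> ennreal" where
  "frag_const R = N * s (R + 1) + ennreal R * k R"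

lemma frag_const_fin: "frag_const R < top"
  using N_fin s_fin k_fin by (simp add: frag_const_def ennreal_mult_less_top)

lemma frag_le:
  assumes "1 \<le> R" "E \<in> sets borel" "E \<subseteq> {0<..<R}"
  shows "(\<integral>\<^sup>+x. indicator E x * G y x \<partial>lborel) \<le> frag_const R * wt l y"
proof (cases "y < R + 1")
  case True
  have "(\<integral>\<^sup>+x. indicator E x * G y x \<partial>lborel) \<le> N * S y"
    unfolding G_num[symmetric] by (rule nn_integral_indicator_le)
  also have "\<dots> \<le> frag_const R"
    unfolding frag_const_def using S_le[of "R + 1" y] True assms
    by (intro add_increasing2 mult_left_mono) auto
  also have "\<dots> \<le> frag_const R * wt l y"
    using mult_left_mono[OF wt_ge_1[OF l(1)]] by fastforce
  finally show ?thesis .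
next
  case False
  have "(\<integral>\<^sup>+x. indicator E x * G y x \<partial>lborel) \<le> (\<integral>\<^sup>+x. (k R * wt l y) * indicator {0<..<R} x \<partial>lborel)"
    using assms False G_tail[of R y] by (intro nn_integral_mono) (auto split: split_indicator)
  also have "\<dots> = ennreal R * k R * wt l y"
    using assms by (subst nn_integral_cmult_indicator) (auto simp: ac_simps)
  also have "\<dots> \<le> frag_const R * wt l y"
    unfolding frag_const_def by (intro mult_right_mono) auto
  finally show ?thesis .
qed

lemma frag_test_le:
  assumes [measurable]: "f \<in> borel_measurable borel"
    and E: "1 \<le> R" "E \<in> sets borel" "E \<subseteq> {0<..<R}"
  shows "(\<integral>\<^sup>+y. f y * (\<integral>\<^sup>+x. indicator E x * G y x \<partial>lborel) \<partial>lborel) \<le> frag_const R * moment f"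
proof -
  have "(\<integral>\<^sup>+y. f y * (\<integral>\<^sup>+x. indicator E x * G y x \<partial>lborel) \<partial>lborel) \<le>
      (\<integral>\<^sup>+y. f y * (frag_const R * vt y) \<partial>lborel)"
    using E wt_le_vt[of l] l
    by (intro nn_integral_mono mult_left_mono order_trans[OF frag_le mult_left_mono]) auto
  also have "\<dots> = (\<integral>\<^sup>+y. frag_const R * (vt y * f y) \<partial>lborel)" by (simp add: ac_simps)
  also have "\<dots> \<le> frag_const R * moment f"
    unfolding moment_def by (simp add: nn_integral_cmult)
  finally show ?thesis .
qed

end

section \<open>A priori estimates for one Euler step\<close>

lemma half_mult_le_ennreal: "ennreal (1 / 2) * a \<le> a"
proof -
  have "ennreal (1 / 2) \<le> ennreal 1" by (rule ennreal_leI) simp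
  from mult_right_mono[OF this, of a] show ?thesis by simp
qed

definition number :: "(real \<Rightarrow> ennreal) \<Rightarrow> ennreal" where
  "number f = (\<integral>\<^sup>+x. indicator {0<..<1} x * f x \<partial>lborel)"

text \<open>Mass is conserved, so only the number of particles below size 1 has to be followed in
  time. From size 1 on the weight 1 + x is at most 2x, hence the factor 2.\<close>

definition control :: "(real \<Rightarrow> ennreal) \<Rightarrow> ennreal" where
  "control f = number f + 2 * mass f"

lemma moment_le_control:
  assumes f: "density_fun f" shows "moment f \<le> control f"
proof -
  have [measurable]: "f \<in> borel_measurable borel" using f by (simp add: density_fun_def)
  have "vt x * f x \<le> indicator {0<..<1} x * f x + 2 * (ennreal x * f x)" for x
  proof -
    consider "x \<le> 0" | "0 < x" "x < 1" | "1 \<le> x" by linarith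
    then show ?thesis
    proof cases
      case 1
      then show ?thesis using f by (simp add: density_fun_zero)
    next
      case 2
      have "vt x \<le> 1 + 2 * ennreal x"
        using 2 by (simp add: vt_def ennreal_plus[symmetric] ennreal_mult[symmetric]
          del: ennreal_plus flip: ennreal_1 ennreal_numeral)
      then have "vt x * f x \<le> (1 + 2 * ennreal x) * f x" by (rule mult_right_mono) simp
      then show ?thesis using 2 by (simp add: algebra_simps)
    next
      case 3
      have "vt x \<le> 2 * ennreal x"
        using 3 by (simp add: vt_def ennreal_mult[symmetric] del: ennreal_plus flip: ennreal_numeral)
      then have "vt x * f x \<le> (2 * ennreal x) * f x" by (rule mult_right_mono) simp
      then show ?thesis using 3 by (simp add: algebra_simps)
    qed
  qed
  then have "moment f \<le> (\<integral>\<^sup>+x. indicator {0<..<1} x * f x + 2 * (ennreal x * f x) \<partial>lborel)"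
    unfolding moment_def by (intro nn_integral_mono) auto
  also have "\<dots> = control f"
    unfolding control_def number_def mass_def by (simp add: nn_integral_add nn_integral_cmult)
  finally show ?thesis .
qed

lemma mass_le_moment: "mass f \<le> moment f"
  unfolding mass_def moment_def vt_def
  by (intro nn_integral_mono mult_right_mono ennreal_leI) auto

lemma number_le_moment: "number f \<le> moment f"
  unfolding number_def moment_def using vt_ge_1
  by (intro nn_integral_mono mult_right_mono) (auto split: split_indicator)

lemma control_fin: "moment f < top \<Longrightarrow> control f < top"
  unfolding control_def using number_le_moment[of f] mass_le_moment[of f]
  by (auto simp: ennreal_mult_less_top)

context coag_frag_kernels
begin

text \<open>One constant for gain and loss in ]0,R[, where L bounds the moment: C L^2 covers
  coagulation in both directions, \<open>s (R + 1) * L\<close> the loss by breakage,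
  \<open>frag_const R * L\<close> the fragments gained.\<close>

definition flux_bound :: "real \<Rightarrow> ennreal \<Rightarrow> ennreal" where
  "flux_bound R L = (C * L + s (R + 1) + frag_const R) * L"

lemma flux_bound_fin: "L < top \<Longrightarrow> flux_bound R L < top"
  using C_fin s_fin frag_const_fin by (simp add: flux_bound_def ennreal_mult_less_top)

lemma kernel_integral_le:
  assumes [measurable]: "f \<in> borel_measurable borel" and L: "moment f \<le> L"
  shows "(\<integral>\<^sup>+y. K x y * f y \<partial>lborel) \<le> C * wt l x * L"
proof -
  have "(\<integral>\<^sup>+y. K x y * f y \<partial>lborel) \<le> (\<integral>\<^sup>+y. (C * wt l x) * (wt l y * f y) \<partial>lborel)"
    by (intro nn_integral_mono) (auto simp: mult.assoc[symmetric] intro!: mult_right_mono K_le)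
  also have "\<dots> = C * wt l x * (\<integral>\<^sup>+y. wt l y * f y \<partial>lborel)"
    by (rule nn_integral_cmult) measurable
  also have "\<dots> \<le> C * wt l x * L"
    using nn_integral_le_moment[of l f] l L by (intro mult_left_mono) auto
  finally show ?thesis .
qed

lemma double_integral_le:
  assumes [measurable]: "f \<in> borel_measurable borel" and L: "moment f \<le> L"
  shows "(\<integral>\<^sup>+y. \<integral>\<^sup>+x. K x y * f x * f y \<partial>lborel \<partial>lborel) \<le> C * L * L"
proof -
  have "(\<integral>\<^sup>+y. \<integral>\<^sup>+x. K x y * f x * f y \<partial>lborel \<partial>lborel) = (\<integral>\<^sup>+y. (\<integral>\<^sup>+x. K y x * f x \<partial>lborel) * f y \<partial>lborel)"
    by (subst nn_integral_multc[symmetric]) (auto simp: K_sym)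
  also have "\<dots> \<le> (\<integral>\<^sup>+y. (C * L) * (wt l y * f y) \<partial>lborel)"
  proof (rule nn_integral_mono)
    fix y
    have "(\<integral>\<^sup>+x. K y x * f x \<partial>lborel) * f y \<le> (C * wt l y * L) * f y"
      by (intro mult_right_mono kernel_integral_le[OF assms]) simp
    then show "(\<integral>\<^sup>+x. K y x * f x \<partial>lborel) * f y \<le> (C * L) * (wt l y * f y)"
      by (simp only: ac_simps)
  qed
  also have "\<dots> = (C * L) * (\<integral>\<^sup>+y. wt l y * f y \<partial>lborel)"
    by (rule nn_integral_cmult) measurable
  also have "\<dots> \<le> C * L * L"
    using nn_integral_le_moment[of l f] l L by (intro mult_left_mono) auto
  finally show ?thesis .
qed

lemma loss_set_le:
  assumes [measurable]: "f \<in> borel_measurable borel" and L: "moment f \<le> L"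
    and E [measurable]: "1 \<le> R" "E \<in> sets borel" "E \<subseteq> {0<..<R}"
  shows "(\<integral>\<^sup>+x. indicator E x * (rate K S f x * f x) \<partial>lborel) \<le> flux_bound R L"
proof -
  have "(\<integral>\<^sup>+y. \<integral>\<^sup>+x. indicator E x * (K x y * f x * f y) \<partial>lborel \<partial>lborel) \<le> C * L * L"
    using double_integral_le[OF assms(1) L]
    by (rule order_trans[rotated]) (intro nn_integral_mono nn_integral_indicator_le)
  moreover have "(\<integral>\<^sup>+x. indicator E x * (S x * f x) \<partial>lborel) \<le> s (R + 1) * L"
  proof -
    have "(\<integral>\<^sup>+x. indicator E x * (S x * f x) \<partial>lborel) \<le> (\<integral>\<^sup>+x. s (R + 1) * f x \<partial>lborel)"
      using E S_le[of "R + 1"]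
      by (intro nn_integral_mono) (auto split: split_indicator intro!: mult_right_mono)
    also have "\<dots> = s (R + 1) * (\<integral>\<^sup>+x. f x \<partial>lborel)" by (rule nn_integral_cmult) simp
    also have "\<dots> \<le> s (R + 1) * L"
      using nn_integral_le_moment'[of f] L by (intro mult_left_mono) auto
    finally show ?thesis .
  qed
  ultimately have "(\<integral>\<^sup>+x. indicator E x * (rate K S f x * f x) \<partial>lborel) \<le> C * L * L + s (R + 1) * L"
    unfolding rate_test[OF assms(1) borel_measurable_indicator[OF E(2)]] by (rule add_mono)
  also have "\<dots> \<le> flux_bound R L"
    unfolding flux_bound_def by (simp add: distrib_right)
  finally show ?thesis .
qed

lemma gain_set_le:
  assumes [measurable]: "f \<in> borel_measurable borel" and L: "moment f \<le> L"
    and E [measurable]: "1 \<le> R" "E \<in> sets borel" "E \<subseteq> {0<..<R}"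
  shows "(\<integral>\<^sup>+x. indicator E x * gain K G f x \<partial>lborel) \<le> flux_bound R L"
proof -
  have "(\<integral>\<^sup>+y. \<integral>\<^sup>+x. indicator E (x + y) * (K x y * f x * f y) \<partial>lborel \<partial>lborel) \<le>
    (\<integral>\<^sup>+y. \<integral>\<^sup>+x. K x y * f x * f y \<partial>lborel \<partial>lborel)"
    by (intro nn_integral_mono) (auto split: split_indicator)
  also have "\<dots> \<le> C * L * L" by (rule double_integral_le[OF assms(1) L])
  finally have "ennreal (1 / 2) *
      (\<integral>\<^sup>+y. \<integral>\<^sup>+x. indicator E (x + y) * (K x y * f x * f y) \<partial>lborel \<partial>lborel) \<le> C * L * L"
    using half_mult_le_ennreal order_trans by blast
  moreover have "(\<integral>\<^sup>+y. f y * (\<integral>\<^sup>+x. indicator E x * G y x \<partial>lborel) \<partial>lborel) \<le> frag_const R * L"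
    using frag_test_le[OF assms(1) E] L mult_left_mono[OF L] order_trans by fastforce
  ultimately have "(\<integral>\<^sup>+x. indicator E x * gain K G f x \<partial>lborel) \<le> C * L * L + frag_const R * L"
    unfolding gain_test[OF assms(1) borel_measurable_indicator[OF E(2)]] by (rule add_mono)
  also have "\<dots> \<le> C * L * L + frag_const R * L + s (R + 1) * L" by simp
  also have "\<dots> = flux_bound R L"
    unfolding flux_bound_def by (simp add: algebra_simps)
  finally show ?thesis .
qed

text \<open>With the loss on the left no integrals are subtracted, so the balance holds for every
  nonnegative test function, even if some terms are infinite. The assumption \<open>h\<close> makes
  \<open>1 - h * rate K S f x\<close> an exact difference.\<close>

lemma euler_test:
  assumes [measurable]: "f \<in> borel_measurable borel" "g \<in> borel_measurable borel"
    and h: "\<And>x. h * rate K S f x \<le> 1"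
  shows "(\<integral>\<^sup>+x. g x * euler K G S h f x \<partial>lborel) + h * (\<integral>\<^sup>+x. g x * (rate K S f x * f x) \<partial>lborel) =
    (\<integral>\<^sup>+x. g x * f x \<partial>lborel) + h * (\<integral>\<^sup>+x. g x * gain K G f x \<partial>lborel)"
proof -
  have "g x * euler K G S h f x + h * (g x * (rate K S f x * f x)) = g x * f x + h * (g x * gain K G f x)" for x
  proof -
    have "g x * euler K G S h f x + h * (g x * (rate K S f x * f x)) =
        ((1 - h * rate K S f x) + h * rate K S f x) * (g x * f x) + h * (g x * gain K G f x)"
      unfolding euler_def by (simp add: algebra_simps)
    then show ?thesis using diff_add_cancel_ennreal[OF h] by simp
  qed
  then have "(\<integral>\<^sup>+x. g x * euler K G S h f x + h * (g x * (rate K S f x * f x)) \<partial>lborel) =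
      (\<integral>\<^sup>+x. g x * f x + h * (g x * gain K G f x) \<partial>lborel)"
    by simp
  then show ?thesis
    by (simp add: nn_integral_add nn_integral_cmult)
qed

lemma mass_euler:
  assumes f [measurable]: "f \<in> borel_measurable borel"
    and h: "\<And>x. h * rate K S f x \<le> 1" and fin: "mass f < top"
  shows "mass (euler K G S h f) = mass f"
proof -
  let ?X = "\<integral>\<^sup>+x. ennreal x * (rate K S f x * f x) \<partial>lborel"
  have m: "ennreal \<in> borel_measurable borel" by measurable
  \<comment> \<open>Since step times rate is at most 1, the mass lost in one step is at most the
    mass present; it is therefore finite and can be cancelled from the balance.\<close>
  have "h * ?X = (\<integral>\<^sup>+x. (h * rate K S f x) * (ennreal x * f x) \<partial>lborel)"
    by (subst nn_integral_cmult[symmetric]) (auto simp: ac_simps)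
  also have "\<dots> \<le> (\<integral>\<^sup>+x. 1 * (ennreal x * f x) \<partial>lborel)"
    by (intro nn_integral_mono mult_right_mono h) auto
  finally have "h * ?X \<noteq> top" using fin by (auto simp: mass_def top_unique)
  moreover have "h * ?X + mass (euler K G S h f) = h * ?X + mass f"
    using euler_test[OF f m h] unfolding mass_balance[OF f] mass_def by (simp add: add.commute)
  ultimately show ?thesis by (simp add: ennreal_add_left_cancel)
qed

text \<open>A product of size below 1 comes from partners below 1, so the coagulation gain of small
  particles is dominated by their loss. After cancelling the loss, only fragments can increase the
  number.\<close>

lemma number_euler:
  assumes f [measurable]: "f \<in> borel_measurable borel"
    and h: "\<And>x. h * rate K S f x \<le> 1" and fin: "number f < top"
  shows "number (euler K G S h f) \<le> number f + h * (frag_const 1 * moment f)"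
proof -
  let ?g = "indicator {0<..<1} :: real \<Rightarrow> ennreal"
  let ?X = "\<integral>\<^sup>+x. ?g x * (rate K S f x * f x) \<partial>lborel"
  have g: "?g \<in> borel_measurable borel" by simp
  have "h * ?X = (\<integral>\<^sup>+x. (h * rate K S f x) * (?g x * f x) \<partial>lborel)"
    by (subst nn_integral_cmult[symmetric]) (auto simp: ac_simps)
  also have "\<dots> \<le> (\<integral>\<^sup>+x. 1 * (?g x * f x) \<partial>lborel)"
    by (intro nn_integral_mono mult_right_mono h) auto
  finally have X: "h * ?X \<noteq> top" using fin by (auto simp: number_def top_unique)
  have "(\<integral>\<^sup>+y. \<integral>\<^sup>+x. ?g (x + y) * (K x y * f x * f y) \<partial>lborel \<partial>lborel) \<le>
      (\<integral>\<^sup>+y. \<integral>\<^sup>+x. ?g x * (K x y * f x * f y) \<partial>lborel \<partial>lborel)"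
  proof (intro nn_integral_mono)
    fix x y
    show "?g (x + y) * (K x y * f x * f y) \<le> ?g x * (K x y * f x * f y)"
      by (cases "x \<le> 0 \<or> y \<le> 0") (auto simp: K_zero K_zero' split: split_indicator)
  qed
  also have "\<dots> \<le> ?X" unfolding rate_test[OF f g] by simp
  finally have "(\<integral>\<^sup>+x. ?g x * gain K G f x \<partial>lborel) \<le> ?X + frag_const 1 * moment f"
    unfolding gain_test[OF f g] using frag_test_le[OF f, of 1 "{0<..<1}"] half_mult_le_ennreal
    by (intro add_mono) (auto intro: order_trans)
  then have "h * (\<integral>\<^sup>+x. ?g x * gain K G f x \<partial>lborel) \<le> h * ?X + h * (frag_const 1 * moment f)"
    by (metis distrib_left mult_left_mono zero_le)
  then have "h * ?X + number (euler K G S h f) \<le> h * ?X + (number f + h * (frag_const 1 * moment f))"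
    using euler_test[OF f g h] unfolding number_def by (simp add: ac_simps add_left_mono)
  then show ?thesis using X by (simp add: ennreal_add_left_cancel_le)
qed

lemma control_euler:
  assumes f: "density_fun f" and h: "\<And>x. h * rate K S f x \<le> 1" and fin: "moment f < top"
  shows "control (euler K G S h f) \<le> (1 + h * frag_const 1) * control f"
proof -
  have fb: "f \<in> borel_measurable borel" using f by (simp add: density_fun_def)
  have "mass f < top" "number f < top"
    using fin mass_le_moment number_le_moment by (auto intro: order.strict_trans1)
  then have "control (euler K G S h f) \<le> (number f + h * (frag_const 1 * moment f)) + 2 * mass f"
    unfolding control_def using mass_euler[OF fb h] number_euler[OF fb h] by (intro add_mono) auto
  also have "\<dots> \<le> control f + h * (frag_const 1 * control f)"
    using mult_left_mono[OF mult_left_mono[OF moment_le_control[OF f], of "frag_const 1"], of h]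
    unfolding control_def[of f] by (simp add: ac_simps add_left_mono)
  finally show ?thesis by (simp add: distrib_right mult.assoc)
qed

text \<open>\<open>P\<close> bounds the integral of \<open>f\<close> over all subsets of ]0,R[ of
  measure at most \<open>\<delta>\<close>. With the partner y fixed, the coagulation gain on E
  involves only the translate E - y, which has the same measure, so the same \<open>P\<close>
  applies. For fragments, parents below R + 1 are covered by the modulus \<open>d (R + 1) e\<close>,
  larger ones by the pointwise bound of \<open>G_tail\<close> times |E|; these are the two
  conditions on \<open>\<delta>\<close>. The loss only decreases the integral and is
  dropped.\<close>

lemma set_euler_le:
  assumes f: "density_fun f" and L: "moment f \<le> L"
    and R: "1 \<le> R" and e: "0 < e" and \<delta>: "\<delta> \<le> d (R + 1) e" "k R * ennreal \<delta> \<le> ennreal e"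
    and P: "\<And>E. E \<in> sets borel \<Longrightarrow> E \<subseteq> {0<..<R} \<Longrightarrow> emeasure lborel E \<le> ennreal \<delta> \<Longrightarrow>
      (\<integral>\<^sup>+x. indicator E x * f x \<partial>lborel) \<le> P"
    and E: "E \<in> sets borel" "E \<subseteq> {0<..<R}" "emeasure lborel E \<le> ennreal \<delta>"
  shows "(\<integral>\<^sup>+x. indicator E x * euler K G S h f x \<partial>lborel) \<le>
    P + h * (C * wt l R * wt l R * L * P + ennreal e * L)"
proof -
  have [measurable]: "f \<in> borel_measurable borel" "E \<in> sets borel"
    using f E by (auto simp: density_fun_def)
  let ?c = "C * wt l R * wt l R"
  have in_y: "(\<integral>\<^sup>+x. indicator E (x + y) * (K x y * f x * f y) \<partial>lborel) \<le> ?c * P * f y" for y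
  proof (cases "0 < y \<and> y < R")
    case True
    \<comment> \<open>The positive part of the translate E - y; it stays inside ]0,R[ because y >
      0.\<close>
    define E' where "E' = {x. 0 < x \<and> x + y \<in> E}"
    have [measurable]: "E' \<in> sets borel" unfolding E'_def by measurable
    have "E' \<subseteq> {0<..<R}" using E(2) True by (force simp: E'_def)
    moreover have "emeasure lborel E' \<le> ennreal \<delta>"
    proof -
      have "emeasure lborel E' = (\<integral>\<^sup>+x. indicator E' x \<partial>lborel)" by simp
      also have "\<dots> \<le> (\<integral>\<^sup>+x. indicator E (y + 1 * x) \<partial>lborel)"
        by (intro nn_integral_mono) (auto simp: E'_def add.commute split: split_indicator)
      also have "\<dots> = (\<integral>\<^sup>+x. indicator E x \<partial>lborel)"
        by (subst nn_integral_real_affine[where c = 1 and t = y and f = "indicator E"]) auto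
      finally show ?thesis using E(3) by simp
    qed
    ultimately have P': "(\<integral>\<^sup>+x. indicator E' x * f x \<partial>lborel) \<le> P" using P by simp
    have "(\<integral>\<^sup>+x. indicator E (x + y) * (K x y * f x * f y) \<partial>lborel) \<le>
        (\<integral>\<^sup>+x. ?c * f y * (indicator E' x * f x) \<partial>lborel)"
    proof (rule nn_integral_mono)
      fix x
      show "indicator E (x + y) * (K x y * f x * f y) \<le> ?c * f y * (indicator E' x * f x)"
      proof (cases "0 < x \<and> x + y \<in> E")
        case xE: True
        then have "x \<le> R" "y \<le> R" using E(2) True by auto
        then have "K x y \<le> ?c"
          using K_le[of x y] wt_mono[OF l(1), of x R] wt_mono[OF l(1), of y R]
          by (elim order_trans) (intro mult_mono, auto)
        then have "K x y * (f x * f y) \<le> ?c * (f x * f y)" by (rule mult_right_mono) simp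
        then show ?thesis using xE by (simp add: E'_def ac_simps)
      next
        case False
        then show ?thesis by (auto simp: K_zero split: split_indicator)
      qed
    qed
    also have "\<dots> = ?c * f y * (\<integral>\<^sup>+x. indicator E' x * f x \<partial>lborel)"
      by (rule nn_integral_cmult) measurable
    also have "\<dots> \<le> ?c * P * f y"
      using mult_left_mono[OF P', of "?c * f y"] by (simp add: ac_simps)
    finally show ?thesis .
  next
    case False
    have z: "indicator E (x + y) * (K x y * f x * f y) = 0" for x
      using False E(2) by (cases "x \<le> 0 \<or> y \<le> 0") (auto simp: K_zero K_zero' split: split_indicator)
    show ?thesis unfolding z by simp
  qed
  have "ennreal (1 / 2) * (\<integral>\<^sup>+y. \<integral>\<^sup>+x. indicator E (x + y) * (K x y * f x * f y) \<partial>lborel \<partial>lborel) \<le>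
      (\<integral>\<^sup>+y. ?c * P * f y \<partial>lborel)"
    using half_mult_le_ennreal by (rule order_trans) (intro nn_integral_mono in_y)
  also have "\<dots> = ?c * P * (\<integral>\<^sup>+y. f y \<partial>lborel)" by (rule nn_integral_cmult) simp
  also have "\<dots> \<le> ?c * P * L"
    using nn_integral_le_moment'[of f] L by (intro mult_left_mono) auto
  finally have 1: "ennreal (1 / 2) *
      (\<integral>\<^sup>+y. \<integral>\<^sup>+x. indicator E (x + y) * (K x y * f x * f y) \<partial>lborel \<partial>lborel) \<le> ?c * P * L" .
  have in_y2: "(\<integral>\<^sup>+x. indicator E x * G y x \<partial>lborel) \<le> ennreal e * vt y" for y
  proof (cases "y < R + 1")
    case True
    have "(\<integral>\<^sup>+x. indicator E x * G y x \<partial>lborel) \<le> ennreal e"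
      using True R e E \<delta>(1) order_trans[OF E(3) ennreal_leI[OF \<delta>(1)]]
      by (intro G_ui[of "R + 1"]) auto
    also have "\<dots> \<le> ennreal e * vt y"
      using mult_left_mono[OF vt_ge_1] by fastforce
    finally show ?thesis .
  next
    case False
    have "(\<integral>\<^sup>+x. indicator E x * G y x \<partial>lborel) \<le> (\<integral>\<^sup>+x. (k R * wt l y) * indicator E x \<partial>lborel)"
      using E False R G_tail[of R y] by (intro nn_integral_mono) (auto split: split_indicator)
    also have "\<dots> = k R * wt l y * emeasure lborel E"
      by (rule nn_integral_cmult_indicator) simp
    also have "\<dots> \<le> k R * wt l y * ennreal \<delta>" by (intro mult_left_mono E(3)) simp
    also have "\<dots> = (k R * ennreal \<delta>) * wt l y" by (simp add: ac_simps)
    also have "\<dots> \<le> ennreal e * vt y"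
      using l wt_le_vt[of l y] by (intro mult_mono \<delta>(2)) auto
    finally show ?thesis .
  qed
  have "(\<integral>\<^sup>+y. f y * (\<integral>\<^sup>+x. indicator E x * G y x \<partial>lborel) \<partial>lborel) \<le> (\<integral>\<^sup>+y. f y * (ennreal e * vt y) \<partial>lborel)"
    by (intro nn_integral_mono mult_left_mono in_y2) simp
  also have "\<dots> = ennreal e * moment f"
    unfolding moment_def by (subst nn_integral_cmult[symmetric]) (auto simp: ac_simps)
  also have "\<dots> \<le> ennreal e * L" by (intro mult_left_mono L) simp
  finally have gain: "(\<integral>\<^sup>+x. indicator E x * gain K G f x \<partial>lborel) \<le> ?c * P * L + ennreal e * L"
    using 1 by (subst gain_test) (auto intro: add_mono)
  have "indicator E x * euler K G S h f x \<le> indicator E x * f x + h * (indicator E x * gain K G f x)" for x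
  proof -
    have "(1 - h * rate K S f x) * f x \<le> 1 * f x"
      by (rule mult_right_mono) (auto simp: diff_le_self_ennreal)
    then show ?thesis unfolding euler_def by (auto split: split_indicator)
  qed
  then have "(\<integral>\<^sup>+x. indicator E x * euler K G S h f x \<partial>lborel) \<le>
      (\<integral>\<^sup>+x. indicator E x * f x + h * (indicator E x * gain K G f x) \<partial>lborel)"
    by (rule nn_integral_mono)
  also have "\<dots> = (\<integral>\<^sup>+x. indicator E x * f x \<partial>lborel) + h * (\<integral>\<^sup>+x. indicator E x * gain K G f x \<partial>lborel)"
    by (simp add: nn_integral_add nn_integral_cmult)
  also have "\<dots> \<le> P + h * (?c * L * P + ennreal e * L)"
    using gain P[OF E] by (intro add_mono mult_left_mono) (auto simp: ac_simps)
  finally show ?thesis .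
qed

end

text \<open>The discrete Gronwall factor: steps of length \<open>\<eta>\<close> filling a time at
  most \<open>t\<close> cost a factor that does not depend on the step length.\<close>

lemma power_one_plus_le_exp:
  assumes "a < top" "0 \<le> \<eta>" "real j * \<eta> \<le> t"
  shows "(1 + ennreal \<eta> * a) ^ j \<le> ennreal (exp (enn2real a * t))"
proof -
  obtain r where r: "a = ennreal r" "0 \<le> r" using assms(1) by (auto simp: less_top_ennreal)
  have "(1 + \<eta> * r) ^ j \<le> exp (\<eta> * r) ^ j"
    using assms r exp_ge_add_one_self[of "\<eta> * r"] by (intro power_mono) auto
  also have "\<dots> = exp (r * (real j * \<eta>))" by (simp add: exp_of_nat_mult[symmetric] ac_simps)
  also have "\<dots> \<le> exp (r * t)" using assms r by (simp add: mult_left_mono)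
  finally have le: "(1 + \<eta> * r) ^ j \<le> exp (r * t)" .
  have "1 + ennreal \<eta> * a = ennreal 1 + ennreal (\<eta> * r)"
    using assms r by (simp add: ennreal_mult)
  also have "\<dots> = ennreal (1 + \<eta> * r)"
    using assms r by (intro ennreal_plus[symmetric]) auto
  finally have "(1 + ennreal \<eta> * a) ^ j = ennreal ((1 + \<eta> * r) ^ j)"
    using assms r ennreal_power[of "1 + \<eta> * r" j] by simp
  then show ?thesis using le r by (auto intro: ennreal_leI)
qed

section \<open>The truncated Euler scheme\<close>

lemma nn_integral_small_sets:
  fixes f :: "'a \<Rightarrow> ennreal"
  assumes [measurable]: "f \<in> borel_measurable M" and fin: "(\<integral>\<^sup>+x. f x \<partial>M) < top" and e: "0 < e"
  obtains \<delta> where "0 < \<delta>" "\<And>E. E \<in> sets M \<Longrightarrow> emeasure M E \<le> ennreal \<delta> \<Longrightarrow>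
    (\<integral>\<^sup>+x. indicator E x * f x \<partial>M) \<le> ennreal e"
proof -
  have "(SUP n. min (f x) (ennreal (real n))) = f x" for x
  proof (cases "f x = top")
    case True
    then show ?thesis by (simp add: ennreal_SUP_of_nat_eq_top ennreal_of_nat_eq_real_of_nat[symmetric])
  next
    case False
    then obtain r where r: "f x = ennreal r" "0 \<le> r" by (cases "f x") auto
    obtain n where "r \<le> real n" using real_arch_simple by blast
    then have "f x \<le> min (f x) (ennreal (real n))" using r by (simp add: ennreal_leI)
    then show ?thesis by (intro antisym SUP_least SUP_upper2[of n]) auto
  qed
  then have "(\<integral>\<^sup>+x. f x \<partial>M) = (\<integral>\<^sup>+x. (SUP n. min (f x) (ennreal (real n))) \<partial>M)" by simp
  also have "\<dots> = (SUP n. \<integral>\<^sup>+x. min (f x) (ennreal (real n)) \<partial>M)"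
    by (rule nn_integral_monotone_convergence_SUP)
       (auto simp: incseq_def le_fun_def intro!: min.coboundedI2 ennreal_leI)
  finally have SUP: "(\<integral>\<^sup>+x. f x \<partial>M) = (SUP n. \<integral>\<^sup>+x. min (f x) (ennreal (real n)) \<partial>M)" .
  obtain n where n: "(\<integral>\<^sup>+x. f x \<partial>M) \<le> (\<integral>\<^sup>+x. min (f x) (ennreal (real n)) \<partial>M) + ennreal (e / 2)"
  proof (cases "(\<integral>\<^sup>+x. f x \<partial>M) = 0")
    case True
    then show ?thesis by (intro that[of 0]) simp
  next
    case False
    have "(\<integral>\<^sup>+x. f x \<partial>M) - ennreal (e / 2) < (\<integral>\<^sup>+x. f x \<partial>M)"
      using False fin e by (intro ennreal_between) (auto simp: less_top zero_less_iff_neq_zero)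
    then obtain n where "(\<integral>\<^sup>+x. f x \<partial>M) - ennreal (e / 2) < (\<integral>\<^sup>+x. min (f x) (ennreal (real n)) \<partial>M)"
      by (subst (asm) (2) SUP) (auto simp: less_SUP_iff)
    then show ?thesis
      by (intro that[of n]) (metis add.commute ennreal_minus_le_iff less_imp_le)
  qed
  \<comment> \<open>Half of \<open>e\<close> pays for the part of \<open>f\<close> above level n,
    the other half for n times the measure of E; the \<open>+ 1\<close> avoids division by 0 when n
    = 0.\<close>
  define \<delta> where "\<delta> = e / (2 * (real n + 1))"
  show ?thesis
  proof (rule that)
    show "0 < \<delta>" using e by (simp add: \<delta>_def)
    fix E assume E [measurable]: "E \<in> sets M" and "emeasure M E \<le> ennreal \<delta>"
    let ?m = "\<lambda>x. min (f x) (ennreal (real n))"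
    have split: "(\<integral>\<^sup>+x. g x \<partial>M) = (\<integral>\<^sup>+x. indicator E x * g x \<partial>M) + (\<integral>\<^sup>+x. indicator (space M - E) x * g x \<partial>M)"
      if [measurable]: "g \<in> borel_measurable M" for g :: "'a \<Rightarrow> ennreal"
      by (subst nn_integral_add[symmetric]) (auto intro!: nn_integral_cong split: split_indicator)
    let ?r = "\<integral>\<^sup>+x. indicator (space M - E) x * f x \<partial>M"
    have "?r \<le> (\<integral>\<^sup>+x. f x \<partial>M)" by (rule nn_integral_indicator_le)
    then have r: "?r \<noteq> top" using fin by (auto simp: top_unique)
    have i2: "(\<integral>\<^sup>+x. indicator (space M - E) x * ?m x \<partial>M) \<le> ?r"
      by (intro nn_integral_mono mult_left_mono) auto
    have i1: "(\<integral>\<^sup>+x. indicator E x * ?m x \<partial>M) \<le> ennreal (e / 2)"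
    proof -
      have "(\<integral>\<^sup>+x. indicator E x * ?m x \<partial>M) \<le> (\<integral>\<^sup>+x. ennreal (real n) * indicator E x \<partial>M)"
        by (intro nn_integral_mono) (auto split: split_indicator)
      also have "\<dots> = ennreal (real n) * emeasure M E" by (rule nn_integral_cmult_indicator) simp
      also have "\<dots> \<le> ennreal (real n) * ennreal \<delta>"
        by (intro mult_left_mono \<open>emeasure M E \<le> ennreal \<delta>\<close>) simp
      also have "\<dots> = ennreal (real n * \<delta>)" by (simp add: ennreal_mult')
      also have "\<dots> \<le> ennreal (e / 2)"
        using e by (intro ennreal_leI) (simp add: \<delta>_def field_simps)
      finally show ?thesis .
    qed
    have m_split: "(\<integral>\<^sup>+x. ?m x \<partial>M) =
        (\<integral>\<^sup>+x. indicator E x * ?m x \<partial>M) + (\<integral>\<^sup>+x. indicator (space M - E) x * ?m x \<partial>M)"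
      by (rule split) simp
    have "(\<integral>\<^sup>+x. indicator E x * f x \<partial>M) + ?r \<le> (\<integral>\<^sup>+x. ?m x \<partial>M) + ennreal (e / 2)"
      using n split[OF assms(1)] by simp
    also have "\<dots> \<le> ennreal (e / 2) + ?r + ennreal (e / 2)"
      unfolding m_split by (intro add_mono i1 i2 order_refl)
    finally have "?r + (\<integral>\<^sup>+x. indicator E x * f x \<partial>M) \<le> ?r + (ennreal (e / 2) + ennreal (e / 2))"
      by (simp only: ac_simps)
    then have "(\<integral>\<^sup>+x. indicator E x * f x \<partial>M) \<le> ennreal (e / 2) + ennreal (e / 2)"
      using r by (simp add: ennreal_add_left_cancel_le)
    also have "\<dots> = ennreal e" using e by (simp add: ennreal_plus[symmetric] del: ennreal_plus)
    finally show "(\<integral>\<^sup>+x. indicator E x * f x \<partial>M) \<le> ennreal e" .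
  qed
qed

text \<open>The cut-off is in x + y, which keeps the kernel symmetric and switches a pair off in
  gain and loss simultaneously.\<close>

definition trunc_K :: "(real \<Rightarrow> real \<Rightarrow> ennreal) \<Rightarrow> real \<Rightarrow> real \<Rightarrow> real \<Rightarrow> ennreal" where
  "trunc_K K r x y = indicator {..<r} (x + y) * K x y"

text \<open>The cut-off involves the parent size only: each parent keeps all of its fragments or
  none, so the identities for mass and number survive exactly with \<open>trunc_S\<close>.\<close>

definition trunc_G :: "(real \<Rightarrow> real \<Rightarrow> ennreal) \<Rightarrow> real \<Rightarrow> real \<Rightarrow> real \<Rightarrow> ennreal" where
  "trunc_G G r y x = indicator {..<r} y * G y x"

definition trunc_S :: "(real \<Rightarrow> ennreal) \<Rightarrow> real \<Rightarrow> real \<Rightarrow> ennreal" where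
  "trunc_S S r y = indicator {..<r} y * S y"

context coag_frag_kernels
begin

lemma truncated_kernels: "coag_frag_kernels (trunc_K K r) (trunc_G G r) (trunc_S S r) l C N s k d"
proof
  show "case_prod (trunc_K K r) \<in> borel_measurable (borel \<Otimes>\<^sub>M borel)"
    unfolding trunc_K_def by measurable
  show "case_prod (trunc_G G r) \<in> borel_measurable (borel \<Otimes>\<^sub>M borel)"
    unfolding trunc_G_def by measurable
  show "trunc_S S r \<in> borel_measurable borel" unfolding trunc_S_def by measurable
  show "trunc_K K r x y = trunc_K K r y x" for x y
    by (simp add: trunc_K_def K_sym add.commute)
  show "trunc_K K r x y = 0" if "x \<le> 0" for x y using that by (simp add: trunc_K_def K_zero)
  show "trunc_K K r x y \<le> C * wt l x * wt l y" for x y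
    using K_le by (auto simp: trunc_K_def split: split_indicator)
  show "trunc_G G r y x = 0" if "x \<le> 0 \<or> y < x" for x y using that by (simp add: trunc_G_def G_zero)
  show "(\<integral>\<^sup>+x. ennreal x * trunc_G G r y x \<partial>lborel) = ennreal y * trunc_S S r y" for y
    using G_mass by (auto simp: trunc_G_def trunc_S_def split: split_indicator)
  show "(\<integral>\<^sup>+x. trunc_G G r y x \<partial>lborel) = N * trunc_S S r y" for y
    using G_num by (auto simp: trunc_G_def trunc_S_def split: split_indicator)
  show "trunc_S S r y \<le> s R" if "1 \<le> R" "y < R" for R y
    using S_le[OF that] by (auto simp: trunc_S_def split: split_indicator)
  show "trunc_G G r y x \<le> k R * wt l y" if "1 \<le> R" "R < y" "x < R" for R y x
    using G_tail[OF that] by (auto simp: trunc_G_def split: split_indicator)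
  show "(\<integral>\<^sup>+x. indicator E x * trunc_G G r y x \<partial>lborel) \<le> ennreal e"
    if "1 \<le> R" "0 < e" "y < R" "E \<in> sets borel" "E \<subseteq> {0<..<R}" "emeasure lborel E \<le> ennreal (d R e)" for R e y E
    using G_ui[OF that] by (auto simp: trunc_G_def split: split_indicator)
qed (use l C_fin N_fin s_fin k_fin d_pos in auto)

end

section \<open>The Euler iterates and their uniform bounds\<close>

locale coag_frag_problem = coag_frag_kernels +
  fixes f0 :: "real \<Rightarrow> ennreal"
  assumes f0: "density_fun f0" and f0_fin: "moment f0 < top"
begin

lemma f0_measurable [measurable]: "f0 \<in> borel_measurable borel"
  using f0 by (simp add: density_fun_def)

abbreviation "Kn n \<equiv> trunc_K K (real n)"
abbreviation "Gn n \<equiv> trunc_G G (real n)"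
abbreviation "Sn n \<equiv> trunc_S S (real n)"

text \<open>The growth rate is \<open>frag_const 1\<close> because only fragments below size 1 can
  increase \<open>control\<close> in a step.\<close>

definition mbound :: "real \<Rightarrow> ennreal" where
  "mbound t = ennreal (exp (enn2real (frag_const 1) * t)) * control f0"

lemma mbound_fin: "mbound t < top"
  using control_fin[OF f0_fin] by (simp add: mbound_def ennreal_mult_less_top)

lemma mbound_mono: "t \<le> u \<Longrightarrow> mbound t \<le> mbound u"
  unfolding mbound_def by (intro mult_right_mono ennreal_leI) (auto intro: mult_left_mono)

text \<open>Bounds the total rate of the coefficients cut at n as long as the moment is at most
  \<open>mbound (real n)\<close>: only sizes below n interact. The argument n + 1 meets the
  condition 1 <= R of \<open>S_le\<close> also for n = 0.\<close>

definition rate_bound :: "nat \<Rightarrow> ennreal" where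
  "rate_bound n = C * wt l (real n) * wt l (real n) * mbound (real n) + s (real n + 1)"

lemma rate_bound_fin: "rate_bound n < top"
  using C_fin s_fin mbound_fin by (simp add: rate_bound_def ennreal_mult_less_top)

text \<open>The factor n + 1 drives the steps to 0; the factor 1 + \<open>rate_bound n\<close> makes
  step times rate at most 1.\<close>

definition tau :: "nat \<Rightarrow> real" where
  "tau n = 1 / ((real n + 1) * (1 + enn2real (rate_bound n)))"

lemma tau_pos: "0 < tau n"
  unfolding tau_def by (intro divide_pos_pos mult_pos_pos) (auto intro: add_pos_nonneg)

lemma tau_le: "tau n \<le> 1 / (real n + 1)"
proof -
  have "(real n + 1) * 1 \<le> (real n + 1) * (1 + enn2real (rate_bound n))"
    by (intro mult_left_mono) auto
  then show ?thesis
    unfolding tau_def using frac_le[of 1 1 "real n + 1"] by simp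
qed

lemma tau_tendsto: "tau \<longlonglongrightarrow> 0"
proof (rule tendsto_sandwich[where f = "\<lambda>_. 0" and h = "\<lambda>n. 1 / (real n + 1)"])
  show "\<forall>\<^sub>F n in sequentially. tau n \<le> 1 / (real n + 1)" using tau_le by simp
  show "(\<lambda>n. 1 / (real n + 1)) \<longlonglongrightarrow> 0"
    using LIMSEQ_inverse_real_of_nat by (simp add: inverse_eq_divide add.commute)
  show "(\<lambda>n. 0 :: real) \<longlonglongrightarrow> 0" by simp
  show "\<forall>\<^sub>F n in sequentially. 0 \<le> tau n" by (simp add: less_imp_le[OF tau_pos])
qed

lemma tau_rate: "ennreal (tau n) * rate_bound n \<le> 1"
proof -
  obtain r where r: "rate_bound n = ennreal r" "0 \<le> r"
    using rate_bound_fin[of n] by (auto simp: less_top_ennreal)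
  have "1 * r \<le> (real n + 1) * (1 + r)" using r by (intro mult_mono) auto
  then have "tau n * r \<le> 1"
    using r by (simp add: tau_def divide_le_eq)
  then have "ennreal (tau n * r) \<le> ennreal 1" by (rule ennreal_leI)
  then show ?thesis using r tau_pos[of n] by (simp add: ennreal_mult)
qed

definition scheme :: "nat \<Rightarrow> nat \<Rightarrow> real \<Rightarrow> ennreal" where
  "scheme n j = (euler (Kn n) (Gn n) (Sn n) (ennreal (tau n)) ^^ j) f0"

lemma scheme_0: "scheme n 0 = f0"
  by (simp add: scheme_def)

lemma scheme_Suc: "scheme n (Suc j) = euler (Kn n) (Gn n) (Sn n) (ennreal (tau n)) (scheme n j)"
  by (simp add: scheme_def)

lemma step_rate_le_1:
  assumes f: "density_fun f" and m: "moment f \<le> mbound (real n)"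
  shows "ennreal (tau n) * rate (Kn n) (Sn n) f x \<le> 1"
proof -
  have [measurable]: "f \<in> borel_measurable borel" using f by (simp add: density_fun_def)
  have "(\<integral>\<^sup>+y. Kn n x y * f y \<partial>lborel) \<le> (\<integral>\<^sup>+y. (C * wt l (real n) * wt l (real n)) * f y \<partial>lborel)"
  proof (intro nn_integral_mono mult_right_mono)
    fix y
    show "Kn n x y \<le> C * wt l (real n) * wt l (real n)"
    proof (cases "0 < x \<and> 0 < y \<and> x + y < real n")
      case True
      then have "C * wt l x * wt l y \<le> C * wt l (real n) * wt l (real n)"
        by (intro mult_mono wt_mono l) auto
      with K_le[of x y] show ?thesis by (auto simp: trunc_K_def split: split_indicator)
    next
      case False
      then show ?thesis using K_zero[of x y] K_zero'[of y x]
        by (auto simp: trunc_K_def not_less split: split_indicator)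
    qed
  qed simp
  also have "\<dots> = C * wt l (real n) * wt l (real n) * (\<integral>\<^sup>+y. f y \<partial>lborel)"
    by (rule nn_integral_cmult) simp
  also have "\<dots> \<le> C * wt l (real n) * wt l (real n) * mbound (real n)"
    using nn_integral_le_moment'[of f] m by (intro mult_left_mono) auto
  finally have "rate (Kn n) (Sn n) f x \<le> rate_bound n"
    unfolding rate_def rate_bound_def using S_le[of "real n + 1" x]
    by (intro add_mono) (auto simp: trunc_S_def split: split_indicator)
  then have "ennreal (tau n) * rate (Kn n) (Sn n) f x \<le> ennreal (tau n) * rate_bound n"
    by (rule mult_left_mono) simp
  with tau_rate show ?thesis by (rule order_trans[rotated])
qed

lemma density_fun_scheme: "density_fun (scheme n j)"
proof (induction j)
  case (Suc j)
  interpret tr: coag_frag_kernels "Kn n" "Gn n" "Sn n" l C N s k d by (rule truncated_kernels)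
  show ?case unfolding scheme_Suc by (rule tr.density_fun_euler[OF Suc])
qed (simp add: scheme_0 f0)

lemma scheme_measurable [measurable]: "scheme n j \<in> borel_measurable borel"
  using density_fun_scheme by (simp add: density_fun_def)

text \<open>The step condition itself depends on the moment of the current iterate, so conservation
  of mass and the growth bound must be carried through one induction: the bound at step j licenses
  step j + 1. The horizon is n because \<open>tau n\<close> is calibrated to
  \<open>mbound (real n)\<close>.\<close>

lemma scheme_bounds:
  assumes "real j * tau n \<le> real n"
  shows "mass (scheme n j) = mass f0 \<and> control (scheme n j) \<le> (1 + ennreal (tau n) * frag_const 1) ^ j * control f0"
  using assms
proof (induction j)
  case (Suc j)
  interpret tr: coag_frag_kernels "Kn n" "Gn n" "Sn n" l C N s k d by (rule truncated_kernels)
  have j: "real j * tau n \<le> real n"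
    using Suc.prems tau_pos[of n] by (simp add: algebra_simps)
  note IH = Suc.IH[OF j]
  have "(1 + ennreal (tau n) * frag_const 1) ^ j * control f0 \<le> mbound (real n)"
    unfolding mbound_def
    by (intro mult_right_mono power_one_plus_le_exp frag_const_fin less_imp_le[OF tau_pos] j) simp
  then have m: "moment (scheme n j) \<le> mbound (real n)"
    using IH moment_le_control[OF density_fun_scheme] by (meson order_trans)
  then have fin: "moment (scheme n j) < top" using mbound_fin by (rule order.strict_trans1)
  note h = step_rate_le_1[OF density_fun_scheme m]
  have "mass (scheme n (Suc j)) = mass (scheme n j)"
    unfolding scheme_Suc using fin mass_le_moment order.strict_trans1
    by (intro tr.mass_euler h) (auto simp: scheme_measurable)
  moreover have "control (scheme n (Suc j)) \<le> (1 + ennreal (tau n) * frag_const 1) * control (scheme n j)"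
    unfolding scheme_Suc by (rule tr.control_euler[OF density_fun_scheme h fin])
  ultimately show ?case
    using IH mult_left_mono[of "control (scheme n j)" _ "1 + ennreal (tau n) * frag_const 1"]
    by (auto simp: mult.assoc intro: order_trans)
qed (simp add: scheme_0)

lemma moment_scheme_le:
  assumes "real j * tau n \<le> t" "real j * tau n \<le> real n"
  shows "moment (scheme n j) \<le> mbound t"
proof -
  have "moment (scheme n j) \<le> control (scheme n j)"
    by (rule moment_le_control[OF density_fun_scheme])
  also have "\<dots> \<le> (1 + ennreal (tau n) * frag_const 1) ^ j * control f0"
    using scheme_bounds[of j n] assms by simp
  also have "\<dots> \<le> mbound t"
    unfolding mbound_def
    by (intro mult_right_mono power_one_plus_le_exp frag_const_fin less_imp_le[OF tau_pos] assms) simp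
  finally show ?thesis .
qed

text \<open>Iterates \<open>set_euler_le\<close>. Its estimate P + tau (c L P + e1 L) is an affine
  recursion, which becomes a linear one for P + e1 L. The resulting \<open>\<delta>\<close> depends
  neither on n nor on j.\<close>

lemma scheme_small_sets:
  assumes R: "1 \<le> R" and e: "0 < e"
  obtains \<delta> where "0 < \<delta>" "\<And>n j E. real j * tau n \<le> t \<Longrightarrow> real j * tau n \<le> real n \<Longrightarrow> E \<in> sets borel \<Longrightarrow> E \<subseteq> {0<..<R} \<Longrightarrow>
    emeasure lborel E \<le> ennreal \<delta> \<Longrightarrow> (\<integral>\<^sup>+x. indicator E x * scheme n j x \<partial>lborel) \<le> ennreal e"
proof -
  define L where "L = mbound t"
  \<comment> \<open>Growth rate of P + e1 L: the first term is the coagulation rate, the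
    \<open>+ 1\<close> absorbs the inhomogeneity e1 L coming from fragmentation.\<close>
  define A where "A = C * wt l R * wt l R * L + 1"
  \<comment> \<open>The final bound will be \<open>e1 * B\<close>, whence
    \<open>e1 = e / (B + 1)\<close>.\<close>
  define B where "B = enn2real (ennreal (exp (enn2real A * t)) * (1 + L))"
  have A_fin: "A < top" and L_fin: "L < top"
    using C_fin mbound_fin by (auto simp: A_def L_def ennreal_mult_less_top)
  have B: "ennreal B = ennreal (exp (enn2real A * t)) * (1 + L)"
    unfolding B_def using L_fin by (intro ennreal_enn2real) (simp add: ennreal_mult_less_top)
  have B0: "0 \<le> B" by (simp add: B_def)
  define e1 where "e1 = e / (B + 1)"
  have e1: "0 < e1" using e B0 by (simp add: e1_def)
  have "(\<integral>\<^sup>+x. f0 x \<partial>lborel) < top" using nn_integral_le_moment' f0_fin by (rule order.strict_trans1)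
  from nn_integral_small_sets[OF _ this e1] obtain \<delta>0 where \<delta>0: "0 < \<delta>0"
    "\<And>E. E \<in> sets lborel \<Longrightarrow> emeasure lborel E \<le> ennreal \<delta>0 \<Longrightarrow> (\<integral>\<^sup>+x. indicator E x * f0 x \<partial>lborel) \<le> ennreal e1"
    by auto
  obtain kr where kr: "k R = ennreal kr" "0 \<le> kr" using k_fin[of R] by (auto simp: less_top_ennreal)
  \<comment> \<open>Three demands: absolute continuity of the initial integral, the modulus for
    parents below R + 1, and k R times \<open>\<delta>\<close> at most e1 for larger
    parents.\<close>
  define \<delta> where "\<delta> = min \<delta>0 (min (d (R + 1) e1) (e1 / (kr + 1)))"
  have \<delta>: "0 < \<delta>" using \<delta>0(1) e1 d_pos[of "R + 1" e1] kr R by (simp add: \<delta>_def)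
  have "kr * \<delta> \<le> (kr + 1) * (e1 / (kr + 1))" using \<delta> kr by (intro mult_mono) (auto simp: \<delta>_def)
  then have "kr * \<delta> \<le> e1" using kr by simp
  then have k\<delta>: "k R * ennreal \<delta> \<le> ennreal e1"
    using kr \<delta> by (simp add: ennreal_mult[symmetric] ennreal_leI)
  have main: "(\<integral>\<^sup>+x. indicator E x * scheme n j x \<partial>lborel) + ennreal e1 * L \<le>
      (1 + ennreal (tau n) * A) ^ j * (ennreal e1 + ennreal e1 * L)"
    if "real j * tau n \<le> t" "real j * tau n \<le> real n" "E \<in> sets borel" "E \<subseteq> {0<..<R}" "emeasure lborel E \<le> ennreal \<delta>" for n j E
    using that
  proof (induction j arbitrary: E)
    case 0
    have "ennreal \<delta> \<le> ennreal \<delta>0" by (rule ennreal_leI) (simp add: \<delta>_def)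
    then show ?case using 0 \<delta>0(2)[of E] by (auto simp: scheme_0 intro!: add_mono)
  next
    case (Suc j)
    interpret tr: coag_frag_kernels "Kn n" "Gn n" "Sn n" l C N s k d by (rule truncated_kernels)
    have j: "real j * tau n \<le> t" and jn: "real j * tau n \<le> real n"
      using Suc.prems tau_pos[of n] by (simp_all add: algebra_simps)
    \<comment> \<open>\<open>P\<close> is recovered from the linear quantity \<open>Q\<close> by a
      subtraction in \<open>ennreal\<close>; it is exact because the induction hypothesis for the
      empty set gives \<open>ennreal e1 * L \<le> Q\<close>.\<close>
    define Q where "Q = (1 + ennreal (tau n) * A) ^ j * (ennreal e1 + ennreal e1 * L)"
    define P where "P = Q - ennreal e1 * L"
    have eL: "ennreal e1 * L \<noteq> top" using L_fin by (auto simp: ennreal_mult_eq_top_iff)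
    have le: "ennreal e1 * L \<le> Q"
      using Suc.IH[of "{}"] j jn by (simp add: Q_def)
    have PQ: "P + ennreal e1 * L = Q" unfolding P_def using le by (rule diff_add_cancel_ennreal)
    have P: "(\<integral>\<^sup>+x. indicator F x * scheme n j x \<partial>lborel) \<le> P"
      if "F \<in> sets borel" "F \<subseteq> {0<..<R}" "emeasure lborel F \<le> ennreal \<delta>" for F
      using Suc.IH[OF j jn that] eL unfolding Q_def[symmetric] PQ[symmetric]
      by (simp add: add.commute ennreal_add_left_cancel_le)
    have "(\<integral>\<^sup>+x. indicator E x * scheme n (Suc j) x \<partial>lborel) \<le>
        P + ennreal (tau n) * (C * wt l R * wt l R * L * P + ennreal e1 * L)"
      unfolding scheme_Suc using moment_scheme_le[OF j jn] Suc.prems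
      by (intro tr.set_euler_le[OF density_fun_scheme _ R e1 _ k\<delta> P]) (auto simp: L_def \<delta>_def)
    then have "(\<integral>\<^sup>+x. indicator E x * scheme n (Suc j) x \<partial>lborel) + ennreal e1 * L \<le>
        P + ennreal (tau n) * (C * wt l R * wt l R * L * P + ennreal e1 * L) + ennreal e1 * L"
      by (rule add_right_mono)
    also have "\<dots> \<le> Q + ennreal (tau n) * (A * Q)"
    proof -
      have "C * wt l R * wt l R * L * P \<le> C * wt l R * wt l R * L * Q"
        by (intro mult_left_mono) (auto simp: PQ[symmetric])
      then have "C * wt l R * wt l R * L * P + ennreal e1 * L \<le> A * Q"
        using le unfolding A_def by (simp add: distrib_right add_mono)
      then have "ennreal (tau n) * (C * wt l R * wt l R * L * P + ennreal e1 * L) \<le> ennreal (tau n) * (A * Q)"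
        by (rule mult_left_mono) simp
      then show ?thesis unfolding PQ[symmetric] by (simp add: ac_simps add_left_mono)
    qed
    also have "\<dots> = (1 + ennreal (tau n) * A) ^ Suc j * (ennreal e1 + ennreal e1 * L)"
      unfolding Q_def by (simp add: algebra_simps)
    finally show ?case .
  qed
  show ?thesis
  proof (rule that[OF \<delta>])
    fix n j E assume H: "real j * tau n \<le> t" "real j * tau n \<le> real n" "E \<in> sets borel" "E \<subseteq> {0<..<R}"
      "emeasure lborel E \<le> ennreal \<delta>"
    have "(\<integral>\<^sup>+x. indicator E x * scheme n j x \<partial>lborel) \<le> (\<integral>\<^sup>+x. indicator E x * scheme n j x \<partial>lborel) + ennreal e1 * L"
      by simp
    also have "\<dots> \<le> (1 + ennreal (tau n) * A) ^ j * (ennreal e1 + ennreal e1 * L)"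
      by (rule main[OF H])
    also have "\<dots> \<le> ennreal (exp (enn2real A * t)) * (ennreal e1 + ennreal e1 * L)"
      by (intro mult_right_mono power_one_plus_le_exp A_fin less_imp_le[OF tau_pos] H) simp
    also have "\<dots> = ennreal e1 * ennreal B" unfolding B by (simp add: algebra_simps)
    also have "\<dots> = ennreal (e1 * B)" using e1 B0 by (simp add: ennreal_mult)
    also have "e1 * B \<le> e" using e B0 by (simp add: e1_def field_simps)
    finally show "(\<integral>\<^sup>+x. indicator E x * scheme n j x \<partial>lborel) \<le> ennreal e"
      by (simp add: ennreal_leI)
  qed
qed

text \<open>The time is capped at n because the bounds on the n-th scheme are established only up to
  time n.\<close>

definition idx :: "nat \<Rightarrow> real \<Rightarrow> nat" where
  "idx n t = nat \<lfloor>min t (real n) / tau n\<rfloor>"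

lemma idx_le: "0 \<le> t \<Longrightarrow> real (idx n t) * tau n \<le> min t (real n)"
proof -
  assume "0 \<le> t"
  then have "0 \<le> min t (real n) / tau n" using tau_pos[of n] by simp
  then have "real (idx n t) \<le> min t (real n) / tau n" unfolding idx_def by (rule of_nat_floor)
  then show ?thesis using tau_pos[of n] by (simp add: pos_le_divide_eq del: min.bounded_iff)
qed

lemma idx_gt: "0 \<le> t \<Longrightarrow> min t (real n) < real (idx n t) * tau n + tau n"
proof -
  assume t: "0 \<le> t"
  have "min t (real n) / tau n < real (idx n t) + 1"
    using t tau_pos[of n] real_of_int_floor_add_one_gt[of "min t (real n) / tau n"]
    by (simp add: idx_def)
  then show ?thesis using tau_pos[of n] by (simp add: pos_divide_less_eq algebra_simps)
qed

lemma idx_mono: "u \<le> t \<Longrightarrow> idx n u \<le> idx n t"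
  unfolding idx_def using tau_pos[of n]
  by (intro nat_mono floor_mono divide_right_mono) auto

definition approx :: "nat \<Rightarrow> real \<Rightarrow> real \<Rightarrow> ennreal" where
  "approx n t = scheme n (idx n t)"

lemma density_fun_approx: "density_fun (approx n t)"
  unfolding approx_def by (rule density_fun_scheme)

lemma approx_measurable [measurable]: "approx n t \<in> borel_measurable borel"
  using density_fun_approx by (simp add: density_fun_def)

lemma mass_approx: "0 \<le> t \<Longrightarrow> mass (approx n t) = mass f0"
  unfolding approx_def using scheme_bounds[of "idx n t" n] idx_le[of t n] by simp

lemma moment_approx: "0 \<le> t \<Longrightarrow> moment (approx n t) \<le> mbound t"
  unfolding approx_def using idx_le[of t n] by (intro moment_scheme_le) auto

lemma approx_small_sets:
  assumes R: "1 \<le> R" and e: "0 < e"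
  obtains \<delta> where "0 < \<delta>" "\<And>n u E. 0 \<le> u \<Longrightarrow> u \<le> t \<Longrightarrow> E \<in> sets borel \<Longrightarrow> E \<subseteq> {0<..<R} \<Longrightarrow>
    emeasure lborel E \<le> ennreal \<delta> \<Longrightarrow> (\<integral>\<^sup>+x. indicator E x * approx n u x \<partial>lborel) \<le> ennreal e"
proof -
  obtain \<delta> where \<delta>: "0 < \<delta>" "\<And>n j E. real j * tau n \<le> t \<Longrightarrow> real j * tau n \<le> real n \<Longrightarrow> E \<in> sets borel \<Longrightarrow>
    E \<subseteq> {0<..<R} \<Longrightarrow> emeasure lborel E \<le> ennreal \<delta> \<Longrightarrow> (\<integral>\<^sup>+x. indicator E x * scheme n j x \<partial>lborel) \<le> ennreal e"
    using scheme_small_sets[OF assms, of t] by blast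
  show ?thesis
  proof (rule that[OF \<delta>(1)])
    fix n u E assume H: "0 \<le> u" "u \<le> t" "E \<in> sets borel" "E \<subseteq> {0<..<R}" "emeasure lborel E \<le> ennreal \<delta>"
    then show "(\<integral>\<^sup>+x. indicator E x * approx n u x \<partial>lborel) \<le> ennreal e"
      unfolding approx_def using idx_le[of u n] by (intro \<delta>(2)) auto
  qed
qed

text \<open>Beyond R the weight (1 + x)^l is at most (1 + R)^(l - 1) (1 + x), and l < 1 makes that
  factor small. The bound is uniform over all densities with the given moment, hence over all
  approximants up to time \<open>t\<close>.\<close>

lemma approx_tail:
  assumes e: "0 < e"
  obtains R where "1 \<le> R" "\<And>f. density_fun f \<Longrightarrow> moment f \<le> mbound t \<Longrightarrow>
    (\<integral>\<^sup>+x. indicator {R..} x * (wt l x * f x) \<partial>lborel) \<le> ennreal e"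
proof -
  obtain b where b: "mbound t = ennreal b" "0 \<le> b" using mbound_fin[of t] by (auto simp: less_top_ennreal)
  have "((\<lambda>R. b * (1 + R) powr (l - 1)) \<longlongrightarrow> b * 0) at_top"
  proof (intro tendsto_mult tendsto_const)
    have "filterlim (\<lambda>R::real. 1 + R) at_top at_top"
      by (rule filterlim_tendsto_add_at_top[OF tendsto_const filterlim_ident])
    then show "((\<lambda>R. (1 + R) powr (l - 1)) \<longlongrightarrow> 0) at_top"
      using l by (intro tendsto_neg_powr) auto
  qed
  then have "\<forall>\<^sub>F R in at_top. b * (1 + R) powr (l - 1) < e"
    using e by (intro order_tendstoD(2)[where y = "b * 0"]) auto
  then have "\<forall>\<^sub>F R in at_top. b * (1 + R) powr (l - 1) < e \<and> 1 \<le> R"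
    using eventually_ge_at_top[of 1] by eventually_elim auto
  then obtain R where R: "b * (1 + R) powr (l - 1) < e" "1 \<le> R"
    by (auto simp: eventually_at_top_linorder)
  show ?thesis
  proof (rule that[OF R(2)])
    fix f assume f: "density_fun f" "moment f \<le> mbound t"
    have [measurable]: "f \<in> borel_measurable borel" using f by (simp add: density_fun_def)
    have "(\<integral>\<^sup>+x. indicator {R..} x * (wt l x * f x) \<partial>lborel) \<le>
        (\<integral>\<^sup>+x. ennreal ((1 + R) powr (l - 1)) * (vt x * f x) \<partial>lborel)"
    proof (rule nn_integral_mono)
      fix x :: real
      show "indicator {R..} x * (wt l x * f x) \<le> ennreal ((1 + R) powr (l - 1)) * (vt x * f x)"
      proof (cases "R \<le> x")
        case True
        have "(1 + x) powr l = (1 + x) powr (l - 1) * (1 + x)"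
          using True R powr_mult_base[of "1 + x" "l - 1"] by (simp add: mult.commute)
        also have "\<dots> \<le> (1 + R) powr (l - 1) * (1 + x)"
          using True R l by (intro mult_right_mono powr_mono2') auto
        finally have "wt l x \<le> ennreal ((1 + R) powr (l - 1)) * vt x"
          using True R by (simp add: wt_def vt_def ennreal_mult'[symmetric] ennreal_leI del: ennreal_plus)
        then have "wt l x * f x \<le> ennreal ((1 + R) powr (l - 1)) * vt x * f x" by (rule mult_right_mono) simp
        then show ?thesis using True by (simp add: mult.assoc)
      qed simp
    qed
    also have "\<dots> = ennreal ((1 + R) powr (l - 1)) * moment f"
      unfolding moment_def by (rule nn_integral_cmult) simp
    also have "\<dots> \<le> ennreal ((1 + R) powr (l - 1)) * ennreal b"
      using f b by (intro mult_left_mono) auto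
    also have "\<dots> \<le> ennreal e"
      using R b by (simp add: ennreal_mult'[symmetric] ennreal_leI mult.commute)
    finally show "(\<integral>\<^sup>+x. indicator {R..} x * (wt l x * f x) \<partial>lborel) \<le> ennreal e" .
  qed
qed

section \<open>Fluxes against a test function and Lipschitz dependence on time\<close>

definition loss_on :: "nat \<Rightarrow> (real \<Rightarrow> ennreal) \<Rightarrow> real \<Rightarrow> ennreal" where
  "loss_on n g t = (\<integral>\<^sup>+x. g x * (rate (Kn n) (Sn n) (approx n t) x * approx n t x) \<partial>lborel)"

definition gain_on :: "nat \<Rightarrow> (real \<Rightarrow> ennreal) \<Rightarrow> real \<Rightarrow> ennreal" where
  "gain_on n g t = (\<integral>\<^sup>+x. g x * gain (Kn n) (Gn n) (approx n t) x \<partial>lborel)"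

lemma scheme_step:
  assumes [measurable]: "g \<in> borel_measurable borel" and j: "real j * tau n \<le> real n"
  shows "(\<integral>\<^sup>+x. g x * scheme n (Suc j) x \<partial>lborel) +
      ennreal (tau n) * (\<integral>\<^sup>+x. g x * (rate (Kn n) (Sn n) (scheme n j) x * scheme n j x) \<partial>lborel) =
    (\<integral>\<^sup>+x. g x * scheme n j x \<partial>lborel) +
      ennreal (tau n) * (\<integral>\<^sup>+x. g x * gain (Kn n) (Gn n) (scheme n j) x \<partial>lborel)"
proof -
  interpret tr: coag_frag_kernels "Kn n" "Gn n" "Sn n" l C N s k d by (rule truncated_kernels)
  show ?thesis
    unfolding scheme_Suc
    by (rule tr.euler_test[OF scheme_measurable assms(1) step_rate_le_1[OF density_fun_scheme moment_scheme_le[OF j j]]])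
qed

lemma flux_on_le:
  assumes [measurable]: "g \<in> borel_measurable borel" and R: "1 \<le> R" and g: "\<And>x. g x \<le> c * indicator {0<..<R} x"
    and f: "density_fun f" "moment f \<le> L"
  shows "(\<integral>\<^sup>+x. g x * (rate (Kn n) (Sn n) f x * f x) \<partial>lborel) \<le> c * flux_bound R L"
    and "(\<integral>\<^sup>+x. g x * gain (Kn n) (Gn n) f x \<partial>lborel) \<le> c * flux_bound R L"
proof -
  interpret tr: coag_frag_kernels "Kn n" "Gn n" "Sn n" l C N s k d by (rule truncated_kernels)
  have [measurable]: "f \<in> borel_measurable borel" using f by (simp add: density_fun_def)
  have *: "(\<integral>\<^sup>+x. g x * F x \<partial>lborel) \<le> c * (\<integral>\<^sup>+x. indicator {0<..<R} x * F x \<partial>lborel)"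
    if [measurable]: "F \<in> borel_measurable borel" for F
  proof -
    have "(\<integral>\<^sup>+x. g x * F x \<partial>lborel) \<le> (\<integral>\<^sup>+x. c * (indicator {0<..<R} x * F x) \<partial>lborel)"
      using mult_right_mono[OF g] by (intro nn_integral_mono) (simp add: mult.assoc)
    then show ?thesis by (simp add: nn_integral_cmult)
  qed
  have "(\<integral>\<^sup>+x. g x * (rate (Kn n) (Sn n) f x * f x) \<partial>lborel) \<le>
      c * (\<integral>\<^sup>+x. indicator {0<..<R} x * (rate (Kn n) (Sn n) f x * f x) \<partial>lborel)"
    by (rule *) measurable
  also have "\<dots> \<le> c * flux_bound R L"
    using f R by (intro mult_left_mono tr.loss_set_le) auto
  finally show "(\<integral>\<^sup>+x. g x * (rate (Kn n) (Sn n) f x * f x) \<partial>lborel) \<le> c * flux_bound R L" .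
  have "(\<integral>\<^sup>+x. g x * gain (Kn n) (Gn n) f x \<partial>lborel) \<le>
      c * (\<integral>\<^sup>+x. indicator {0<..<R} x * gain (Kn n) (Gn n) f x \<partial>lborel)"
    by (rule *) measurable
  also have "\<dots> \<le> c * flux_bound R L"
    using f R by (intro mult_left_mono tr.gain_set_le) auto
  finally show "(\<integral>\<^sup>+x. g x * gain (Kn n) (Gn n) f x \<partial>lborel) \<le> c * flux_bound R L" .
qed

text \<open>Each step changes the integral by at most its gain upwards and its loss downwards, both
  within the flux bound; two one-sided inequalities replace an absolute value, which
  \<open>ennreal\<close> lacks.\<close>

lemma scheme_lipschitz:
  assumes g [measurable]: "g \<in> borel_measurable borel" and R: "1 \<le> R" and gc: "\<And>x. g x \<le> c * indicator {0<..<R} x"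
    and j: "real (i + j) * tau n \<le> t" "real (i + j) * tau n \<le> real n"
  shows "(\<integral>\<^sup>+x. g x * scheme n (i + j) x \<partial>lborel) \<le>
      (\<integral>\<^sup>+x. g x * scheme n i x \<partial>lborel) + of_nat j * (ennreal (tau n) * (c * flux_bound R (mbound t))) \<and>
    (\<integral>\<^sup>+x. g x * scheme n i x \<partial>lborel) \<le>
      (\<integral>\<^sup>+x. g x * scheme n (i + j) x \<partial>lborel) + of_nat j * (ennreal (tau n) * (c * flux_bound R (mbound t)))"
  using j
proof (induction j)
  case (Suc j)
  let ?F = "ennreal (tau n) * (c * flux_bound R (mbound t))"
  let ?l = "ennreal (tau n) * (\<integral>\<^sup>+x. g x * (rate (Kn n) (Sn n) (scheme n (i + j)) x * scheme n (i + j) x) \<partial>lborel)"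
  let ?g = "ennreal (tau n) * (\<integral>\<^sup>+x. g x * gain (Kn n) (Gn n) (scheme n (i + j)) x \<partial>lborel)"
  let ?I = "\<lambda>j. \<integral>\<^sup>+x. g x * scheme n j x \<partial>lborel"
  have j: "real (i + j) * tau n \<le> t" "real (i + j) * tau n \<le> real n"
    using Suc.prems tau_pos[of n] by (simp_all add: algebra_simps)
  note fl = flux_on_le[OF g R gc density_fun_scheme moment_scheme_le[OF j], of n]
  have l: "?l \<le> ?F" and gg: "?g \<le> ?F" by (intro mult_left_mono fl; simp)+
  have st: "?I (Suc (i + j)) + ?l = ?I (i + j) + ?g" by (rule scheme_step[OF g j(2)])
  have up: "?I (Suc (i + j)) \<le> ?I (i + j) + ?F"
  proof -
    have "?I (Suc (i + j)) \<le> ?I (Suc (i + j)) + ?l" by simp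
    also have "\<dots> \<le> ?I (i + j) + ?F" unfolding st by (intro add_left_mono gg)
    finally show ?thesis .
  qed
  have down: "?I (i + j) \<le> ?I (Suc (i + j)) + ?F"
  proof -
    have "?I (i + j) \<le> ?I (i + j) + ?g" by simp
    also have "\<dots> \<le> ?I (Suc (i + j)) + ?F" unfolding st[symmetric] by (intro add_left_mono l)
    finally show ?thesis .
  qed
  have Suc_F: "a + of_nat j * ?F + ?F = a + of_nat (Suc j) * ?F" for a
    by (simp add: distrib_right add.assoc add.commute)
  show ?case
  proof
    have "?I (i + Suc j) \<le> ?I i + of_nat j * ?F + ?F"
      using up Suc.IH[OF j] by (auto intro: order_trans add_right_mono)
    then show "?I (i + Suc j) \<le> ?I i + of_nat (Suc j) * ?F" unfolding Suc_F .
    have "?I i \<le> ?I (i + j) + of_nat j * ?F" using Suc.IH[OF j] by blast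
    also have "\<dots> \<le> (?I (Suc (i + j)) + ?F) + of_nat j * ?F" by (intro add_right_mono down)
    also have "\<dots> = ?I (i + Suc j) + of_nat j * ?F + ?F" by (simp add: ac_simps)
    finally show "?I i \<le> ?I (i + Suc j) + of_nat (Suc j) * ?F" unfolding Suc_F .
  qed
qed simp

end

section \<open>Compactness\<close>

lemma countable_Int_stable_borel_generator:
  obtains B :: "'a::second_countable_topology set set"
  where "countable B" "Int_stable B" "sets borel = sigma_sets UNIV B"
proof -
  obtain B0 :: "'a set set" where B0: "countable B0" "topological_basis B0"
    using ex_countable_basis by blast
  define B where "B = Inter ` {F. finite F \<and> F \<subseteq> B0}"
  have "countable B"
    unfolding B_def using countable_Collect_finite_subset[OF B0(1)]
    by (simp add: countable_image conj_commute)
  moreover have "Int_stable B"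
  proof (rule Int_stableI)
    fix a b assume "a \<in> B" "b \<in> B"
    then obtain F F' where "finite F" "F \<subseteq> B0" "a = \<Inter>F" "finite F'" "F' \<subseteq> B0" "b = \<Inter>F'"
      by (auto simp: B_def)
    then have "a \<inter> b = \<Inter>(F \<union> F')" "F \<union> F' \<in> {F. finite F \<and> F \<subseteq> B0}" by auto
    then show "a \<inter> b \<in> B" unfolding B_def by blast
  qed
  moreover have "topological_basis B"
  proof (rule topological_basisI)
    show "open b" if "b \<in> B" for b
      using that topological_basis_open[OF B0(2)] by (auto simp: B_def intro!: open_Inter)
    show "\<exists>b\<in>B. x \<in> b \<and> b \<subseteq> U" if "open U" "x \<in> U" for U x
    proof -
      obtain b where b: "b \<in> B0" "x \<in> b" "b \<subseteq> U" using topological_basisE[OF B0(2) \<open>open U\<close> \<open>x \<in> U\<close>] by blast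
      then have "b = \<Inter>{b}" "{b} \<in> {F. finite F \<and> F \<subseteq> B0}" by auto
      then have "b \<in> B" unfolding B_def by blast
      with b show ?thesis by blast
    qed
  qed
  ultimately show ?thesis
    using that borel_eq_countable_basis[of B] by (metis sets_measure_of top_greatest Pow_UNIV)
qed

lemma wt_uminus: "wt l x * wt (- l) x = 1"
proof -
  have "wt l x * wt (- l) x = ennreal ((1 + max 0 x) powr (l + - l))"
    unfolding wt_def by (simp only: powr_add ennreal_mult powr_ge_zero)
  then show ?thesis by simp
qed

context coag_frag_problem
begin

lemma flux_bound_mono: "L \<le> L' \<Longrightarrow> flux_bound R L \<le> flux_bound R L'"
  unfolding flux_bound_def by (intro mult_mono add_mono order_refl) auto

text \<open>The extra \<open>tau n\<close> is unavoidable: the approximants are constant between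
  grid times, so an arbitrarily short time interval may contain a whole step.\<close>

lemma approx_lipschitz:
  assumes g: "g \<in> borel_measurable borel" and R: "1 \<le> R" and gc: "\<And>x. g x \<le> c * indicator {0<..<R} x"
    and u: "0 \<le> u" "u \<le> t"
  shows "(\<integral>\<^sup>+x. g x * approx n t x \<partial>lborel) \<le> (\<integral>\<^sup>+x. g x * approx n u x \<partial>lborel) +
      ennreal (t - u + tau n) * (c * flux_bound R (mbound t))"
    and "(\<integral>\<^sup>+x. g x * approx n u x \<partial>lborel) \<le> (\<integral>\<^sup>+x. g x * approx n t x \<partial>lborel) +
      ennreal (t - u + tau n) * (c * flux_bound R (mbound t))"
proof -
  obtain j where j: "idx n t = idx n u + j" using idx_mono[OF u(2)] le_Suc_ex by blast
  have "real (idx n u + j) * tau n \<le> t" "real (idx n u + j) * tau n \<le> real n"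
    using idx_le[of t n] u unfolding j[symmetric] by auto
  note L = scheme_lipschitz[OF g R gc this]
  have "real j * tau n \<le> t - u + tau n"
    using idx_le[of t n] idx_gt[of u n] u unfolding j by (auto simp: algebra_simps min_def split: if_splits)
  then have "of_nat j * ennreal (tau n) \<le> ennreal (t - u + tau n)"
    using less_imp_le[OF tau_pos] by (simp add: ennreal_of_nat_eq_real_of_nat ennreal_mult[symmetric] ennreal_leI)
  then have "of_nat j * ennreal (tau n) * (c * flux_bound R (mbound t)) \<le>
      ennreal (t - u + tau n) * (c * flux_bound R (mbound t))"
    by (rule mult_right_mono) simp
  then have le: "of_nat j * (ennreal (tau n) * (c * flux_bound R (mbound t))) \<le>
      ennreal (t - u + tau n) * (c * flux_bound R (mbound t))"
    by (simp only: mult.assoc)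
  show "(\<integral>\<^sup>+x. g x * approx n t x \<partial>lborel) \<le> (\<integral>\<^sup>+x. g x * approx n u x \<partial>lborel) +
      ennreal (t - u + tau n) * (c * flux_bound R (mbound t))"
    and "(\<integral>\<^sup>+x. g x * approx n u x \<partial>lborel) \<le> (\<integral>\<^sup>+x. g x * approx n t x \<partial>lborel) +
      ennreal (t - u + tau n) * (c * flux_bound R (mbound t))"
    using L order_trans[OF _ add_left_mono[OF le]] unfolding approx_def j by blast+
qed

text \<open>With the weight inside the measure, bounded test functions here correspond to test
  functions of growth (1 + x)^l against the approximants. The total mass is still bounded by the
  moment because l <= 1.\<close>

definition wmeas :: "nat \<Rightarrow> real \<Rightarrow> real measure" where
  "wmeas n t = density lborel (\<lambda>x. wt l x * approx n t x)"

lemma sets_wmeas [simp]: "sets (wmeas n t) = sets borel" and space_wmeas [simp]: "space (wmeas n t) = UNIV"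
  unfolding wmeas_def by auto

lemma emeasure_wmeas:
  "E \<in> sets borel \<Longrightarrow> emeasure (wmeas n t) E = (\<integral>\<^sup>+x. indicator E x * (wt l x * approx n t x) \<partial>lborel)"
  unfolding wmeas_def by (subst emeasure_density) (auto simp: mult.commute)

lemma emeasure_wmeas_le: "0 \<le> t \<Longrightarrow> emeasure (wmeas n t) E \<le> mbound t"
proof -
  assume t: "0 \<le> t"
  have "emeasure (wmeas n t) E \<le> emeasure (wmeas n t) UNIV"
    by (rule emeasure_mono) auto
  also have "\<dots> \<le> mbound t"
    using nn_integral_le_moment[of l "approx n t"] moment_approx[OF t, of n] l by (simp add: emeasure_wmeas)
  finally show ?thesis .
qed

lemma finite_wmeas: "0 \<le> t \<Longrightarrow> finite_measure (wmeas n t)"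
  using emeasure_wmeas_le[of t n UNIV] mbound_fin[of t] by (intro finite_measureI) (auto simp: top_unique)

lemma wmeas_split:
  assumes E [measurable]: "E \<in> sets borel" and f: "density_fun f"
  shows "(\<integral>\<^sup>+x. indicator E x * (wt l x * f x) \<partial>lborel) =
    (\<integral>\<^sup>+x. (indicator (E \<inter> {0<..<R}) x * wt l x) * f x \<partial>lborel) +
    (\<integral>\<^sup>+x. indicator (E \<inter> {R..}) x * (wt l x * f x) \<partial>lborel)"
proof -
  have [measurable]: "f \<in> borel_measurable borel" using f by (simp add: density_fun_def)
  have "indicator E x * (wt l x * f x) =
      (indicator (E \<inter> {0<..<R}) x * wt l x) * f x + indicator (E \<inter> {R..}) x * (wt l x * f x)" for x
    using f by (cases "x \<le> 0") (auto simp: density_fun_zero split: split_indicator)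
  then show ?thesis by (simp add: nn_integral_add)
qed

text \<open>Below R the time Lipschitz estimate applies with the test function bounded by
  \<open>wt l R\<close>; above R the tail of one of the two measures costs \<open>e\<close>, and the
  tail of the other is dropped in each one-sided estimate.\<close>

lemma wmeas_lipschitz:
  assumes E: "E \<in> sets borel" and R: "1 \<le> R" and u: "0 \<le> u" "u \<le> t"
    and tail: "\<And>f. density_fun f \<Longrightarrow> moment f \<le> mbound t \<Longrightarrow>
      (\<integral>\<^sup>+x. indicator {R..} x * (wt l x * f x) \<partial>lborel) \<le> ennreal e" and e: "0 \<le> e"
  shows "\<bar>measure (wmeas n t) E - measure (wmeas n u) E\<bar> \<le>
    (t - u + tau n) * enn2real (wt l R * flux_bound R (mbound t)) + e"
proof -
  let ?F = "wt l R * flux_bound R (mbound t)"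
  let ?g = "\<lambda>x. indicator (E \<inter> {0<..<R}) x * wt l x"
  have F: "?F = ennreal (enn2real ?F)"
    using flux_bound_fin[OF mbound_fin] by (simp add: ennreal_mult_less_top)
  have t: "0 \<le> t" using u by simp
  have g: "?g \<in> borel_measurable borel" using E by measurable
  have gc: "?g x \<le> wt l R * indicator {0<..<R} x" for x
    using wt_mono[OF l(1), of x R] by (auto split: split_indicator)
  note L = approx_lipschitz[OF g R gc u, of n]
  have tl: "(\<integral>\<^sup>+x. indicator (E \<inter> {R..}) x * (wt l x * approx n v x) \<partial>lborel) \<le> ennreal e" if "0 \<le> v" "v \<le> t" for v
  proof -
    have "(\<integral>\<^sup>+x. indicator (E \<inter> {R..}) x * (wt l x * approx n v x) \<partial>lborel) \<le>
        (\<integral>\<^sup>+x. indicator {R..} x * (wt l x * approx n v x) \<partial>lborel)"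
      by (intro nn_integral_mono mult_right_mono) (auto split: split_indicator)
    also have "\<dots> \<le> ennreal e"
      using moment_approx[OF that(1)] mbound_mono[OF that(2)] by (intro tail density_fun_approx) (rule order_trans)
    finally show ?thesis .
  qed
  have nn: "0 \<le> t - u + tau n" using u tau_pos[of n] by simp
  have conv: "measure (wmeas n v) E \<le> measure (wmeas n w) E + (t - u + tau n) * enn2real ?F + e"
    if "0 \<le> v" "v \<le> t" "0 \<le> w" "w \<le> t"
      and le: "(\<integral>\<^sup>+x. ?g x * approx n v x \<partial>lborel) \<le> (\<integral>\<^sup>+x. ?g x * approx n w x \<partial>lborel) + ennreal (t - u + tau n) * ?F"
    for v w
  proof -
    have "emeasure (wmeas n v) E \<le> (\<integral>\<^sup>+x. ?g x * approx n w x \<partial>lborel) + ennreal (t - u + tau n) * ?F + ennreal e"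
      unfolding emeasure_wmeas[OF E] wmeas_split[OF E density_fun_approx, of n v R]
      by (rule add_mono[OF le tl[OF that(1,2)]])
    also have "\<dots> \<le> emeasure (wmeas n w) E + ennreal (t - u + tau n) * ?F + ennreal e"
      unfolding emeasure_wmeas[OF E] wmeas_split[OF E density_fun_approx, of n w R]
      by (intro add_right_mono) simp
    finally have "ennreal (measure (wmeas n v) E) \<le>
        ennreal (measure (wmeas n w) E) + ennreal (t - u + tau n) * ennreal (enn2real ?F) + ennreal e"
      using F by (simp add: finite_measure.emeasure_eq_measure[OF finite_wmeas] that)
    also have "\<dots> = ennreal (measure (wmeas n w) E + (t - u + tau n) * enn2real ?F + e)"
      using nn e by (simp add: ennreal_plus ennreal_mult)
    finally show ?thesis using nn e by (subst (asm) ennreal_le_iff) auto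
  qed
  have "measure (wmeas n t) E \<le> measure (wmeas n u) E + (t - u + tau n) * enn2real ?F + e"
    by (rule conv) (use u t L in auto)
  moreover have "measure (wmeas n u) E \<le> measure (wmeas n t) E + (t - u + tau n) * enn2real ?F + e"
    by (rule conv) (use u t L in auto)
  ultimately show ?thesis by linarith
qed

text \<open>The hypothesis \<open>uc\<close> of the setwise limit lemma. Inside ]0,R[ the Lebesgue
  measures of the sets tend to 0, so uniform integrability applies; the rest is a uniformly small
  tail.\<close>

lemma wmeas_uniformly_continuous:
  assumes t: "0 \<le> t" and A: "range A \<subseteq> sets borel" "decseq A" "(\<Inter>i. A i) = {}" and e: "0 < e"
  shows "\<exists>k. \<forall>n. measure (wmeas n t) (A k) \<le> e"
proof -
  obtain R where R: "1 \<le> R" "\<And>f. density_fun f \<Longrightarrow> moment f \<le> mbound t \<Longrightarrow>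
      (\<integral>\<^sup>+x. indicator {R..} x * (wt l x * f x) \<partial>lborel) \<le> ennreal (e / 2)"
    using approx_tail[of "e / 2" t] e by auto
  define w where "w = enn2real (wt l R)"
  have w: "wt l R = ennreal w" "0 \<le> w" by (auto simp: w_def)
  \<comment> \<open>Compensates the weight, which is at most w on ]0,R[.\<close>
  define e1 where "e1 = e / (2 * (w + 1))"
  have e1: "0 < e1" using e w by (simp add: e1_def)
  obtain \<delta> where \<delta>: "0 < \<delta>" "\<And>n u E. 0 \<le> u \<Longrightarrow> u \<le> t \<Longrightarrow> E \<in> sets borel \<Longrightarrow> E \<subseteq> {0<..<R} \<Longrightarrow>
      emeasure lborel E \<le> ennreal \<delta> \<Longrightarrow> (\<integral>\<^sup>+x. indicator E x * approx n u x \<partial>lborel) \<le> ennreal e1"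
    using approx_small_sets[OF R(1) e1] by metis
  have "(\<lambda>i. emeasure lborel (A i \<inter> {0<..<R})) \<longlonglongrightarrow> emeasure lborel (\<Inter>i. A i \<inter> {0<..<R})"
  proof (rule Lim_emeasure_decseq)
    show "range (\<lambda>i. A i \<inter> {0<..<R}) \<subseteq> sets lborel" using A by auto
    show "decseq (\<lambda>i. A i \<inter> {0<..<R})" using A(2) by (auto simp: decseq_def)
    fix i
    have "emeasure lborel (A i \<inter> {0<..<R}) \<le> emeasure lborel {0<..<R}" by (rule emeasure_mono) auto
    then show "emeasure lborel (A i \<inter> {0<..<R}) \<noteq> \<infinity>" using R by (auto simp: top_unique)
  qed
  moreover have "(\<Inter>i. A i \<inter> {0<..<R}) = {}" using A(3) by auto
  ultimately have "(\<lambda>i. emeasure lborel (A i \<inter> {0<..<R})) \<longlonglongrightarrow> 0" by simp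
  then have "\<forall>\<^sub>F i in sequentially. emeasure lborel (A i \<inter> {0<..<R}) < ennreal \<delta>"
    using \<delta>(1) by (intro order_tendstoD) auto
  then obtain k where k: "emeasure lborel (A k \<inter> {0<..<R}) < ennreal \<delta>"
    by (auto simp: eventually_sequentially)
  have "measure (wmeas n t) (A k) \<le> e" for n
  proof -
    have Ak [measurable]: "A k \<in> sets borel" using A by auto
    have "(\<integral>\<^sup>+x. (indicator (A k \<inter> {0<..<R}) x * wt l x) * approx n t x \<partial>lborel) \<le>
        (\<integral>\<^sup>+x. wt l R * (indicator (A k \<inter> {0<..<R}) x * approx n t x) \<partial>lborel)"
      using wt_mono[OF l(1), of _ R]
      by (intro nn_integral_mono) (auto split: split_indicator intro!: mult_right_mono)
    also have "\<dots> = wt l R * (\<integral>\<^sup>+x. indicator (A k \<inter> {0<..<R}) x * approx n t x \<partial>lborel)"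
      by (rule nn_integral_cmult) measurable
    also have "\<dots> \<le> wt l R * ennreal e1"
      using t k by (intro mult_left_mono \<delta>(2)) auto
    also have "\<dots> = ennreal (w * e1)" using w e1 by (simp add: ennreal_mult)
    also have "\<dots> \<le> ennreal (e / 2)"
      using w e by (intro ennreal_leI) (simp add: e1_def field_simps)
    finally have 1: "(\<integral>\<^sup>+x. (indicator (A k \<inter> {0<..<R}) x * wt l x) * approx n t x \<partial>lborel) \<le> ennreal (e / 2)" .
    have "(\<integral>\<^sup>+x. indicator (A k \<inter> {R..}) x * (wt l x * approx n t x) \<partial>lborel) \<le>
        (\<integral>\<^sup>+x. indicator {R..} x * (wt l x * approx n t x) \<partial>lborel)"
      by (intro nn_integral_mono mult_right_mono) (auto split: split_indicator)
    also have "\<dots> \<le> ennreal (e / 2)" by (intro R(2) density_fun_approx moment_approx t)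
    finally have "emeasure (wmeas n t) (A k) \<le> ennreal (e / 2) + ennreal (e / 2)"
      unfolding emeasure_wmeas[OF Ak] wmeas_split[OF Ak density_fun_approx, of n t R] using 1 by (intro add_mono)
    also have "\<dots> = ennreal e" using e by (simp add: ennreal_plus[symmetric] del: ennreal_plus)
    finally show ?thesis
      using e t by (simp add: finite_measure.emeasure_eq_measure[OF finite_wmeas])
  qed
  then show ?thesis by blast
qed

lemma subsequence_convergent:
  assumes B: "countable B" "B \<subseteq> sets (borel :: real measure)"
  shows "\<exists>r. strict_mono r \<and>
    (\<forall>t E. 0 \<le> t \<longrightarrow> E \<in> B \<longrightarrow> convergent (\<lambda>n. measure (wmeas (r n) t) E))"
proof -
  define I where "I = {q \<in> \<rat>. 0 \<le> (q :: real)} \<times> B"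
  have "countable I" unfolding I_def using B(1) countable_rat countable_subset[of "{q \<in> \<rat>. 0 \<le> q}" \<rat>]
    by (intro countable_SIGMA) auto
  moreover have "bounded (range (\<lambda>n. measure (wmeas n (fst i)) (snd i)))" if i: "i \<in> I" for i
  proof -
    have "0 \<le> fst i" using i by (auto simp: I_def)
    then have "measure (wmeas n (fst i)) (snd i) \<le> enn2real (mbound (fst i))" for n
      unfolding measure_def using emeasure_wmeas_le mbound_fin by (intro enn2real_mono)
    then show ?thesis by (intro boundedI[of _ "enn2real (mbound (fst i))"]) auto
  qed
  ultimately obtain r where r: "strict_mono r"
    "\<And>i. i \<in> I \<Longrightarrow> convergent (\<lambda>n. measure (wmeas (r n) (fst i)) (snd i))"
    using countable_diagonal_subsequence[of I "\<lambda>i n. measure (wmeas n (fst i)) (snd i)"] by blast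
  have "convergent (\<lambda>n. measure (wmeas (r n) t) E)" if t: "0 \<le> t" and E: "E \<in> B" for t E
  proof (rule convergent_if_approximated)
    fix e :: real assume e: "0 < e"
    obtain R where R: "1 \<le> R" "\<And>f. density_fun f \<Longrightarrow> moment f \<le> mbound (t + 1) \<Longrightarrow>
        (\<integral>\<^sup>+x. indicator {R..} x * (wt l x * f x) \<partial>lborel) \<le> ennreal (e / 2)"
      using approx_tail[of "e / 2" "t + 1"] e by auto
    define F where "F = enn2real (wt l R * flux_bound R (mbound (t + 1)))"
    have F0: "0 \<le> F" by (simp add: F_def)
    have fin: "wt l R * flux_bound R (mbound (t + 1)) < top"
      using flux_bound_fin[OF mbound_fin] by (simp add: ennreal_mult_less_top)
    \<comment> \<open>A rational q is taken within \<open>\<eta>\<close> of t and the grid error is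
      below \<open>\<eta>\<close>, so the Lipschitz part is at most 2 \<open>\<eta>\<close> F, that
      is e / 2. The cap 1 keeps q below t + 1, the time at which R and F were fixed.\<close>
    define \<eta> where "\<eta> = min 1 (e / (4 * (F + 1)))"
    have \<eta>: "0 < \<eta>" "\<eta> \<le> 1" "\<eta> * F \<le> e / 4"
    proof -
      show "0 < \<eta>" "\<eta> \<le> 1" using e F0 by (auto simp: \<eta>_def)
      have "\<eta> * F \<le> e / (4 * (F + 1)) * (F + 1)" using e F0 by (intro mult_mono) (auto simp: \<eta>_def)
      also have "\<dots> = e / 4"
      proof -
        have "F + 1 \<noteq> 0" using F0 by simp
        then show ?thesis by (simp add: divide_simps)
      qed
      finally show "\<eta> * F \<le> e / 4" .
    qed
    obtain q where q: "q \<in> \<rat>" "t < q" "q < t + \<eta>" using Rats_dense_in_real[of t "t + \<eta>"] \<eta> by auto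
    have Eb: "E \<in> sets borel" using E B by auto
    have mono: "enn2real (wt l R * flux_bound R (mbound q)) \<le> F"
      unfolding F_def using mbound_mono[of q "t + 1"] q \<eta> fin
      by (intro enn2real_mono mult_left_mono flux_bound_mono) auto
    have "(\<lambda>n. tau (r n)) \<longlonglongrightarrow> 0"
      using LIMSEQ_subseq_LIMSEQ[OF tau_tendsto r(1)] by (simp add: o_def)
    then have "\<forall>\<^sub>F n in sequentially. tau (r n) < \<eta>" using \<eta> by (intro order_tendstoD(2)) auto
    then have "\<forall>\<^sub>F n in sequentially. \<bar>measure (wmeas (r n) t) E - measure (wmeas (r n) q) E\<bar> \<le> e"
    proof eventually_elim
      case (elim n)
      have "\<bar>measure (wmeas (r n) q) E - measure (wmeas (r n) t) E\<bar> \<le>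
          (q - t + tau (r n)) * enn2real (wt l R * flux_bound R (mbound q)) + e / 2"
        using q t e \<eta> R(2) order_trans[OF _ mbound_mono[of q "t + 1"]]
        by (intro wmeas_lipschitz[OF Eb R(1)]) auto
      also have "\<dots> \<le> (\<eta> + \<eta>) * F + e / 2"
        using q elim \<eta> F0 mono less_imp_le[OF tau_pos] by (intro add_right_mono mult_mono) auto
      also have "\<dots> \<le> e" using \<eta>(3) by (simp add: distrib_right)
      finally show ?case by (simp add: abs_minus_commute)
    qed
    moreover have "convergent (\<lambda>n. measure (wmeas (r n) q) E)"
      using r(2)[of "(q, E)"] q t E by (simp add: I_def)
    ultimately show "\<exists>y. convergent y \<and> (\<forall>\<^sub>F n in sequentially. \<bar>measure (wmeas (r n) t) E - y n\<bar> \<le> e)"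
      by blast
  qed
  with r(1) show ?thesis by blast
qed

text \<open>Test functions may vary with n and need only a common bound of growth \<open>l\<close>
  and a pointwise limit. This class contains the inner integrals of the quadratic terms, so the
  property can be applied inside itself. Positive sizes suffice since the densities vanish
  elsewhere.\<close>

definition converges_to :: "(nat \<Rightarrow> nat) \<Rightarrow> real \<Rightarrow> (real \<Rightarrow> ennreal) \<Rightarrow> bool" where
  "converges_to r t f \<longleftrightarrow> (\<forall>u v c. (\<forall>n. u n \<in> borel_measurable borel) \<longrightarrow> v \<in> borel_measurable borel \<longrightarrow> c < top \<longrightarrow>
    (\<forall>n x. 0 < x \<longrightarrow> u n x \<le> c * wt l x) \<longrightarrow> (\<forall>x>0. (\<lambda>n. u n x) \<longlonglongrightarrow> v x) \<longrightarrow>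
    (\<lambda>n. \<integral>\<^sup>+x. u n x * approx (r n) t x \<partial>lborel) \<longlonglongrightarrow> (\<integral>\<^sup>+x. v x * f x \<partial>lborel))"

lemma converges_toD:
  assumes "converges_to r t f" "\<And>n. u n \<in> borel_measurable borel" "v \<in> borel_measurable borel" "c < top"
    "\<And>n x. 0 < x \<Longrightarrow> u n x \<le> c * wt l x" "\<And>x. 0 < x \<Longrightarrow> (\<lambda>n. u n x) \<longlonglongrightarrow> v x"
  shows "(\<lambda>n. \<integral>\<^sup>+x. u n x * approx (r n) t x \<partial>lborel) \<longlonglongrightarrow> (\<integral>\<^sup>+x. v x * f x \<partial>lborel)"
  using assms unfolding converges_to_def by blast

lemma limit_density:
  assumes t: "0 \<le> t" and B: "Int_stable B" "sets borel = sigma_sets UNIV B"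
    and conv: "\<And>E. E \<in> B \<or> E = UNIV \<Longrightarrow> convergent (\<lambda>n. measure (wmeas (r n) t) E)"
  obtains f where "density_fun f" "converges_to r t f"
proof -
  have conv': "convergent (\<lambda>n. measure (wmeas (r n) t) E)" if "E \<in> B \<or> E = space (borel :: real measure)" for E
    using that conv by simp
  have uc: "\<exists>k. \<forall>n. measure (wmeas (r n) t) (A k) \<le> e"
    if "range A \<subseteq> sets borel" "decseq A" "(\<Inter>i. A i) = {}" "0 < e" for A e
    using wmeas_uniformly_continuous[OF t that] by blast
  obtain \<nu> where \<nu>: "finite_measure \<nu>" "sets \<nu> = sets borel"
    "\<And>E. E \<in> sets borel \<Longrightarrow> (\<lambda>n. emeasure (wmeas (r n) t) E) \<longlonglongrightarrow> emeasure \<nu> E"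
  proof (rule setwise_convergence_limit[of "\<lambda>n. wmeas (r n) t" borel B, OF _ B(1) _ _ _ uc conv'])
    show "sets borel = sigma_sets (space borel) B" using B(2) by (simp only: space_borel)
  qed (use finite_wmeas[OF t] in simp_all)
  interpret \<nu>: finite_measure \<nu> by fact
  \<comment> \<open>A Lebesgue null set has mass 0 under every approximating measure, hence under
    their setwise limit.\<close>
  have "absolutely_continuous lborel \<nu>"
    unfolding absolutely_continuous_def
  proof
    fix E :: "real set" assume "E \<in> null_sets lborel"
    then have E: "E \<in> sets borel" "AE x in lborel. x \<notin> E" by (auto intro: AE_not_in)
    have "emeasure (wmeas n t) E = 0" for n
    proof -
      have "emeasure (wmeas n t) E = (\<integral>\<^sup>+x. 0 \<partial>(lborel :: real measure))"
        unfolding emeasure_wmeas[OF E(1)]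
        by (rule nn_integral_cong_AE) (use E(2) in \<open>eventually_elim, simp\<close>)
      then show ?thesis by simp
    qed
    then have "emeasure \<nu> E = 0" using \<nu>(3)[OF E(1)] by (simp add: LIMSEQ_const_iff)
    then show "E \<in> null_sets \<nu>" using E \<nu>(2) by (auto simp: null_sets_def)
  qed
  then obtain p where p [measurable]: "p \<in> borel_measurable borel" and dp: "density lborel p = \<nu>"
    using sigma_finite_measure.Radon_Nikodym[OF sigma_finite_lborel, of \<nu>] \<nu>(2) by auto
  \<comment> \<open>Divides the weight out of the Radon-Nikodym density again and restricts to
    positive sizes.\<close>
  define q where "q x = indicator {0<..} x * wt (- l) x" for x :: real
  have [measurable]: "q \<in> borel_measurable borel" unfolding q_def by measurable
  define f where "f x = q x * p x" for x
  have f: "density_fun f" unfolding density_fun_def f_def by (auto simp: q_def)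
  have "converges_to r t f"
    unfolding converges_to_def
  proof (intro allI impI)
    fix u v c assume u [rule_format, measurable]: "\<forall>n. u n \<in> borel_measurable borel"
      and v [measurable]: "v \<in> borel_measurable borel" and c: "c < (top :: ennreal)"
      and le: "\<forall>n x. 0 < x \<longrightarrow> u n x \<le> c * wt l x" and lim: "\<forall>x>0. (\<lambda>n. u n x) \<longlonglongrightarrow> v x"
    have "(\<lambda>n. \<integral>\<^sup>+x. u n x * q x \<partial>wmeas (r n) t) \<longlonglongrightarrow> (\<integral>\<^sup>+x. v x * q x \<partial>\<nu>)"
    proof (rule nn_integral_setwise_tendsto_varying[where C = "enn2real c" and L = "enn2real (mbound t)"])
      show "emeasure (wmeas (r n) t) (space \<nu>) \<le> ennreal (enn2real (mbound t))" for n
        using emeasure_wmeas_le[OF t] mbound_fin[of t] by simp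
      show "(\<lambda>x. u n x * q x) \<in> borel_measurable \<nu>" for n
        unfolding measurable_cong_sets[OF \<nu>(2) refl] by measurable
      show "u n x * q x \<le> ennreal (enn2real c)" for n x
      proof (cases "0 < x")
        case True
        have "u n x * q x \<le> c * wt l x * wt (- l) x"
          using le True by (auto simp: q_def intro: mult_right_mono)
        also have "\<dots> = c" by (simp add: mult.assoc wt_uminus)
        finally show ?thesis using c by simp
      qed (simp add: q_def)
      show "(\<lambda>n. u n x * q x) \<longlonglongrightarrow> v x * q x" for x
      proof (cases "0 < x")
        case True
        then show ?thesis using lim
          by (intro ennreal_tendsto_cmult[of "q x" _ _ sequentially, unfolded mult.commute[of "q x"]])
             (auto simp: q_def)
      qed (simp add: q_def)
    qed (use \<nu> in auto)
    moreover have "(\<integral>\<^sup>+x. u n x * q x \<partial>wmeas m t) = (\<integral>\<^sup>+x. u n x * approx m t x \<partial>lborel)" for n m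
    proof -
      have "(\<integral>\<^sup>+x. u n x * q x \<partial>wmeas m t) = (\<integral>\<^sup>+x. (wt l x * approx m t x) * (u n x * q x) \<partial>lborel)"
        unfolding wmeas_def by (rule nn_integral_density) measurable
      also have "\<dots> = (\<integral>\<^sup>+x. u n x * approx m t x \<partial>lborel)"
      proof (rule nn_integral_cong)
        fix x
        have "(wt l x * approx m t x) * (u n x * q x) = (wt l x * wt (- l) x) * (indicator {0<..} x * (u n x * approx m t x))"
          unfolding q_def by (simp only: ac_simps)
        also have "\<dots> = u n x * approx m t x"
          using density_fun_zero[OF density_fun_approx, of x m t]
          by (cases "0 < x") (auto simp: wt_uminus)
        finally show "(wt l x * approx m t x) * (u n x * q x) = u n x * approx m t x" .
      qed
      finally show ?thesis .
    qed
    moreover have "(\<integral>\<^sup>+x. v x * q x \<partial>\<nu>) = (\<integral>\<^sup>+x. v x * f x \<partial>lborel)"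
      unfolding dp[symmetric] f_def by (subst nn_integral_density) (auto simp: ac_simps)
    ultimately show "(\<lambda>n. \<integral>\<^sup>+x. u n x * approx (r n) t x \<partial>lborel) \<longlonglongrightarrow> (\<integral>\<^sup>+x. v x * f x \<partial>lborel)"
      by simp
  qed
  with f show ?thesis by (rule that)
qed

lemma limit_densities:
  obtains r f where "strict_mono r" "\<And>t. density_fun (f t)" "\<And>t. 0 \<le> t \<Longrightarrow> converges_to r t (f t)"
proof -
  obtain B :: "real set set" where B: "countable B" "Int_stable B" "sets borel = sigma_sets UNIV B"
    using countable_Int_stable_borel_generator by blast
  have "B \<subseteq> sigma_sets UNIV B" by auto
  then have "B \<subseteq> sets borel" by (simp only: B(3))
  then have sub: "insert UNIV B \<subseteq> sets borel" by simp
  have cnt: "countable (insert UNIV B)" using B(1) by simp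
  obtain r where r: "strict_mono r"
    "\<forall>t E. 0 \<le> t \<longrightarrow> E \<in> insert UNIV B \<longrightarrow> convergent (\<lambda>n. measure (wmeas (r n) t) E)"
    using subsequence_convergent[OF cnt sub] by (elim exE conjE)
  have "\<exists>f. density_fun f \<and> (0 \<le> t \<longrightarrow> converges_to r t f)" for t
  proof (cases "0 \<le> t")
    case True
    have "convergent (\<lambda>n. measure (wmeas (r n) t) E)" if "E \<in> B \<or> E = UNIV" for E
      using r(2) True that by (elim disjE) auto
    then show ?thesis using limit_density[OF True B(2,3)] by blast
  next
    case False
    then show ?thesis using f0 by blast
  qed
  then obtain f where "\<And>t. density_fun (f t) \<and> (0 \<le> t \<longrightarrow> converges_to r t (f t))" by metis
  with r(1) show ?thesis using that by blast
qed

end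

section \<open>The limit density\<close>

lemma nn_integral_le_truncated:
  fixes F :: "real \<Rightarrow> ennreal"
  assumes [measurable]: "F \<in> borel_measurable borel"
    and le: "\<And>n. (\<integral>\<^sup>+x. indicator {..<real n} x * F x \<partial>lborel) \<le> c"
  shows "(\<integral>\<^sup>+x. F x \<partial>lborel) \<le> c"
proof -
  have "(SUP n. indicator {..<real n} x * F x) = F x" for x
  proof -
    obtain n where "x < real n" using reals_Archimedean2 by blast
    then show ?thesis by (intro antisym SUP_least SUP_upper2[of n]) (auto split: split_indicator)
  qed
  then have "(\<integral>\<^sup>+x. F x \<partial>lborel) = (\<integral>\<^sup>+x. (SUP n. indicator {..<real n} x * F x) \<partial>lborel)" by simp
  also have "\<dots> = (SUP n. \<integral>\<^sup>+x. indicator {..<real n} x * F x \<partial>lborel)"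
    by (rule nn_integral_monotone_convergence_SUP)
       (auto simp: incseq_def le_fun_def split: split_indicator)
  also have "\<dots> \<le> c" by (intro SUP_least le)
  finally show ?thesis .
qed

text \<open>With truncated subtraction, the sum of the two differences is the distance of
  \<open>b j\<close> to \<open>a\<close>.\<close>

lemma ennreal_tendsto_of_differences:
  fixes a :: ennreal
  assumes a: "a < top" and D: "(\<lambda>j. (b j - a) + (a - b j)) \<longlonglongrightarrow> 0"
  shows "b \<longlonglongrightarrow> a"
proof -
  define D where "D j = (b j - a) + (a - b j)" for j
  have D0: "D \<longlonglongrightarrow> 0" using D unfolding D_def .
  have up: "b j \<le> a + D j" for j
  proof -
    have "b j \<le> a + (b j - a)" by (auto simp: add_diff_self_ennreal)
    also have "\<dots> \<le> a + D j" unfolding D_def by (intro add_left_mono) simp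
    finally show ?thesis .
  qed
  have lo: "a - D j \<le> b j" for j
  proof -
    have "a \<le> b j + (a - b j)" by (auto simp: add_diff_self_ennreal)
    also have "\<dots> \<le> b j + D j" unfolding D_def by (intro add_left_mono) simp
    finally have "a \<le> D j + b j" by (simp only: add.commute)
    then show "a - D j \<le> b j" using a by (auto simp: ennreal_minus_le_iff)
  qed
  have "(\<lambda>j. a - D j) \<longlonglongrightarrow> a - 0"
    using a by (intro tendsto_diff_ennreal[OF tendsto_const D0]) auto
  moreover have "(\<lambda>j. a + D j) \<longlonglongrightarrow> a + 0" by (rule tendsto_add[OF tendsto_const D0])
  ultimately show ?thesis
    using tendsto_sandwich[of "\<lambda>j. a - D j" b sequentially "\<lambda>j. a + D j" a] up lo by simp
qed

section \<open>Joint measurability in time and size\<close>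

definition dyadic :: "nat \<Rightarrow> real \<Rightarrow> real" where
  "dyadic j t = real_of_int \<lfloor>2 ^ j * t\<rfloor> / 2 ^ j"

lemma dyadic_bounds: "0 \<le> t \<Longrightarrow> 0 \<le> dyadic j t" "dyadic j t \<le> t" "t - dyadic j t \<le> (1 / 2) ^ j"
proof -
  show "0 \<le> t \<Longrightarrow> 0 \<le> dyadic j t" by (simp add: dyadic_def)
  have "real_of_int \<lfloor>2 ^ j * t\<rfloor> \<le> 2 ^ j * t" by (rule of_int_floor_le)
  then show "dyadic j t \<le> t" by (simp add: dyadic_def divide_le_eq mult.commute)
  have "2 ^ j * t < real_of_int \<lfloor>2 ^ j * t\<rfloor> + 1" by (rule floor_correct[THEN conjunct2, THEN less_le_trans]) simp
  then have "(2 ^ j * t) / 2 ^ j \<le> (real_of_int \<lfloor>2 ^ j * t\<rfloor> + 1) / 2 ^ j"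
    by (intro divide_right_mono) auto
  then show "t - dyadic j t \<le> (1 / 2) ^ j"
    by (simp add: dyadic_def add_divide_distrib power_one_over)
qed

locale coag_frag_limit = coag_frag_problem +
  fixes r :: "nat \<Rightarrow> nat" and f :: "real \<Rightarrow> real \<Rightarrow> ennreal"
  assumes r: "strict_mono r" and f: "\<And>t. density_fun (f t)"
    and conv: "\<And>t. 0 \<le> t \<Longrightarrow> converges_to r t (f t)"
begin

lemma f_measurable [measurable]: "f t \<in> borel_measurable borel"
  using f by (simp add: density_fun_def)

lemma converges_fixed:
  assumes t: "0 \<le> t" and g: "g \<in> borel_measurable borel" and c: "c < top" and le: "\<And>x. g x \<le> c * wt l x"
  shows "(\<lambda>n. \<integral>\<^sup>+x. g x * approx (r n) t x \<partial>lborel) \<longlonglongrightarrow> (\<integral>\<^sup>+x. g x * f t x \<partial>lborel)"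
  by (rule converges_toD[OF conv[OF t], of "\<lambda>_. g", OF g g c]) (auto intro: le)

text \<open>The weight x grows faster than \<open>converges_to\<close> admits, so the limit is taken
  on bounded sizes only and then the cut-off is removed by monotone convergence. Mass may escape to
  infinity in the limit, which leaves an inequality.\<close>

lemma mass_f: assumes t: "0 \<le> t" shows "mass (f t) \<le> mass f0"
  unfolding mass_def[of "f t"]
proof (rule nn_integral_le_truncated)
  fix n :: nat
  let ?g = "\<lambda>x. indicator {..<real n} x * ennreal x"
  have "(\<lambda>m. \<integral>\<^sup>+x. ?g x * approx (r m) t x \<partial>lborel) \<longlonglongrightarrow> (\<integral>\<^sup>+x. ?g x * f t x \<partial>lborel)"
  proof (rule converges_fixed[OF t, where c = "ennreal (real n)"])
    show "?g x \<le> ennreal (real n) * wt l x" for x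
      using mult_mono[of "ennreal x" "ennreal (real n)" 1 "wt l x"] wt_ge_1[OF l(1), of x]
      by (auto simp: ennreal_leI split: split_indicator)
  qed auto
  moreover have "(\<integral>\<^sup>+x. ?g x * approx (r m) t x \<partial>lborel) \<le> mass f0" for m
  proof -
    have "(\<integral>\<^sup>+x. ?g x * approx (r m) t x \<partial>lborel) \<le> mass (approx (r m) t)"
      unfolding mass_def by (intro nn_integral_mono) (auto split: split_indicator)
    then show ?thesis using mass_approx[OF t] by simp
  qed
  ultimately have "(\<integral>\<^sup>+x. ?g x * f t x \<partial>lborel) \<le> mass f0"
    by (intro LIMSEQ_le_const2) auto
  then show "(\<integral>\<^sup>+x. indicator {..<real n} x * (ennreal x * f t x) \<partial>lborel) \<le> mass f0"
    by (simp add: mult.assoc)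
qed measurable

lemma moment_f: assumes t: "0 \<le> t" shows "moment (f t) \<le> mbound t"
  unfolding moment_def[of "f t"]
proof (rule nn_integral_le_truncated)
  fix n :: nat
  let ?g = "\<lambda>x. indicator {..<real n} x * vt x"
  have "(\<lambda>m. \<integral>\<^sup>+x. ?g x * approx (r m) t x \<partial>lborel) \<longlonglongrightarrow> (\<integral>\<^sup>+x. ?g x * f t x \<partial>lborel)"
  proof (rule converges_fixed[OF t, where c = "vt (real n)"])
    show "?g x \<le> vt (real n) * wt l x" for x
    proof (cases "x < real n")
      case True
      then have "vt x * 1 \<le> vt (real n) * wt l x"
        by (intro mult_mono wt_ge_1 l) (auto simp: vt_def intro!: ennreal_leI)
      then show ?thesis using True by simp
    qed simp
  qed auto
  moreover have "(\<integral>\<^sup>+x. ?g x * approx (r m) t x \<partial>lborel) \<le> mbound t" for m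
  proof -
    have "(\<integral>\<^sup>+x. ?g x * approx (r m) t x \<partial>lborel) \<le> moment (approx (r m) t)"
      unfolding moment_def by (intro nn_integral_mono) (auto split: split_indicator)
    then show ?thesis using moment_approx[OF t] order_trans by blast
  qed
  ultimately have "(\<integral>\<^sup>+x. ?g x * f t x \<partial>lborel) \<le> mbound t"
    by (intro LIMSEQ_le_const2) auto
  then show "(\<integral>\<^sup>+x. indicator {..<real n} x * (vt x * f t x) \<partial>lborel) \<le> mbound t"
    by (simp add: mult.assoc)
qed measurable

lemma tau_r_tendsto: "(\<lambda>n. tau (r n)) \<longlonglongrightarrow> 0"
  using LIMSEQ_subseq_LIMSEQ[OF tau_tendsto r] by (simp add: o_def)

lemma f_lipschitz:
  assumes E: "E \<in> sets borel" "E \<subseteq> {0<..<R}" and R: "1 \<le> R" and u: "0 \<le> u" "u \<le> t"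
  shows "(\<integral>\<^sup>+x. indicator E x * f t x \<partial>lborel) \<le> (\<integral>\<^sup>+x. indicator E x * f u x \<partial>lborel) +
      ennreal (t - u) * flux_bound R (mbound t)" (is ?A)
    and "(\<integral>\<^sup>+x. indicator E x * f u x \<partial>lborel) \<le> (\<integral>\<^sup>+x. indicator E x * f t x \<partial>lborel) +
      ennreal (t - u) * flux_bound R (mbound t)" (is ?B)
proof -
  let ?g = "indicator E :: real \<Rightarrow> ennreal"
  have g: "?g \<in> borel_measurable borel" using E by simp
  have gc: "?g x \<le> 1 * indicator {0<..<R} x" for x
    using E(2) by (auto split: split_indicator)
  have gw: "?g x \<le> 1 * wt l x" for x
    using wt_ge_1[OF l(1), of x] by (auto split: split_indicator)
  have cv: "(\<lambda>n. \<integral>\<^sup>+x. ?g x * approx (r n) v x \<partial>lborel) \<longlonglongrightarrow> (\<integral>\<^sup>+x. ?g x * f v x \<partial>lborel)" if "0 \<le> v" for v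
    by (rule converges_fixed[OF that g _ gw]) simp
  have ct: "(\<lambda>n. ennreal (t - u + tau (r n)) * (1 * flux_bound R (mbound t))) \<longlonglongrightarrow>
      ennreal (t - u + 0) * flux_bound R (mbound t)"
  proof -
    have "(\<lambda>n. t - u + tau (r n)) \<longlonglongrightarrow> t - u + 0" by (intro tendsto_intros tau_r_tendsto)
    then have "(\<lambda>n. ennreal (t - u + tau (r n))) \<longlonglongrightarrow> ennreal (t - u + 0)" by (rule tendsto_ennrealI)
    from ennreal_tendsto_cmult[OF flux_bound_fin[OF mbound_fin] this, of R t]
    show ?thesis by (simp only: mult_1 mult.commute)
  qed
  note L = approx_lipschitz[OF g R gc u]
  have "0 \<le> t" using u by simp
  show ?A
    using LIMSEQ_le[OF cv[OF \<open>0 \<le> t\<close>] tendsto_add[OF cv[OF u(1)] ct]] L(1) by auto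
  show ?B
    using LIMSEQ_le[OF cv[OF u(1)] tendsto_add[OF cv[OF \<open>0 \<le> t\<close>] ct]] L(2) by auto
qed

text \<open>An estimate on all sets gives one in L^1: the positive part of a difference is
  integrated over the set where the difference is nonnegative, and both orders are added.\<close>

lemma integral_difference_le:
  assumes R: "1 \<le> R" and u: "0 \<le> u" "u \<le> t"
  shows "(\<integral>\<^sup>+x. indicator {0<..<R} x * ((f u x - f t x) + (f t x - f u x)) \<partial>lborel) \<le>
    2 * (ennreal (t - u) * flux_bound R (mbound t))"
proof -
  let ?K = "ennreal (t - u) * flux_bound R (mbound t)"
  have half: "(\<integral>\<^sup>+x. indicator {0<..<R} x * (f a x - f b x) \<partial>lborel) \<le> ?K"
    if le: "\<And>E. E \<in> sets borel \<Longrightarrow> E \<subseteq> {0<..<R} \<Longrightarrow>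
      (\<integral>\<^sup>+x. indicator E x * f a x \<partial>lborel) \<le> (\<integral>\<^sup>+x. indicator E x * f b x \<partial>lborel) + ?K"
      and b: "0 \<le> b" for a b
  proof -
    define A where "A = {x \<in> {0<..<R}. f b x \<le> f a x}"
    have A [measurable]: "A \<in> sets borel" "A \<subseteq> {0<..<R}" unfolding A_def by auto
    have "(\<integral>\<^sup>+x. indicator A x * f b x \<partial>lborel) \<le> moment (f b)"
      using nn_integral_indicator_le nn_integral_le_moment' order_trans by blast
    also have "\<dots> < top" using moment_f[OF b] mbound_fin by (rule order.strict_trans1)
    finally have fin: "(\<integral>\<^sup>+x. indicator A x * f b x \<partial>lborel) \<noteq> top" by simp
    have "(\<integral>\<^sup>+x. indicator {0<..<R} x * (f a x - f b x) \<partial>lborel) =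
        (\<integral>\<^sup>+x. indicator A x * f a x - indicator A x * f b x \<partial>lborel)"
    proof (rule nn_integral_cong)
      fix x
      show "indicator {0<..<R} x * (f a x - f b x) = indicator A x * f a x - indicator A x * f b x"
      proof (cases "x \<in> {0<..<R} \<and> \<not> f b x \<le> f a x")
        case True
        then have "f a x < f b x" by (simp add: not_le)
        then have "f a x < top" using top_greatest by (rule order.strict_trans2)
        with \<open>f a x < f b x\<close> have "f a x - f b x = 0" by (simp add: diff_eq_0_iff_ennreal)
        with True show ?thesis by (simp add: A_def)
      next
        case False
        then show ?thesis by (auto simp: A_def split: split_indicator)
      qed
    qed
    also have "\<dots> = (\<integral>\<^sup>+x. indicator A x * f a x \<partial>lborel) - (\<integral>\<^sup>+x. indicator A x * f b x \<partial>lborel)"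
      using fin by (intro nn_integral_diff) (auto simp: A_def split: split_indicator)
    also have "\<dots> \<le> ?K"
      using le[OF A] fin by (subst ennreal_minus_le_iff) auto
    finally show ?thesis .
  qed
  have "(\<integral>\<^sup>+x. indicator {0<..<R} x * ((f u x - f t x) + (f t x - f u x)) \<partial>lborel) =
      (\<integral>\<^sup>+x. indicator {0<..<R} x * (f u x - f t x) \<partial>lborel) +
      (\<integral>\<^sup>+x. indicator {0<..<R} x * (f t x - f u x) \<partial>lborel)"
    by (simp add: distrib_left nn_integral_add)
  also have "\<dots> \<le> ?K + ?K"
    using f_lipschitz[OF _ _ R u] u by (intro add_mono half) auto
  finally show ?thesis by (simp add: mult_2)
qed

text \<open>The L^1 distances on ]0,R[ are of order 2^(-j), hence summable. So the sum of the
  pointwise distances is finite almost everywhere and its terms tend to 0, without passing to a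
  subsequence that might depend on t.\<close>

lemma AE_dyadic_tendsto:
  assumes t: "0 \<le> t"
  shows "AE x in lborel. (\<lambda>j. f (dyadic j t) x) \<longlonglongrightarrow> f t x"
proof -
  define D where "D j x = (f (dyadic j t) x - f t x) + (f t x - f (dyadic j t) x)" for j x
  have [measurable]: "D j \<in> borel_measurable borel" for j unfolding D_def by measurable
  have "AE x in lborel. 0 < x \<and> x < real (Suc R) \<longrightarrow> (\<lambda>j. D j x) \<longlonglongrightarrow> 0" for R :: nat
  proof -
    let ?R = "real (Suc R)"
    let ?F = "flux_bound ?R (mbound t)"
    have F: "?F < top" by (rule flux_bound_fin[OF mbound_fin])
    then obtain b where b: "?F = ennreal b" "0 \<le> b" by (auto simp: less_top_ennreal)
    have Dj: "(\<integral>\<^sup>+x. indicator {0<..<?R} x * D j x \<partial>lborel) \<le> ennreal (2 * b * (1 / 2) ^ j)" for j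
    proof -
      have "(\<integral>\<^sup>+x. indicator {0<..<?R} x * D j x \<partial>lborel) \<le> 2 * (ennreal (t - dyadic j t) * ?F)"
        unfolding D_def using t by (intro integral_difference_le dyadic_bounds) auto
      also have "\<dots> \<le> 2 * (ennreal ((1 / 2) ^ j) * ?F)"
        by (intro mult_left_mono mult_right_mono ennreal_leI dyadic_bounds) auto
      also have "\<dots> = ennreal (2 * b * (1 / 2) ^ j)"
        using b by (simp add: ennreal_mult ac_simps flip: ennreal_numeral)
      finally show ?thesis .
    qed
    have "(\<integral>\<^sup>+x. (\<Sum>j. indicator {0<..<?R} x * D j x) \<partial>lborel) =
        (\<Sum>j. \<integral>\<^sup>+x. indicator {0<..<?R} x * D j x \<partial>lborel)"
      by (rule nn_integral_suminf) measurable
    also have "\<dots> \<le> (\<Sum>j. ennreal (2 * b * (1 / 2) ^ j))"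
      by (intro suminf_le Dj summableI)
    also have "\<dots> < top"
    proof -
      have "summable (\<lambda>j. 2 * b * (1 / 2) ^ j :: real)"
        by (intro summable_mult summable_geometric) simp
      then have "(\<Sum>j. ennreal (2 * b * (1 / 2) ^ j)) \<noteq> top"
        using b by (intro ennreal_suminf_neq_top) simp_all
      then show ?thesis by (simp only: less_top)
    qed
    finally have "AE x in lborel. (\<Sum>j. indicator {0<..<?R} x * D j x) \<noteq> \<infinity>"
      by (intro nn_integral_PInf_AE) auto
    then show ?thesis
    proof eventually_elim
      case (elim x)
      show ?case
      proof
        assume x: "0 < x \<and> x < ?R"
        then have sum: "(\<Sum>j. D j x) \<noteq> top" using elim by simp
        have fin: "D j x < top" for j
          using ennreal_suminf_lessD[of "\<lambda>j. D j x" top j] sum by (simp add: less_top)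
        then have e: "D j x = ennreal (enn2real (D j x))" for j by simp
        have "summable (\<lambda>j. enn2real (D j x))"
          using sum e by (intro summable_suminf_not_top) auto
        then have "(\<lambda>j. enn2real (D j x)) \<longlonglongrightarrow> 0" by (rule summable_LIMSEQ_zero)
        then have "(\<lambda>j. ennreal (enn2real (D j x))) \<longlonglongrightarrow> ennreal 0" by (rule tendsto_ennrealI)
        then show "(\<lambda>j. D j x) \<longlonglongrightarrow> 0" using e by simp
      qed
    qed
  qed
  then have "AE x in lborel. \<forall>R. 0 < x \<and> x < real (Suc R) \<longrightarrow> (\<lambda>j. D j x) \<longlonglongrightarrow> 0"
    unfolding AE_all_countable by blast
  moreover have "AE x in lborel. f t x \<noteq> \<infinity>"
  proof (rule nn_integral_PInf_AE)
    show "(\<integral>\<^sup>+x. f t x \<partial>lborel) \<noteq> \<infinity>"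
      using nn_integral_le_moment'[of "f t"] moment_f[OF t] mbound_fin[of t] by (auto simp: top_unique)
  qed simp
  ultimately show ?thesis
  proof eventually_elim
    case (elim x)
    show ?case
    proof (cases "0 < x")
      case True
      obtain n where "x < real n" using reals_Archimedean2 by blast
      then have "x < real (Suc n)" by simp
      then have D0: "(\<lambda>j. D j x) \<longlonglongrightarrow> 0" using elim(1) True by blast
      have "f t x < top" using elim(2) by (simp add: top.not_eq_extremum)
      then show ?thesis using D0 unfolding D_def by (rule ennreal_tendsto_of_differences)
    next
      case False
      then show ?thesis by (simp add: density_fun_zero[OF f])
    qed
  qed
qed

text \<open>
  The densities \<open>f t\<close> come from the Radon-Nikodym theorem separately for each \<open>t\<close>. They are
  Lipschitz in \<open>t\<close> with values in \<open>L\<^sup>1(0,R)\<close>, hence almost everywhere the limit of their values at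
  dyadic times.
\<close>

lemma jointly_measurable_version:
  obtains F where "case_prod F \<in> borel_measurable (borel \<Otimes>\<^sub>M borel)" "\<And>t. density_fun (F t)"
    "\<And>t. 0 \<le> t \<Longrightarrow> converges_to r t (F t)"
proof -
  define F where "F t x = limsup (\<lambda>j. f (dyadic j t) x)" for t x
  have "(\<lambda>p. f (dyadic j (fst p)) (snd p)) \<in> borel_measurable (borel \<Otimes>\<^sub>M borel)" for j
  proof -
    have "(\<lambda>p. f (real_of_int i / 2 ^ j) (snd p)) \<in> borel_measurable (borel \<Otimes>\<^sub>M borel)" for i :: int
      by measurable
    then show ?thesis
      unfolding dyadic_def
      by (rule measurable_compose_countable[where f = "\<lambda>i p. f (real_of_int i / 2 ^ j) (snd p)"]) measurable
  qed
  then have pair: "case_prod F \<in> borel_measurable (borel \<Otimes>\<^sub>M borel)"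
    unfolding F_def case_prod_beta by (rule borel_measurable_limsup)
  have Fm: "F t \<in> borel_measurable borel" for t
    using measurable_compose[OF measurable_Pair1' pair, of t] by simp
  have dF: "density_fun (F t)" for t
    unfolding density_fun_def using Fm by (auto simp: F_def density_fun_zero[OF f] Limsup_const)
  have ae: "AE x in lborel. F t x = f t x" if t: "0 \<le> t" for t
    using AE_dyadic_tendsto[OF t] unfolding F_def by eventually_elim (simp add: lim_imp_Limsup)
  have "converges_to r t (F t)" if t: "0 \<le> t" for t
  proof -
    have "(\<integral>\<^sup>+x. v x * F t x \<partial>lborel) = (\<integral>\<^sup>+x. v x * f t x \<partial>lborel)" for v
      by (rule nn_integral_cong_AE) (use ae[OF t] in \<open>eventually_elim, simp\<close>)
    then show ?thesis using conv[OF t] unfolding converges_to_def by simp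
  qed
  with pair dF show ?thesis by (rule that)
qed

end

section \<open>Passage to the limit in the equation\<close>

text \<open>Rewrites an Euler sum as a time integral, so that the limit in time becomes an instance
  of dominated convergence.\<close>

lemma nn_integral_step_function:
  fixes \<psi> :: "nat \<Rightarrow> ennreal"
  assumes \<eta>: "0 < \<eta>"
  shows "(\<integral>\<^sup>+u. indicator {0..<real j * \<eta>} u * \<psi> (nat \<lfloor>u / \<eta>\<rfloor>) \<partial>lborel) = (\<Sum>i<j. ennreal \<eta> * \<psi> i)"
proof (induction j)
  case (Suc j)
  have m: "(\<lambda>u. \<psi> (nat \<lfloor>u / \<eta>\<rfloor>)) \<in> borel_measurable borel"
    by (rule measurable_compose[of _ borel "count_space UNIV"]) measurable
  have "indicator {0..<real (Suc j) * \<eta>} u * \<psi> (nat \<lfloor>u / \<eta>\<rfloor>) =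
      indicator {0..<real j * \<eta>} u * \<psi> (nat \<lfloor>u / \<eta>\<rfloor>) +
      \<psi> j * indicator {real j * \<eta>..<real (Suc j) * \<eta>} u" for u
  proof (cases "real j * \<eta> \<le> u \<and> u < real (Suc j) * \<eta>")
    case True
    then have "real j \<le> u / \<eta>" "u / \<eta> < real j + 1"
      using \<eta> by (auto simp: pos_le_divide_eq pos_divide_less_eq algebra_simps)
    then have "\<lfloor>u / \<eta>\<rfloor> = int j" by (simp add: floor_eq_iff)
    moreover have "0 \<le> u" using True \<eta> order_trans[of 0 "real j * \<eta>" u] by simp
    ultimately show ?thesis using True by simp
  next
    case False
    have "real j * \<eta> \<le> real (Suc j) * \<eta>" using \<eta> by (intro mult_right_mono) auto
    then show ?thesis using False by (auto split: split_indicator)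
  qed
  then have "(\<integral>\<^sup>+u. indicator {0..<real (Suc j) * \<eta>} u * \<psi> (nat \<lfloor>u / \<eta>\<rfloor>) \<partial>lborel) =
      (\<integral>\<^sup>+u. indicator {0..<real j * \<eta>} u * \<psi> (nat \<lfloor>u / \<eta>\<rfloor>) \<partial>lborel) +
      (\<integral>\<^sup>+u. \<psi> j * indicator {real j * \<eta>..<real (Suc j) * \<eta>} u \<partial>lborel)"
    using m by (simp add: nn_integral_add)
  also have "(\<integral>\<^sup>+u. \<psi> j * indicator {real j * \<eta>..<real (Suc j) * \<eta>} u \<partial>lborel) = ennreal \<eta> * \<psi> j"
    using \<eta> by (subst nn_integral_cmult_indicator) (auto simp: algebra_simps mult_right_mono)
  finally show ?case using Suc by simp
qed simp

context coag_frag_problem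
begin

lemma idx_measurable [measurable]: "idx n \<in> measurable borel (count_space UNIV)"
  unfolding idx_def by measurable

lemma loss_on_measurable [measurable]: "loss_on n g \<in> borel_measurable borel"
proof -
  have "(\<lambda>t. (\<lambda>j. \<integral>\<^sup>+x. g x * (rate (Kn n) (Sn n) (scheme n j) x * scheme n j x) \<partial>lborel) (idx n t))
      \<in> borel_measurable borel"
    by (rule measurable_compose[OF idx_measurable]) simp
  then show ?thesis unfolding loss_on_def[abs_def] approx_def .
qed

lemma gain_on_measurable [measurable]: "gain_on n g \<in> borel_measurable borel"
proof -
  have "(\<lambda>t. (\<lambda>j. \<integral>\<^sup>+x. g x * gain (Kn n) (Gn n) (scheme n j) x \<partial>lborel) (idx n t)) \<in> borel_measurable borel"
    by (rule measurable_compose[OF idx_measurable]) simp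
  then show ?thesis unfolding gain_on_def[abs_def] approx_def .
qed

lemma scheme_sum_identity:
  assumes g [measurable]: "g \<in> borel_measurable borel" and j: "real j * tau n \<le> real n"
  shows "(\<integral>\<^sup>+x. g x * scheme n j x \<partial>lborel) +
      (\<Sum>i<j. ennreal (tau n) * (\<integral>\<^sup>+x. g x * (rate (Kn n) (Sn n) (scheme n i) x * scheme n i x) \<partial>lborel)) =
    (\<integral>\<^sup>+x. g x * f0 x \<partial>lborel) +
      (\<Sum>i<j. ennreal (tau n) * (\<integral>\<^sup>+x. g x * gain (Kn n) (Gn n) (scheme n i) x \<partial>lborel))"
  using j
proof (induction j)
  case (Suc j)
  have j: "real j * tau n \<le> real n" using Suc.prems tau_pos[of n] by (simp add: algebra_simps)
  note st = scheme_step[OF g j] and IH = Suc.IH[OF j]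
  let ?l = "\<lambda>i. ennreal (tau n) * (\<integral>\<^sup>+x. g x * (rate (Kn n) (Sn n) (scheme n i) x * scheme n i x) \<partial>lborel)"
  let ?g = "\<lambda>i. ennreal (tau n) * (\<integral>\<^sup>+x. g x * gain (Kn n) (Gn n) (scheme n i) x \<partial>lborel)"
  let ?I = "\<lambda>j. \<integral>\<^sup>+x. g x * scheme n j x \<partial>lborel"
  have "?I (Suc j) + (\<Sum>i<Suc j. ?l i) = (?I (Suc j) + ?l j) + (\<Sum>i<j. ?l i)"
    by (simp only: sum.lessThan_Suc ac_simps)
  also have "\<dots> = (?I j + (\<Sum>i<j. ?l i)) + ?g j" unfolding st by (simp only: ac_simps)
  also have "\<dots> = (\<integral>\<^sup>+x. g x * f0 x \<partial>lborel) + (\<Sum>i<Suc j. ?g i)"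
    unfolding IH by (simp only: sum.lessThan_Suc ac_simps)
  finally show ?case .
qed (simp add: scheme_0)

text \<open>The discrete balance is exact at grid times only; its time integrals therefore end at
  the last grid time reached.\<close>

definition last_step :: "nat \<Rightarrow> real \<Rightarrow> real" where
  "last_step n t = real (idx n t) * tau n"

lemma idx_before_last_step:
  assumes t: "0 \<le> t" and u: "u \<in> {0..<last_step n t}"
  shows "idx n u = nat \<lfloor>u / tau n\<rfloor>"
proof -
  have "u \<le> real n" using u idx_le[OF t, of n] by (simp add: last_step_def)
  then show ?thesis by (simp add: idx_def)
qed

lemma approx_identity:
  assumes g: "g \<in> borel_measurable borel" and t: "0 \<le> t"
  shows "(\<integral>\<^sup>+x. g x * approx n t x \<partial>lborel) + (\<integral>\<^sup>+u. indicator {0..<last_step n t} u * loss_on n g u \<partial>lborel) =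
    (\<integral>\<^sup>+x. g x * f0 x \<partial>lborel) + (\<integral>\<^sup>+u. indicator {0..<last_step n t} u * gain_on n g u \<partial>lborel)"
proof -
  let ?l = "\<lambda>i. \<integral>\<^sup>+x. g x * (rate (Kn n) (Sn n) (scheme n i) x * scheme n i x) \<partial>lborel"
  let ?g = "\<lambda>i. \<integral>\<^sup>+x. g x * gain (Kn n) (Gn n) (scheme n i) x \<partial>lborel"
  have "(\<integral>\<^sup>+u. indicator {0..<last_step n t} u * loss_on n g u \<partial>lborel) =
      (\<integral>\<^sup>+u. indicator {0..<last_step n t} u * ?l (nat \<lfloor>u / tau n\<rfloor>) \<partial>lborel)"
    by (intro nn_integral_cong) (auto simp: loss_on_def approx_def idx_before_last_step[OF t] split: split_indicator)
  also have "\<dots> = (\<Sum>i<idx n t. ennreal (tau n) * ?l i)"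
    unfolding last_step_def by (rule nn_integral_step_function[OF tau_pos])
  finally have 1: "(\<integral>\<^sup>+u. indicator {0..<last_step n t} u * loss_on n g u \<partial>lborel) =
      (\<Sum>i<idx n t. ennreal (tau n) * ?l i)" .
  have "(\<integral>\<^sup>+u. indicator {0..<last_step n t} u * gain_on n g u \<partial>lborel) =
      (\<integral>\<^sup>+u. indicator {0..<last_step n t} u * ?g (nat \<lfloor>u / tau n\<rfloor>) \<partial>lborel)"
    by (intro nn_integral_cong) (auto simp: gain_on_def approx_def idx_before_last_step[OF t] split: split_indicator)
  also have "\<dots> = (\<Sum>i<idx n t. ennreal (tau n) * ?g i)"
    unfolding last_step_def by (rule nn_integral_step_function[OF tau_pos])
  finally have 2: "(\<integral>\<^sup>+u. indicator {0..<last_step n t} u * gain_on n g u \<partial>lborel) =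
      (\<Sum>i<idx n t. ennreal (tau n) * ?g i)" .
  show ?thesis
    unfolding 1 2 approx_def using idx_le[OF t, of n] by (intro scheme_sum_identity[OF g]) simp
qed

end

text \<open>Joint measurability is what Fubini in time and size requires;
  \<open>jointly_measurable_version\<close> supplies densities with this property.\<close>

locale coag_frag_flow = coag_frag_limit +
  assumes f_pair: "case_prod f \<in> borel_measurable (borel \<Otimes>\<^sub>M borel)"
begin

lemma f_measurable' [measurable (raw)]:
  "a \<in> borel_measurable M \<Longrightarrow> b \<in> borel_measurable M \<Longrightarrow> (\<lambda>x. f (a x) (b x)) \<in> borel_measurable M"
  using measurable_compose[OF measurable_Pair f_pair] by simp

lemma rate_measurable' [measurable (raw)]:
  assumes [measurable]: "a \<in> borel_measurable M" "b \<in> borel_measurable M"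
  shows "(\<lambda>x. rate K S (f (a x)) (b x)) \<in> borel_measurable M"
  unfolding rate_def by measurable

lemma coag_measurable' [measurable (raw)]:
  assumes [measurable]: "a \<in> borel_measurable M" "b \<in> borel_measurable M"
  shows "(\<lambda>x. coag K (f (a x)) (b x)) \<in> borel_measurable M"
  unfolding coag_def by measurable

lemma frag_measurable' [measurable (raw)]:
  assumes [measurable]: "a \<in> borel_measurable M" "b \<in> borel_measurable M"
  shows "(\<lambda>x. frag G (f (a x)) (b x)) \<in> borel_measurable M"
  unfolding frag_def by measurable

lemma gain_measurable' [measurable (raw)]:
  assumes [measurable]: "a \<in> borel_measurable M" "b \<in> borel_measurable M"
  shows "(\<lambda>x. gain K G (f (a x)) (b x)) \<in> borel_measurable M"
  unfolding gain_def by measurable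

section \<open>Convergence of rate, loss and gain\<close>

lemma eventually_r_gt: "\<forall>\<^sub>F n in sequentially. z < real (r n)"
proof -
  obtain m where m: "z < real m" using reals_Archimedean2 by blast
  show ?thesis using eventually_ge_at_top[of m]
  proof eventually_elim
    case (elim n)
    then show ?case using seq_suble[OF r, of n] m by linarith
  qed
qed

lemma truncation_tendsto:
  "(\<lambda>n. Kn (r n) x y) \<longlonglongrightarrow> K x y" "(\<lambda>n. Gn (r n) y x) \<longlonglongrightarrow> G y x" "(\<lambda>n. Sn (r n) y) \<longlonglongrightarrow> S y"
proof -
  show "(\<lambda>n. Kn (r n) x y) \<longlonglongrightarrow> K x y"
    by (rule tendsto_eventually) (use eventually_r_gt[of "x + y"] in \<open>eventually_elim, simp add: trunc_K_def\<close>)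
  show "(\<lambda>n. Gn (r n) y x) \<longlonglongrightarrow> G y x"
    by (rule tendsto_eventually) (use eventually_r_gt[of y] in \<open>eventually_elim, simp add: trunc_G_def\<close>)
  show "(\<lambda>n. Sn (r n) y) \<longlonglongrightarrow> S y"
    by (rule tendsto_eventually) (use eventually_r_gt[of y] in \<open>eventually_elim, simp add: trunc_S_def\<close>)
qed

lemma trunc_measurable [measurable (raw)]:
  assumes [measurable]: "a \<in> borel_measurable M" "b \<in> borel_measurable M"
  shows "(\<lambda>x. Kn n (a x) (b x)) \<in> borel_measurable M" "(\<lambda>x. Gn n (a x) (b x)) \<in> borel_measurable M"
    "(\<lambda>x. Sn n (a x)) \<in> borel_measurable M"
  unfolding trunc_K_def trunc_G_def trunc_S_def by measurable

lemma rate_tendsto: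
  assumes t: "0 \<le> t"
  shows "(\<lambda>n. rate (Kn (r n)) (Sn (r n)) (approx (r n) t) x) \<longlonglongrightarrow> rate K S (f t) x"
  unfolding rate_def
proof (rule tendsto_add[OF _ truncation_tendsto(3)])
  show "(\<lambda>n. \<integral>\<^sup>+y. Kn (r n) x y * approx (r n) t y \<partial>lborel) \<longlonglongrightarrow> (\<integral>\<^sup>+y. K x y * f t y \<partial>lborel)"
  proof (rule converges_toD[OF conv[OF t]])
    show "C * wt l x < top" using C_fin by (simp add: ennreal_mult_less_top)
    show "Kn (r n) x y \<le> C * wt l x * wt l y" for n y
      using K_le[of x y] by (auto simp: trunc_K_def split: split_indicator)
  qed (measurable, rule truncation_tendsto)
qed

text \<open>The quadratic loss is linear in the density once the rate is regarded as the test
  function: the rate converges pointwise, and on sizes below R it is bounded by a constant times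
  \<open>wt l\<close>, uniformly in n.\<close>

lemma loss_tendsto:
  assumes t: "0 \<le> t" and E [measurable]: "E \<in> sets borel" "E \<subseteq> {0<..<R}" and R: "1 \<le> R"
  shows "(\<lambda>n. loss_on (r n) (indicator E) t) \<longlonglongrightarrow> (\<integral>\<^sup>+x. indicator E x * (rate K S (f t) x * f t x) \<partial>lborel)"
proof -
  define u where "u n x = indicator E x * rate (Kn (r n)) (Sn (r n)) (approx (r n) t) x" for n x
  have [measurable]: "u n \<in> borel_measurable borel" for n
    unfolding u_def rate_def by measurable
  have "(\<lambda>n. \<integral>\<^sup>+x. u n x * approx (r n) t x \<partial>lborel) \<longlonglongrightarrow>
      (\<integral>\<^sup>+x. (indicator E x * rate K S (f t) x) * f t x \<partial>lborel)"
  proof (rule converges_toD[OF conv[OF t]])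
    show "C * mbound t + s R < top" using C_fin s_fin mbound_fin by (simp add: ennreal_mult_less_top)
    show "u n x \<le> (C * mbound t + s R) * wt l x" for n x
    proof (cases "x \<in> E")
      case True
      interpret tr: coag_frag_kernels "Kn (r n)" "Gn (r n)" "Sn (r n)" l C N s k d by (rule truncated_kernels)
      have "x < R" using True E(2) by auto
      have "u n x \<le> C * wt l x * mbound t + s R"
        using True tr.kernel_integral_le[OF approx_measurable moment_approx[OF t], of x] tr.S_le[OF R \<open>x < R\<close>]
        by (simp add: u_def rate_def add_mono)
      also have "\<dots> \<le> C * wt l x * mbound t + s R * wt l x"
        using mult_left_mono[OF wt_ge_1[OF l(1), of x], of "s R"] by (intro add_left_mono) simp
      also have "\<dots> = (C * mbound t + s R) * wt l x" by (simp add: algebra_simps)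
      finally show ?thesis .
    qed (simp add: u_def)
    show "(\<lambda>n. u n x) \<longlonglongrightarrow> indicator E x * rate K S (f t) x" for x
      unfolding u_def by (rule ennreal_tendsto_cmult) (auto simp: rate_tendsto[OF t] split: split_indicator)
  qed measurable
  then show ?thesis unfolding loss_on_def u_def by (simp add: mult.assoc)
qed

text \<open>The double integral is handled by applying \<open>converges_to\<close> twice: first to
  the inner integral with y fixed, then with the inner integral as varying test function in y,
  dominated by \<open>C * mbound t * wt l y\<close>. For fragmentation the truncation is inactive
  from some index on for each parent.\<close>

lemma gain_tendsto:
  assumes t: "0 \<le> t" and E [measurable]: "E \<in> sets borel" "E \<subseteq> {0<..<R}" and R: "1 \<le> R"
  shows "(\<lambda>n. gain_on (r n) (indicator E) t) \<longlonglongrightarrow> (\<integral>\<^sup>+x. indicator E x * gain K G (f t) x \<partial>lborel)"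
proof -
  have g: "(indicator E :: real \<Rightarrow> ennreal) \<in> borel_measurable borel" by measurable
  have inner: "(\<lambda>n. \<integral>\<^sup>+x. (indicator E (x + y) * Kn (r n) x y) * approx (r n) t x \<partial>lborel) \<longlonglongrightarrow>
      (\<integral>\<^sup>+x. (indicator E (x + y) * K x y) * f t x \<partial>lborel)" for y
  proof (rule converges_toD[OF conv[OF t]])
    show "C * wt l y < top" using C_fin by (simp add: ennreal_mult_less_top)
    show "indicator E (x + y) * Kn (r n) x y \<le> C * wt l y * wt l x" for n x
      using K_le[of x y] by (auto simp: trunc_K_def mult.assoc mult.commute mult.left_commute split: split_indicator)
    show "(\<lambda>n. indicator E (x + y) * Kn (r n) x y) \<longlonglongrightarrow> indicator E (x + y) * K x y" for x
      by (rule ennreal_tendsto_cmult[OF _ truncation_tendsto(1)]) (auto split: split_indicator)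
  qed measurable
  have "(\<lambda>n. \<integral>\<^sup>+y. (\<integral>\<^sup>+x. (indicator E (x + y) * Kn (r n) x y) * approx (r n) t x \<partial>lborel) * approx (r n) t y \<partial>lborel) \<longlonglongrightarrow>
      (\<integral>\<^sup>+y. (\<integral>\<^sup>+x. (indicator E (x + y) * K x y) * f t x \<partial>lborel) * f t y \<partial>lborel)"
  proof (rule converges_toD[OF conv[OF t] _ _ _ _ inner])
    show "C * mbound t < top" using C_fin mbound_fin by (simp add: ennreal_mult_less_top)
    fix n y
    interpret tr: coag_frag_kernels "Kn (r n)" "Gn (r n)" "Sn (r n)" l C N s k d by (rule truncated_kernels)
    have "(\<integral>\<^sup>+x. (indicator E (x + y) * Kn (r n) x y) * approx (r n) t x \<partial>lborel) \<le>
        (\<integral>\<^sup>+x. Kn (r n) y x * approx (r n) t x \<partial>lborel)"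
      by (intro nn_integral_mono mult_right_mono) (auto simp: tr.K_sym[of y] split: split_indicator)
    also have "\<dots> \<le> C * wt l y * mbound t"
      by (rule tr.kernel_integral_le[OF approx_measurable moment_approx[OF t]])
    finally show "(\<integral>\<^sup>+x. (indicator E (x + y) * Kn (r n) x y) * approx (r n) t x \<partial>lborel) \<le> C * mbound t * wt l y"
      by (simp add: ac_simps)
  qed measurable
  moreover have pull: "(\<integral>\<^sup>+y. (\<integral>\<^sup>+x. (indicator E (x + y) * k' x y) * h x \<partial>lborel) * h y \<partial>lborel) =
      (\<integral>\<^sup>+y. \<integral>\<^sup>+x. indicator E (x + y) * (k' x y * h x * h y) \<partial>lborel \<partial>lborel)"
    if [measurable]: "case_prod k' \<in> borel_measurable (borel \<Otimes>\<^sub>M borel)" "h \<in> borel_measurable borel" for k' h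
    by (subst nn_integral_multc[symmetric]) (auto simp: mult.assoc)
  have Kp: "case_prod (Kn n) \<in> borel_measurable (borel \<Otimes>\<^sub>M borel)" for n
    unfolding trunc_K_def by measurable
  ultimately have 1: "(\<lambda>n. ennreal (1 / 2) *
      (\<integral>\<^sup>+y. \<integral>\<^sup>+x. indicator E (x + y) * (Kn (r n) x y * approx (r n) t x * approx (r n) t y) \<partial>lborel \<partial>lborel)) \<longlonglongrightarrow>
      ennreal (1 / 2) * (\<integral>\<^sup>+y. \<integral>\<^sup>+x. indicator E (x + y) * (K x y * f t x * f t y) \<partial>lborel \<partial>lborel)"
    unfolding pull[OF Kp approx_measurable] pull[OF K_pair f_measurable]
    by (intro ennreal_tendsto_cmult ennreal_less_top)
  have 2: "(\<lambda>n. \<integral>\<^sup>+y. (\<integral>\<^sup>+x. indicator E x * Gn (r n) y x \<partial>lborel) * approx (r n) t y \<partial>lborel) \<longlonglongrightarrow>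
      (\<integral>\<^sup>+y. (\<integral>\<^sup>+x. indicator E x * G y x \<partial>lborel) * f t y \<partial>lborel)"
  proof (rule converges_toD[OF conv[OF t]])
    show "frag_const R < top" by (rule frag_const_fin)
    fix n y
    interpret tr: coag_frag_kernels "Kn (r n)" "Gn (r n)" "Sn (r n)" l C N s k d by (rule truncated_kernels)
    show "(\<integral>\<^sup>+x. indicator E x * Gn (r n) y x \<partial>lborel) \<le> frag_const R * wt l y"
      by (rule tr.frag_le[OF R E])
  next
    fix y
    show "(\<lambda>n. \<integral>\<^sup>+x. indicator E x * Gn (r n) y x \<partial>lborel) \<longlonglongrightarrow> (\<integral>\<^sup>+x. indicator E x * G y x \<partial>lborel)"
      by (rule tendsto_eventually) (use eventually_r_gt[of y] in \<open>eventually_elim, simp add: trunc_G_def\<close>)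
  qed measurable
  have eq: "gain_on (r n) (indicator E) t = ennreal (1 / 2) *
      (\<integral>\<^sup>+y. \<integral>\<^sup>+x. indicator E (x + y) * (Kn (r n) x y * approx (r n) t x * approx (r n) t y) \<partial>lborel \<partial>lborel) +
      (\<integral>\<^sup>+y. (\<integral>\<^sup>+x. indicator E x * Gn (r n) y x \<partial>lborel) * approx (r n) t y \<partial>lborel)" for n
  proof -
    interpret tr: coag_frag_kernels "Kn (r n)" "Gn (r n)" "Sn (r n)" l C N s k d by (rule truncated_kernels)
    show ?thesis unfolding gain_on_def tr.gain_test[OF approx_measurable g] by (simp only: mult.commute)
  qed
  have eq': "(\<integral>\<^sup>+x. indicator E x * gain K G (f t) x \<partial>lborel) = ennreal (1 / 2) *
      (\<integral>\<^sup>+y. \<integral>\<^sup>+x. indicator E (x + y) * (K x y * f t x * f t y) \<partial>lborel \<partial>lborel) +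
      (\<integral>\<^sup>+y. (\<integral>\<^sup>+x. indicator E x * G y x \<partial>lborel) * f t y \<partial>lborel)"
    unfolding gain_test[OF f_measurable g] by (simp only: mult.commute)
  show ?thesis unfolding eq eq' by (rule tendsto_add[OF 1 2])
qed

lemma last_step_tendsto: assumes t: "0 \<le> t" shows "(\<lambda>n. last_step (r n) t) \<longlonglongrightarrow> t"
proof (rule tendsto_sandwich[where f = "\<lambda>n. t - tau (r n)" and h = "\<lambda>_. t"])
  show "\<forall>\<^sub>F n in sequentially. t - tau (r n) \<le> last_step (r n) t"
    using eventually_r_gt[of t]
  proof eventually_elim
    case (elim n)
    then show ?case using idx_gt[OF t, of "r n"] by (simp add: last_step_def)
  qed
  show "\<forall>\<^sub>F n in sequentially. last_step (r n) t \<le> t"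
    using idx_le[OF t] by (simp add: last_step_def)
  show "(\<lambda>n. t - tau (r n)) \<longlonglongrightarrow> t" using tendsto_diff[OF tendsto_const tau_r_tendsto, of t] by simp
qed simp

text \<open>The moving endpoint tends to t, so the indicators converge except at the endpoints,
  which form a null set; this also accounts for the change from a half-open to an open
  interval.\<close>

lemma time_integral_tendsto:
  assumes t: "0 \<le> t" and [measurable]: "\<And>n. \<psi> n \<in> borel_measurable borel" "\<psi>' \<in> borel_measurable borel"
    and b: "b < top" "\<And>n u. 0 \<le> u \<Longrightarrow> u \<le> t \<Longrightarrow> \<psi> n u \<le> b"
    and lim: "\<And>u. 0 \<le> u \<Longrightarrow> (\<lambda>n. \<psi> n u) \<longlonglongrightarrow> \<psi>' u"
  shows "(\<lambda>n. \<integral>\<^sup>+u. indicator {0..<last_step (r n) t} u * \<psi> n u \<partial>lborel) \<longlonglongrightarrow>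
    (\<integral>\<^sup>+u. indicator {0<..<t} u * \<psi>' u \<partial>lborel)"
proof (rule nn_integral_dominated_convergence[where w = "\<lambda>u. b * indicator {0..t} u"])
  have le: "last_step (r n) t \<le> t" for n using idx_le[OF t] by (simp add: last_step_def)
  show "AE u in lborel. indicator {0..<last_step (r n) t} u * \<psi> n u \<le> b * indicator {0..t} u" for n
    using b(2) le[of n] by (intro AE_I2) (auto split: split_indicator)
  show "(\<integral>\<^sup>+u. b * indicator {0..t} u \<partial>lborel) < \<infinity>"
    using b(1) t by (subst nn_integral_cmult_indicator) (auto simp: ennreal_mult_less_top)
  have "AE u in lborel. u \<noteq> t" "AE u in lborel. u \<noteq> (0::real)" by (rule AE_lborel_singleton)+
  then show "AE u in lborel. (\<lambda>n. indicator {0..<last_step (r n) t} u * \<psi> n u) \<longlonglongrightarrow> indicator {0<..<t} u * \<psi>' u"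
  proof eventually_elim
    case (elim u)
    show ?case
    proof (cases "0 < u \<and> u < t")
      case True
      have "\<forall>\<^sub>F n in sequentially. u < last_step (r n) t"
        using order_tendstoD(1)[OF last_step_tendsto[OF t]] True by blast
      then have "\<forall>\<^sub>F n in sequentially. \<psi> n u = indicator {0..<last_step (r n) t} u * \<psi> n u"
        using True by (auto elim!: eventually_mono)
      then have "(\<lambda>n. indicator {0..<last_step (r n) t} u * \<psi> n u) \<longlonglongrightarrow> \<psi>' u"
        using lim[of u] True by (auto elim: Lim_transform_eventually)
      then show ?thesis using True by simp
    next
      case False
      then have "indicator {0..<last_step (r n) t} u = (0 :: ennreal)" for n
        using elim le[of n] by (auto split: split_indicator)
      then show ?thesis using False by simp
    qed
  qed
qed measurable

text \<open>By \<open>approx_identity\<close> one and the same sequence has both sides as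
  limits.\<close>

lemma limit_identity:
  assumes t: "0 \<le> t" and E: "E \<in> sets borel" "E \<subseteq> {0<..<R}" and R: "1 \<le> R"
  shows "(\<integral>\<^sup>+x. indicator E x * f t x \<partial>lborel) +
      (\<integral>\<^sup>+u. indicator {0<..<t} u * (\<integral>\<^sup>+x. indicator E x * (rate K S (f u) x * f u x) \<partial>lborel) \<partial>lborel) =
    (\<integral>\<^sup>+x. indicator E x * f0 x \<partial>lborel) +
      (\<integral>\<^sup>+u. indicator {0<..<t} u * (\<integral>\<^sup>+x. indicator E x * gain K G (f u) x \<partial>lborel) \<partial>lborel)"
proof (rule LIMSEQ_unique)
  have [measurable]: "E \<in> sets borel" by fact
  have g: "(indicator E :: real \<Rightarrow> ennreal) \<in> borel_measurable borel" by measurable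
  have gw: "indicator E x \<le> 1 * wt l x" for x
    using wt_ge_1[OF l(1), of x] by (auto split: split_indicator)
  have gc: "indicator E x \<le> (1 :: ennreal) * indicator {0<..<R} x" for x
    using E(2) by (auto split: split_indicator)
  have fl: "loss_on (r n) (indicator E) u \<le> flux_bound R (mbound t)"
    "gain_on (r n) (indicator E) u \<le> flux_bound R (mbound t)" if "0 \<le> u" "u \<le> t" for n u
    using flux_on_le[OF g R gc density_fun_approx order_trans[OF moment_approx[OF that(1)] mbound_mono[OF that(2)]]]
    unfolding loss_on_def gain_on_def by auto
  have b: "flux_bound R (mbound t) < top" by (rule flux_bound_fin[OF mbound_fin])
  show "(\<lambda>n. (\<integral>\<^sup>+x. indicator E x * approx (r n) t x \<partial>lborel) +
      (\<integral>\<^sup>+u. indicator {0..<last_step (r n) t} u * loss_on (r n) (indicator E) u \<partial>lborel)) \<longlonglongrightarrow>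
    (\<integral>\<^sup>+x. indicator E x * f t x \<partial>lborel) +
      (\<integral>\<^sup>+u. indicator {0<..<t} u * (\<integral>\<^sup>+x. indicator E x * (rate K S (f u) x * f u x) \<partial>lborel) \<partial>lborel)"
    by (intro tendsto_add converges_fixed[OF t g _ gw] time_integral_tendsto[OF t _ _ b fl(1)]
        loss_tendsto[OF _ E R] loss_on_measurable) (simp, measurable)
  show "(\<lambda>n. (\<integral>\<^sup>+x. indicator E x * approx (r n) t x \<partial>lborel) +
      (\<integral>\<^sup>+u. indicator {0..<last_step (r n) t} u * loss_on (r n) (indicator E) u \<partial>lborel)) \<longlonglongrightarrow>
    (\<integral>\<^sup>+x. indicator E x * f0 x \<partial>lborel) +
      (\<integral>\<^sup>+u. indicator {0<..<t} u * (\<integral>\<^sup>+x. indicator E x * gain K G (f u) x \<partial>lborel) \<partial>lborel)"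
    unfolding approx_identity[OF g t]
    by (intro tendsto_add tendsto_const time_integral_tendsto[OF t _ _ b fl(2)]
        gain_tendsto[OF _ E R] gain_on_measurable) measurable
qed

end

section \<open>The pointwise equation\<close>

lemma continuous_on_time_integral:
  fixes h :: "real \<Rightarrow> ennreal"
  assumes [measurable]: "h \<in> borel_measurable borel"
    and fin: "\<And>t. 0 \<le> t \<Longrightarrow> (\<integral>\<^sup>+u. indicator {0<..<t} u * h u \<partial>lborel) < top"
  shows "continuous_on {0..} (\<lambda>t. enn2real (\<integral>\<^sup>+u. indicator {0<..<t} u * h u \<partial>lborel))"
  unfolding continuous_on_sequentially
proof (intro allI ballI impI, elim conjE)
  fix x :: "nat \<Rightarrow> real" and t assume x: "\<forall>n. x n \<in> {0..}" and t: "t \<in> {0..}" and lim: "x \<longlonglongrightarrow> t"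
  have "Bseq x" using lim by (rule convergent_imp_Bseq[OF convergentI])
  then obtain M where M: "0 < M" "\<And>n. norm (x n) \<le> M" by (auto elim: BseqE)
  have "(\<lambda>n. \<integral>\<^sup>+u. indicator {0<..<x n} u * h u \<partial>lborel) \<longlonglongrightarrow> (\<integral>\<^sup>+u. indicator {0<..<t} u * h u \<partial>lborel)"
  proof (rule nn_integral_dominated_convergence[where w = "\<lambda>u. indicator {0<..<M} u * h u"])
    have "x n \<le> M" for n using M(2)[of n] by simp
    then show "AE u in lborel. indicator {0<..<x n} u * h u \<le> indicator {0<..<M} u * h u" for n
      by (intro AE_I2 mult_right_mono) (auto split: split_indicator intro: order.strict_trans2)
    show "(\<integral>\<^sup>+u. indicator {0<..<M} u * h u \<partial>lborel) < \<infinity>" using fin[of M] M(1) by simp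
    show "AE u in lborel. (\<lambda>n. indicator {0<..<x n} u * h u) \<longlonglongrightarrow> indicator {0<..<t} u * h u"
      using AE_lborel_singleton[of t]
    proof eventually_elim
      case (elim u)
      have ev: "\<forall>\<^sub>F n in sequentially. u < x n \<longleftrightarrow> u < t"
      proof (cases "u < t")
        case True
        then show ?thesis using order_tendstoD(1)[OF lim True] by (auto elim: eventually_mono)
      next
        case False
        then have "t < u" using elim by simp
        then have "\<forall>\<^sub>F n in sequentially. x n < u" by (rule order_tendstoD(2)[OF lim])
        then show ?thesis using \<open>t < u\<close> by (auto elim!: eventually_mono)
      qed
      show ?case
        by (rule tendsto_eventually) (use ev in \<open>eventually_elim, auto split: split_indicator\<close>)
    qed
  qed measurable
  moreover obtain c where c: "(\<integral>\<^sup>+u. indicator {0<..<t} u * h u \<partial>lborel) = ennreal c" "0 \<le> c"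
    using fin[of t] t by (auto simp: less_top_ennreal)
  ultimately have "(\<lambda>n. enn2real (\<integral>\<^sup>+u. indicator {0<..<x n} u * h u \<partial>lborel)) \<longlonglongrightarrow> c"
    by (intro tendsto_enn2real) simp_all
  then show "((\<lambda>t. enn2real (\<integral>\<^sup>+u. indicator {0<..<t} u * h u \<partial>lborel)) \<circ> x) \<longlonglongrightarrow>
      enn2real (\<integral>\<^sup>+u. indicator {0<..<t} u * h u \<partial>lborel)"
    using c by (simp add: o_def)
qed

lemma continuous_nonneg_from_rationals:
  fixes g :: "real \<Rightarrow> real"
  assumes cont: "continuous_on {0..} g" and q: "\<And>q. q \<in> \<rat> \<Longrightarrow> 0 \<le> q \<Longrightarrow> 0 \<le> g q" and t: "0 \<le> t"
  shows "0 \<le> g t"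
proof -
  have "\<exists>q. q \<in> \<rat> \<and> t < q \<and> q < t + 1 / real (Suc n)" for n
    using Rats_dense_in_real[of t "t + 1 / real (Suc n)"] by auto
  then obtain Q where Q: "\<And>n. Q n \<in> \<rat> \<and> t < Q n \<and> Q n < t + 1 / real (Suc n)" by metis
  have "Q \<longlonglongrightarrow> t"
  proof (rule tendsto_sandwich[where f = "\<lambda>_. t" and h = "\<lambda>n. t + 1 / real (Suc n)"])
    show "(\<lambda>n. t + 1 / real (Suc n)) \<longlonglongrightarrow> t"
      using tendsto_add[OF tendsto_const LIMSEQ_inverse_real_of_nat, of t] by (simp add: inverse_eq_divide)
    show "\<forall>\<^sub>F n in sequentially. t \<le> Q n" "\<forall>\<^sub>F n in sequentially. Q n \<le> t + 1 / real (Suc n)"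
      using Q by (intro always_eventually allI less_imp_le; blast)+
  qed simp
  moreover have "\<forall>n. Q n \<in> {0..}" using Q t by (auto intro: less_imp_le order.strict_trans1)
  ultimately have "(g \<circ> Q) \<longlonglongrightarrow> g t"
    using cont t unfolding continuous_on_sequentially by auto
  then show ?thesis
    using Q t by (intro LIMSEQ_le_const[of "g \<circ> Q"]) (auto intro!: q intro: less_imp_le order.strict_trans1)
qed

lemma AE_eq_from_local_integrals:
  fixes A B :: "real \<Rightarrow> ennreal"
  assumes [measurable]: "A \<in> borel_measurable borel" "B \<in> borel_measurable borel"
    and zero: "\<And>x. x \<le> 0 \<Longrightarrow> A x = B x"
    and eq: "\<And>E R. E \<in> sets borel \<Longrightarrow> E \<subseteq> {0<..<R} \<Longrightarrow> 1 \<le> R \<Longrightarrow>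
      (\<integral>\<^sup>+x. indicator E x * A x \<partial>lborel) = (\<integral>\<^sup>+x. indicator E x * B x \<partial>lborel)"
  shows "AE x in lborel. A x = B x"
proof -
  have "AE x in lborel. indicator {0<..<real (Suc n)} x * A x = indicator {0<..<real (Suc n)} x * B x" for n
  proof (rule sigma_finite_measure.density_unique[OF sigma_finite_lborel])
    show "density lborel (\<lambda>x. indicator {0<..<real (Suc n)} x * A x) =
        density lborel (\<lambda>x. indicator {0<..<real (Suc n)} x * B x)"
    proof (rule measure_eqI)
      fix E assume "E \<in> sets (density lborel (\<lambda>x. indicator {0<..<real (Suc n)} x * A x))"
      then have E [measurable]: "E \<in> sets borel" by simp
      have "(\<integral>\<^sup>+x. indicator {0<..<real (Suc n)} x * H x * indicator E x \<partial>lborel) =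
          (\<integral>\<^sup>+x. indicator (E \<inter> {0<..<real (Suc n)}) x * H x \<partial>lborel)" for H
        by (intro nn_integral_cong) (auto split: split_indicator)
      then show "emeasure (density lborel (\<lambda>x. indicator {0<..<real (Suc n)} x * A x)) E =
          emeasure (density lborel (\<lambda>x. indicator {0<..<real (Suc n)} x * B x)) E"
        using eq[of "E \<inter> {0<..<real (Suc n)}" "real (Suc n)"] by (simp add: emeasure_density)
    qed simp
  qed measurable
  then have "AE x in lborel. \<forall>n. indicator {0<..<real (Suc n)} x * A x = indicator {0<..<real (Suc n)} x * B x"
    unfolding AE_all_countable by blast
  then show ?thesis
  proof eventually_elim
    case (elim x)
    show ?case
    proof (cases "0 < x")
      case True
      obtain n where "x < real n" using reals_Archimedean2 by blast
      then have "x < real (Suc n)" by simp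
      then show ?thesis using elim[rule_format, of n] True by simp
    qed (simp add: zero)
  qed
qed

text \<open>Integrals over sizes use the \<open>ennreal\<close> density \<open>f\<close>; the values
  at the size x itself use its continuous version \<open>F\<close>. For a fixed time the two agree
  at almost every size, so the integrals do not see the difference.\<close>

definition net_rate ::
  "(real \<Rightarrow> real \<Rightarrow> ennreal) \<Rightarrow> (real \<Rightarrow> real \<Rightarrow> ennreal) \<Rightarrow> (real \<Rightarrow> ennreal) \<Rightarrow>
    (real \<Rightarrow> real \<Rightarrow> ennreal) \<Rightarrow> (real \<Rightarrow> real \<Rightarrow> real) \<Rightarrow> real \<Rightarrow> real \<Rightarrow> real" where
  "net_rate K G S f F x u = 1 / 2 * enn2real (coag K (f u) x)
    - enn2real (\<integral>\<^sup>+y. K x y * f u y \<partial>lborel) * F u x + enn2real (frag G (f u) x) - enn2real (S x) * F u x"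

definition pointwise_solution ::
  "(real \<Rightarrow> real \<Rightarrow> ennreal) \<Rightarrow> (real \<Rightarrow> real \<Rightarrow> ennreal) \<Rightarrow> (real \<Rightarrow> ennreal) \<Rightarrow> (real \<Rightarrow> ennreal) \<Rightarrow>
    (real \<Rightarrow> real \<Rightarrow> ennreal) \<Rightarrow> (real \<Rightarrow> real \<Rightarrow> real) \<Rightarrow> real \<Rightarrow> bool" where
  "pointwise_solution K G S f0 f F x \<longleftrightarrow> continuous_on {0..} (\<lambda>t. F t x) \<and> (\<forall>t\<ge>0. 0 \<le> F t x \<and>
    (\<integral>\<^sup>+u. indicator {0<..<t} u * coag K (f u) x \<partial>lborel) < top \<and>
    (\<integral>\<^sup>+u. indicator {0<..<t} u * (\<integral>\<^sup>+y. K x y * f u y \<partial>lborel) \<partial>lborel) < top \<and>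
    (\<integral>\<^sup>+u. indicator {0<..<t} u * frag G (f u) x \<partial>lborel) < top \<and>
    set_integrable lborel {0<..<t} (net_rate K G S f F x) \<and>
    F t x = enn2real (f0 x) + (LINT u:{0<..<t}|lborel. net_rate K G S f F x u))"

context coag_frag_flow
begin

definition total_loss :: "real \<Rightarrow> real \<Rightarrow> ennreal" where
  "total_loss t x = (\<integral>\<^sup>+u. indicator {0<..<t} u * (rate K S (f u) x * f u x) \<partial>lborel)"

definition total_gain :: "real \<Rightarrow> real \<Rightarrow> ennreal" where
  "total_gain t x = (\<integral>\<^sup>+u. indicator {0<..<t} u * gain K G (f u) x \<partial>lborel)"

lemma total_measurable [measurable (raw)]:
  assumes [measurable]: "a \<in> borel_measurable M" "b \<in> borel_measurable M"
  shows "(\<lambda>x. total_loss (a x) (b x)) \<in> borel_measurable M"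
    and "(\<lambda>x. total_gain (a x) (b x)) \<in> borel_measurable M"
  unfolding total_loss_def total_gain_def indicator_def greaterThanLessThan_iff by measurable

lemma total_zero: "x \<le> 0 \<Longrightarrow> total_loss t x = 0" "x \<le> 0 \<Longrightarrow> total_gain t x = 0"
  by (simp_all add: total_loss_def total_gain_def gain_zero density_fun_zero[OF f])

lemma total_mono:
  assumes "t \<le> t'" shows "total_loss t x \<le> total_loss t' x" "total_gain t x \<le> total_gain t' x"
  unfolding total_loss_def total_gain_def using assms
  by (intro nn_integral_mono mult_right_mono; auto split: split_indicator)+

lemma set_total:
  assumes [measurable]: "E \<in> sets borel"
  shows "(\<integral>\<^sup>+x. indicator E x * total_loss t x \<partial>lborel) =
      (\<integral>\<^sup>+u. indicator {0<..<t} u * (\<integral>\<^sup>+x. indicator E x * (rate K S (f u) x * f u x) \<partial>lborel) \<partial>lborel)"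
    and "(\<integral>\<^sup>+x. indicator E x * total_gain t x \<partial>lborel) =
      (\<integral>\<^sup>+u. indicator {0<..<t} u * (\<integral>\<^sup>+x. indicator E x * gain K G (f u) x \<partial>lborel) \<partial>lborel)"
proof -
  have swap: "(\<integral>\<^sup>+x. indicator E x * (\<integral>\<^sup>+u. indicator {0<..<t} u * H u x \<partial>lborel) \<partial>lborel) =
      (\<integral>\<^sup>+u. indicator {0<..<t} u * (\<integral>\<^sup>+x. indicator E x * H u x \<partial>lborel) \<partial>lborel)"
    if [measurable]: "case_prod H \<in> borel_measurable (borel \<Otimes>\<^sub>M borel)" for H :: "real \<Rightarrow> real \<Rightarrow> ennreal"
  proof -
    have "(\<integral>\<^sup>+x. indicator E x * (\<integral>\<^sup>+u. indicator {0<..<t} u * H u x \<partial>lborel) \<partial>lborel) =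
        (\<integral>\<^sup>+x. \<integral>\<^sup>+u. indicator E x * (indicator {0<..<t} u * H u x) \<partial>lborel \<partial>lborel)"
      by (subst nn_integral_cmult) auto
    also have "\<dots> = (\<integral>\<^sup>+u. \<integral>\<^sup>+x. indicator E x * (indicator {0<..<t} u * H u x) \<partial>lborel \<partial>lborel)"
      by (rule lborel_pair.Fubini') measurable
    also have "\<dots> = (\<integral>\<^sup>+u. indicator {0<..<t} u * (\<integral>\<^sup>+x. indicator E x * H u x \<partial>lborel) \<partial>lborel)"
      by (subst nn_integral_cmult[symmetric]) (auto simp: mult.left_commute)
    finally show ?thesis .
  qed
  show "(\<integral>\<^sup>+x. indicator E x * total_loss t x \<partial>lborel) =
      (\<integral>\<^sup>+u. indicator {0<..<t} u * (\<integral>\<^sup>+x. indicator E x * (rate K S (f u) x * f u x) \<partial>lborel) \<partial>lborel)"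
    unfolding total_loss_def by (rule swap) measurable
  show "(\<integral>\<^sup>+x. indicator E x * total_gain t x \<partial>lborel) =
      (\<integral>\<^sup>+u. indicator {0<..<t} u * (\<integral>\<^sup>+x. indicator E x * gain K G (f u) x \<partial>lborel) \<partial>lborel)"
    unfolding total_gain_def by (rule swap) measurable
qed

lemma pointwise_identity:
  assumes t: "0 \<le> t"
  shows "AE x in lborel. f t x + total_loss t x = f0 x + total_gain t x"
proof (rule AE_eq_from_local_integrals)
  fix E R assume E: "E \<in> sets borel" "E \<subseteq> {0<..<R}" "1 \<le> (R :: real)"
  have [measurable]: "E \<in> sets borel" by fact
  show "(\<integral>\<^sup>+x. indicator E x * (f t x + total_loss t x) \<partial>lborel) =
      (\<integral>\<^sup>+x. indicator E x * (f0 x + total_gain t x) \<partial>lborel)"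
    using limit_identity[OF t E] by (simp add: distrib_left nn_integral_add set_total)
qed (auto simp: total_zero density_fun_zero[OF f] density_fun_zero[OF f0])

text \<open>One null set serves all times: both totals are monotone in time, so finiteness at
  integer times, a countable family of conditions, is enough.\<close>

lemma AE_total_finite: "AE x in lborel. \<forall>t\<ge>0. total_loss t x < top \<and> total_gain t x < top"
proof -
  have "AE x in lborel. 0 < x \<and> x < real (Suc n) \<longrightarrow> total_loss (real n) x < top \<and> total_gain (real n) x < top" for n :: nat
  proof -
    let ?E = "{0<..<real (Suc n)}"
    let ?F = "flux_bound (real (Suc n)) (mbound (real n))"
    have bound: "(\<integral>\<^sup>+u. indicator {0<..<real n} u * \<psi> u \<partial>lborel) < top"
      if "\<And>u. 0 \<le> u \<Longrightarrow> u \<le> real n \<Longrightarrow> \<psi> u \<le> ?F" for \<psi>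
    proof -
      have "(\<integral>\<^sup>+u. indicator {0<..<real n} u * \<psi> u \<partial>lborel) \<le> (\<integral>\<^sup>+u. ?F * indicator {0<..<real n} u \<partial>lborel)"
        using that by (intro nn_integral_mono) (auto split: split_indicator)
      also have "\<dots> < top"
        using flux_bound_fin[OF mbound_fin] by (subst nn_integral_cmult_indicator) (auto simp: ennreal_mult_less_top)
      finally show ?thesis .
    qed
    have m: "moment (f u) \<le> mbound (real n)" if "0 \<le> u" "u \<le> real n" for u
      using moment_f[OF that(1)] mbound_mono[OF that(2)] by (rule order_trans)
    have "(\<integral>\<^sup>+x. indicator ?E x * total_loss (real n) x \<partial>lborel) < top"
      unfolding set_total[OF borel_open[OF open_greaterThanLessThan]]
      by (intro bound loss_set_le[OF f_measurable m]) auto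
    then have "AE x in lborel. indicator ?E x * total_loss (real n) x \<noteq> \<infinity>"
      by (intro nn_integral_PInf_AE) auto
    moreover have "(\<integral>\<^sup>+x. indicator ?E x * total_gain (real n) x \<partial>lborel) < top"
      unfolding set_total[OF borel_open[OF open_greaterThanLessThan]]
      by (intro bound gain_set_le[OF f_measurable m]) auto
    then have "AE x in lborel. indicator ?E x * total_gain (real n) x \<noteq> \<infinity>"
      by (intro nn_integral_PInf_AE) auto
    ultimately show ?thesis
    proof eventually_elim
      case (elim x)
      then show ?case by (auto simp: top.not_eq_extremum split: split_indicator_asm)
    qed
  qed
  then have "AE x in lborel. \<forall>n. 0 < x \<and> x < real (Suc n) \<longrightarrow> total_loss (real n) x < top \<and> total_gain (real n) x < top"
    unfolding AE_all_countable by blast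
  then show ?thesis
  proof eventually_elim
    case (elim x)
    show ?case
    proof (intro allI impI)
      fix t :: real assume t: "0 \<le> t"
      show "total_loss t x < top \<and> total_gain t x < top"
      proof (cases "0 < x")
        case True
        obtain n where n: "max x t < real n" using reals_Archimedean2 by blast
        then have "total_loss (real n) x < top \<and> total_gain (real n) x < top"
          using elim[rule_format, of n] True by simp
        then show ?thesis using total_mono[of t "real n" x] n by (auto intro: order.strict_trans1)
      qed (simp add: total_zero)
    qed
  qed
qed

section \<open>The version of the limit that is continuous in time\<close>

definition F :: "real \<Rightarrow> real \<Rightarrow> real" where
  "F t x = enn2real (f0 x) + enn2real (total_gain t x) - enn2real (total_loss t x)"

lemma F_measurable [measurable (raw)]:
  assumes [measurable]: "a \<in> borel_measurable M" "b \<in> borel_measurable M"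
  shows "(\<lambda>x. F (a x) (b x)) \<in> borel_measurable M"
  unfolding F_def by measurable

lemma AE_f0_finite: "AE x in lborel. f0 x < top"
proof -
  have "(\<integral>\<^sup>+x. f0 x \<partial>lborel) \<noteq> \<infinity>"
    using nn_integral_le_moment'[of f0] f0_fin by (auto simp: top_unique)
  then have "AE x in lborel. f0 x \<noteq> \<infinity>" by (intro nn_integral_PInf_AE) auto
  then show ?thesis by eventually_elim (simp add: top.not_eq_extremum)
qed

lemma f_eq_F:
  assumes "f t x + total_loss t x = f0 x + total_gain t x"
    and fin: "f0 x < top" "total_loss t x < top" "total_gain t x < top"
  shows "f t x = ennreal (F t x)" "0 \<le> F t x"
proof -
  obtain a b c where abc: "f0 x = ennreal a" "0 \<le> a" "total_loss t x = ennreal b" "0 \<le> b"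
      "total_gain t x = ennreal c" "0 \<le> c"
    using fin by (auto simp: less_top_ennreal)
  have "f t x \<noteq> top" using assms(1) abc by (auto simp flip: ennreal_plus)
  then obtain e where e: "f t x = ennreal e" "0 \<le> e" by (cases "f t x") auto
  have "ennreal (e + b) = ennreal (a + c)" using assms(1) abc e by simp
  then have "e + b = a + c" using abc e by (subst (asm) ennreal_inj) auto
  then have "F t x = e" using abc by (simp add: F_def)
  then show "f t x = ennreal (F t x)" "0 \<le> F t x" using e by auto
qed

lemma AE_f_eq_F:
  assumes t: "0 \<le> t" shows "AE x in lborel. f t x = ennreal (F t x)"
  using pointwise_identity[OF t] AE_total_finite AE_f0_finite
  by eventually_elim (use t in \<open>auto intro: f_eq_F\<close>)

text \<open>For each time the two versions agree off a null set of sizes that depends on the time.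
  Exchanging the order, at almost every size they agree at almost every time, which suffices under a
  time integral.\<close>

lemma AE_AE_f_eq_F: "AE x in lborel. AE u in lborel. 0 \<le> u \<longrightarrow> f u x = ennreal (F u x)"
proof -
  have "AE u in lborel. AE x in lborel. 0 \<le> u \<longrightarrow> f u x = ennreal (F u x)"
  proof (rule AE_I2)
    fix u :: real
    show "AE x in lborel. 0 \<le> u \<longrightarrow> f u x = ennreal (F u x)"
      using AE_f_eq_F[of u] by (cases "0 \<le> u") auto
  qed
  then show ?thesis
    by (subst lborel_pair.AE_commute) measurable
qed

text \<open>Nonnegativity follows from the equality with \<open>f\<close> only off a null set for
  each time; rational times give a common null set, and continuity covers the remaining
  times.\<close>

lemma AE_F_regular:
  "AE x in lborel. continuous_on {0..} (\<lambda>t. F t x) \<and> (\<forall>t\<ge>0. 0 \<le> F t x)"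
proof -
  have "AE x in lborel. 0 \<le> q \<and> q \<in> \<rat> \<longrightarrow> f q x + total_loss q x = f0 x + total_gain q x" for q
    using pointwise_identity[of q] by (cases "0 \<le> q") auto
  then have "AE x in lborel. \<forall>q\<in>\<rat>. 0 \<le> q \<longrightarrow> f q x + total_loss q x = f0 x + total_gain q x"
    using countable_rat by (subst AE_ball_countable) (auto elim: eventually_mono)
  then show ?thesis
    using AE_total_finite AE_f0_finite
  proof eventually_elim
    case (elim x)
    have "continuous_on {0..} (\<lambda>t. F t x)"
      unfolding F_def total_gain_def total_loss_def
      using elim(2) unfolding total_gain_def total_loss_def
      by (intro continuous_on_diff continuous_on_add continuous_on_const continuous_on_time_integral) auto
    then show ?case
      using continuous_nonneg_from_rationals[of "\<lambda>t. F t x"] f_eq_F(2) elim by blast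
  qed
qed

lemma kernel_integral_f_le:
  "0 \<le> u \<Longrightarrow> (\<integral>\<^sup>+y. K x y * f u y \<partial>lborel) \<le> C * wt l x * mbound u"
  by (intro kernel_integral_le f_measurable moment_f)

lemma time_kernel_integral_finite:
  assumes t: "0 \<le> t"
  shows "(\<integral>\<^sup>+u. indicator {0<..<t} u * (\<integral>\<^sup>+y. K x y * f u y \<partial>lborel) \<partial>lborel) < top"
proof -
  have "(\<integral>\<^sup>+u. indicator {0<..<t} u * (\<integral>\<^sup>+y. K x y * f u y \<partial>lborel) \<partial>lborel) \<le>
      (\<integral>\<^sup>+u. (C * wt l x * mbound t) * indicator {0<..<t} u \<partial>lborel)"
  proof (rule nn_integral_mono)
    fix u
    show "indicator {0<..<t} u * (\<integral>\<^sup>+y. K x y * f u y \<partial>lborel) \<le> C * wt l x * mbound t * indicator {0<..<t} u"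
    proof (cases "0 < u \<and> u < t")
      case True
      then have "(\<integral>\<^sup>+y. K x y * f u y \<partial>lborel) \<le> C * wt l x * mbound t"
        using order_trans[OF kernel_integral_f_le[of u x] mult_left_mono[OF mbound_mono[of u t]]] by simp
      then show ?thesis using True by simp
    qed auto
  qed
  also have "\<dots> < top"
    using C_fin mbound_fin t by (subst nn_integral_cmult_indicator) (auto simp: ennreal_mult_less_top)
  finally show ?thesis .
qed

lemma F_equation:
  assumes fin: "\<forall>t\<ge>0. total_loss t x < top \<and> total_gain t x < top" and t: "0 \<le> t"
    and nn: "\<forall>t\<ge>0. 0 \<le> F t x" and ae: "AE u in lborel. 0 \<le> u \<longrightarrow> f u x = ennreal (F u x)"
    and S: "S x < top"
  shows "F t x = enn2real (f0 x) + (LINT u:{0<..<t}|lborel. net_rate K G S f F x u)"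
    and "(\<integral>\<^sup>+u. indicator {0<..<t} u * coag K (f u) x \<partial>lborel) < top"
    and "(\<integral>\<^sup>+u. indicator {0<..<t} u * frag G (f u) x \<partial>lborel) < top"
    and "set_integrable lborel {0<..<t} (net_rate K G S f F x)"
proof -
  \<comment> \<open>\<open>g\<close> and \<open>h\<close> are real-valued forms of the gain and loss
    integrands, equal to them almost everywhere. Both are integrable, so the difference of the two
    totals becomes the integral of the net rate.\<close>
  define g where "g u = indicator {0<..<t} u * (1 / 2 * enn2real (coag K (f u) x) + enn2real (frag G (f u) x))" for u
  define h where "h u = indicator {0<..<t} u *
    ((enn2real (\<integral>\<^sup>+y. K x y * f u y \<partial>lborel) + enn2real (S x)) * F u x)" for u
  have [measurable]: "g \<in> borel_measurable borel" "h \<in> borel_measurable borel"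
    unfolding g_def h_def by measurable
  have nn_g: "0 \<le> g u" for u by (simp add: g_def)
  have nn_h: "0 \<le> h u" for u using nn by (auto simp: h_def split: split_indicator)
  have tg: "total_gain t x < top" "total_loss t x < top" using fin t by auto
  have "(\<integral>\<^sup>+u. indicator {0<..<t} u * (ennreal (1 / 2) * coag K (f u) x) \<partial>lborel) \<le> total_gain t x"
    unfolding total_gain_def gain_def by (intro nn_integral_mono mult_left_mono) auto
  then have c2: "(\<integral>\<^sup>+u. ennreal (1 / 2) * (indicator {0<..<t} u * coag K (f u) x) \<partial>lborel) < top"
    using tg by (simp add: mult.left_commute order.strict_trans1)
  have "(\<integral>\<^sup>+u. indicator {0<..<t} u * coag K (f u) x \<partial>lborel) =
      2 * (\<integral>\<^sup>+u. ennreal (1 / 2) * (indicator {0<..<t} u * coag K (f u) x) \<partial>lborel)"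
  proof -
    have "2 * ennreal (1 / 2) = ennreal (2 * (1 / 2))" by (subst ennreal_mult) auto
    then have "2 * ennreal (1 / 2) = 1" by simp
    then show ?thesis by (subst nn_integral_cmult) (auto simp: mult.assoc[symmetric] simp del: ennreal_half)
  qed
  then show fc: "(\<integral>\<^sup>+u. indicator {0<..<t} u * coag K (f u) x \<partial>lborel) < top"
    using c2 by (simp add: ennreal_mult_less_top)
  have "(\<integral>\<^sup>+u. indicator {0<..<t} u * frag G (f u) x \<partial>lborel) \<le> total_gain t x"
    unfolding total_gain_def gain_def by (intro nn_integral_mono mult_left_mono) auto
  then show ff: "(\<integral>\<^sup>+u. indicator {0<..<t} u * frag G (f u) x \<partial>lborel) < top"
    using tg by (simp add: order.strict_trans1)
  have "AE u in lborel. indicator {0<..<t} u * coag K (f u) x \<noteq> \<infinity>"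
    using fc by (intro nn_integral_PInf_AE) auto
  moreover have "AE u in lborel. indicator {0<..<t} u * frag G (f u) x \<noteq> \<infinity>"
    using ff by (intro nn_integral_PInf_AE) auto
  ultimately have "AE u in lborel. ennreal (g u) = indicator {0<..<t} u * gain K G (f u) x"
  proof eventually_elim
    case (elim u)
    show ?case
    proof (cases "u \<in> {0<..<t}")
      case True
      then have "coag K (f u) x \<noteq> top" "frag G (f u) x \<noteq> top" using elim by auto
      then obtain a b where "coag K (f u) x = ennreal a" "0 \<le> a" "frag G (f u) x = ennreal b" "0 \<le> b"
        by (cases "coag K (f u) x"; cases "frag G (f u) x") auto
      note ab = this
      have "ennreal (g u) = ennreal (1 / 2 * a) + ennreal b"
        using True ab by (simp add: g_def)
      also have "ennreal (1 / 2 * a) = ennreal (1 / 2) * ennreal a"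
        using ab by (intro ennreal_mult) auto
      finally show ?thesis using True ab by (simp add: gain_def)
    qed (simp add: g_def)
  qed
  then have ng: "(\<integral>\<^sup>+u. ennreal (g u) \<partial>lborel) = total_gain t x"
    unfolding total_gain_def by (rule nn_integral_cong_AE)
  have "AE u in lborel. ennreal (h u) = indicator {0<..<t} u * (rate K S (f u) x * f u x)"
    using ae
  proof eventually_elim
    case (elim u)
    show ?case
    proof (cases "u \<in> {0<..<t}")
      case True
      have "(\<integral>\<^sup>+y. K x y * f u y \<partial>lborel) < top"
        using kernel_integral_f_le[of u x] True C_fin mbound_fin
        by (auto simp: ennreal_mult_less_top intro: order.strict_trans1)
      then obtain a b where ab: "(\<integral>\<^sup>+y. K x y * f u y \<partial>lborel) = ennreal a" "0 \<le> a" "S x = ennreal b" "0 \<le> b"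
        using S by (auto simp: less_top_ennreal)
      then have "ennreal (h u) = (ennreal a + ennreal b) * ennreal (F u x)"
        using True nn by (simp add: h_def ennreal_mult)
      then show ?thesis using True elim ab by (simp add: rate_def)
    qed (simp add: h_def)
  qed
  then have nh: "(\<integral>\<^sup>+u. ennreal (h u) \<partial>lborel) = total_loss t x"
    unfolding total_loss_def by (rule nn_integral_cong_AE)
  have ig: "integrable lborel g" and ih: "integrable lborel h"
    using ng nh tg nn_g nn_h by (auto intro!: integrableI_nonneg)
  have "(LINT u|lborel. g u) = enn2real (total_gain t x)" "(LINT u|lborel. h u) = enn2real (total_loss t x)"
    using nn_g nn_h by (simp_all add: integral_eq_nn_integral ng nh)
  then have "F t x = enn2real (f0 x) + (LINT u|lborel. g u - h u)"
    using ig ih by (simp add: F_def)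
  moreover have "integrable lborel (\<lambda>u. g u - h u)" using ig ih by simp
  moreover have "(\<lambda>u. g u - h u) = (\<lambda>u. indicator {0<..<t} u *\<^sub>R net_rate K G S f F x u)"
    by (auto simp: g_def h_def net_rate_def algebra_simps split: split_indicator)
  ultimately show "F t x = enn2real (f0 x) + (LINT u:{0<..<t}|lborel. net_rate K G S f F x u)"
    and "set_integrable lborel {0<..<t} (net_rate K G S f F x)"
    unfolding set_lebesgue_integral_def set_integrable_def by simp_all
qed

end

context coag_frag_problem
begin

theorem exists_flow:
  "\<exists>(f :: real \<Rightarrow> real \<Rightarrow> ennreal) (F :: real \<Rightarrow> real \<Rightarrow> real). (\<forall>t. density_fun (f t)) \<and> (\<forall>t. F t \<in> borel_measurable borel) \<and>
    (\<forall>t\<ge>0. moment (f t) < top \<and> mass (f t) \<le> mass f0 \<and>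
      (AE x in lborel. 0 \<le> F t x \<and> f t x = ennreal (F t x))) \<and>
    (AE x in lborel. pointwise_solution K G S f0 f F x)"
proof -
  obtain r f0' where f0': "strict_mono r" "\<And>t. density_fun (f0' t)" "\<And>t. 0 \<le> t \<Longrightarrow> converges_to r t (f0' t)"
    using limit_densities by blast
  interpret lim: coag_frag_limit K G S l C N s k d f0 r f0'
    by standard (use f0' in auto)
  obtain f where f: "case_prod f \<in> borel_measurable (borel \<Otimes>\<^sub>M borel)" "\<And>t. density_fun (f t)"
    "\<And>t. 0 \<le> t \<Longrightarrow> converges_to r t (f t)"
    using lim.jointly_measurable_version by blast
  interpret flow: coag_frag_flow K G S l C N s k d f0 r f
    by standard (use f f0' in auto)
  have S_fin: "S x < top" for x
    by (rule order.strict_trans1[OF S_le[of "max 1 (x + 1)" x] s_fin]) auto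
  show ?thesis
  proof (rule exI[of _ f], rule exI[of _ flow.F], intro conjI allI impI)
    show "density_fun (f t)" for t by (rule f)
    show "flow.F t \<in> borel_measurable borel" for t by measurable
    show "moment (f t) < top" "mass (f t) \<le> mass f0" if "0 \<le> t" for t
      using flow.moment_f[OF that] flow.mass_f[OF that] mbound_fin by (auto intro: order.strict_trans1)
    show "AE x in lborel. 0 \<le> flow.F t x \<and> f t x = ennreal (flow.F t x)" if "0 \<le> t" for t
      using flow.AE_F_regular flow.AE_f_eq_F[OF that] by eventually_elim (use that in auto)
    show "AE x in lborel. pointwise_solution K G S f0 f flow.F x"
      using flow.AE_F_regular flow.AE_total_finite flow.AE_AE_f_eq_F
    proof eventually_elim
      case (elim x)
      have nn: "\<forall>t\<ge>0. 0 \<le> flow.F t x" using elim(1) by blast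
      show ?case
        unfolding pointwise_solution_def
        using elim(1) flow.F_equation[OF elim(2) _ nn elim(3) S_fin] flow.time_kernel_integral_finite by blast
    qed
  qed
qed

end

section \<open>Borel versions of the coefficients and the existence theorem\<close>

text \<open>The bridge between \<open>weak_solution\<close>, stated with Lebesgue integrals of real
  functions, and the estimates, stated with Borel \<open>ennreal\<close> functions. Measurability of
  \<open>\<phi>\<close> on \<open>A\<close> comes from completeness of Lebesgue measure, since
  \<open>\<phi>\<close> agrees there almost everywhere with a Borel function.\<close>

lemma set_integral_lebesgue_transfer:
  fixes \<phi> :: "real \<Rightarrow> real" and H :: "real \<Rightarrow> ennreal"
  assumes [measurable]: "H \<in> borel_measurable borel"
    and ae: "AE y in lborel. (y \<in> A \<longrightarrow> 0 \<le> \<phi> y \<and> ennreal (\<phi> y) = H y) \<and> (y \<notin> A \<longrightarrow> H y = 0)"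
  shows "(\<integral>\<^sup>+y\<in>A. ennreal (\<phi> y) \<partial>lebesgue) = (\<integral>\<^sup>+y. H y \<partial>lborel)"
    and "(LINT y:A|lebesgue. \<phi> y) = enn2real (\<integral>\<^sup>+y. H y \<partial>lborel)"
proof -
  have "(\<integral>\<^sup>+y\<in>A. ennreal (\<phi> y) \<partial>lebesgue) = (\<integral>\<^sup>+y\<in>A. ennreal (\<phi> y) \<partial>lborel)"
    by (rule nn_integral_completion)
  also have "\<dots> = (\<integral>\<^sup>+y. H y \<partial>lborel)"
    by (rule nn_integral_cong_AE) (use ae in \<open>eventually_elim, auto split: split_indicator\<close>)
  finally show nn: "(\<integral>\<^sup>+y\<in>A. ennreal (\<phi> y) \<partial>lebesgue) = (\<integral>\<^sup>+y. H y \<partial>lborel)" .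
  have eq: "AE y in lborel. enn2real (H y) = indicator A y *\<^sub>R \<phi> y"
    using ae
  proof eventually_elim
    case (elim y)
    then show ?case by (cases "y \<in> A") (auto dest: arg_cong[of _ _ enn2real])
  qed
  have m: "(\<lambda>y. indicator A y *\<^sub>R \<phi> y) \<in> borel_measurable lebesgue"
  proof (rule borel_measurable_AE)
    show "(\<lambda>y. enn2real (H y)) \<in> borel_measurable lebesgue"
      by (intro measurable_completion) measurable
    show "AE y in lebesgue. enn2real (H y) = indicator A y *\<^sub>R \<phi> y"
      using eq by (rule AE_completion)
  qed
  have "AE y in lborel. 0 \<le> indicator A y *\<^sub>R \<phi> y"
    using ae by eventually_elim (auto split: split_indicator)
  then have "AE y in lebesgue. 0 \<le> indicator A y *\<^sub>R \<phi> y" by (rule AE_completion)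
  then have "(LINT y:A|lebesgue. \<phi> y) = enn2real (\<integral>\<^sup>+y. ennreal (indicator A y *\<^sub>R \<phi> y) \<partial>lebesgue)"
    unfolding set_lebesgue_integral_def using m by (intro integral_eq_nn_integral) auto
  also have "(\<integral>\<^sup>+y. ennreal (indicator A y *\<^sub>R \<phi> y) \<partial>lebesgue) = (\<integral>\<^sup>+y\<in>A. ennreal (\<phi> y) \<partial>lebesgue)"
    by (intro nn_integral_cong) (auto split: split_indicator)
  finally show "(LINT y:A|lebesgue. \<phi> y) = enn2real (\<integral>\<^sup>+y. H y \<partial>lborel)" unfolding nn .
qed

text \<open>The set \<open>B\<close> is left free so that the domain can still be shrunk afterwards,
  for instance to a symmetric set, without losing Borel measurability.\<close>

lemma borel_modification:
  fixes g :: "'a::euclidean_space \<Rightarrow> real"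
  assumes g: "g \<in> borel_measurable (lebesgue_on A)" and A: "A \<in> sets borel"
  obtains Z where "Z \<in> null_sets lborel"
    "\<And>B. B \<in> sets borel \<Longrightarrow> B \<subseteq> A - Z \<Longrightarrow> (\<lambda>x. indicator B x * g x) \<in> borel_measurable borel"
proof -
  have "(\<lambda>x. indicator A x *\<^sub>R g x) \<in> borel_measurable lebesgue"
    using g A by (subst (asm) borel_measurable_restrict_space_iff) auto
  from completion_ex_borel_measurable_real[OF this]
  obtain h where h: "h \<in> borel_measurable lborel" "AE x in lborel. indicator A x *\<^sub>R g x = h x" by blast
  from h(2) obtain Z where Z: "{x \<in> space lborel. \<not> indicator A x *\<^sub>R g x = h x} \<subseteq> Z" "Z \<in> null_sets lborel"
    unfolding eventually_ae_filter by blast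
  show ?thesis
  proof (rule that[OF Z(2)])
    fix B assume B [measurable]: "B \<in> sets borel" and sub: "B \<subseteq> A - Z"
    have [measurable]: "h \<in> borel_measurable borel" using h(1) by simp
    have "(\<lambda>x. indicator B x * g x) = (\<lambda>x. indicator B x * h x)"
    proof
      fix x
      show "indicator B x * g x = indicator B x * h x"
      proof (cases "x \<in> B")
        case True
        then have "x \<in> A" "x \<notin> Z" using sub by auto
        have "x \<notin> {x \<in> space lborel. \<not> indicator A x *\<^sub>R g x = h x}" using Z(1) \<open>x \<notin> Z\<close> by blast
        then have "indicator A x *\<^sub>R g x = h x" by simp
        then show ?thesis using \<open>x \<in> A\<close> by simp
      qed simp
    qed
    also have "\<dots> \<in> borel_measurable borel" by measurable
    finally show "(\<lambda>x. indicator B x * g x) \<in> borel_measurable borel" .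
  qed
qed

text \<open>The shifted forms serve the coagulation gain, which evaluates the kernel along the lines
  (x - y, y); they follow from the ordinary sections by translation invariance and an exchange of
  quantifiers.\<close>

lemma null_set_sections:
  fixes Z :: "(real \<times> real) set"
  assumes Z: "Z \<in> null_sets lborel"
  shows "AE x in lborel. AE y in lborel. (x, y) \<notin> Z"
    and "AE x in lborel. AE y in lborel. (y, x) \<notin> Z"
    and "AE x in lborel. AE y in lborel. (x - y, y) \<notin> Z"
    and "AE x in lborel. AE y in lborel. (y, x - y) \<notin> Z"
proof -
  have [measurable]: "Z \<in> sets (borel \<Otimes>\<^sub>M borel)"
    unfolding borel_prod using Z by (simp add: null_sets_def)
  have "AE p in lborel \<Otimes>\<^sub>M lborel. p \<notin> Z" unfolding lborel_prod by (rule AE_not_in[OF Z])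
  from lborel_pair.AE_pair[OF this] show xy: "AE x in lborel. AE y in lborel. (x, y) \<notin> Z" .
  then show yx: "AE x in lborel. AE y in lborel. (y, x) \<notin> Z"
    by (subst lborel_pair.AE_commute) measurable
  have shift: "AE x in lborel. P (x - y)" if [measurable]: "Measurable.pred borel P" and "AE x in lborel. P x"
    for P and y :: real
    using AE_borel_affine[of 1 P "- y"] that by simp
  have "AE y in lborel. AE x in lborel. (x - y, y) \<notin> Z"
    using yx by eventually_elim (rule shift, measurable)
  then show "AE x in lborel. AE y in lborel. (x - y, y) \<notin> Z"
    by (subst lborel_pair.AE_commute) measurable
  have "AE y in lborel. AE x in lborel. (y, x - y) \<notin> Z"
    using xy by eventually_elim (rule shift, measurable)
  then show "AE x in lborel. AE y in lborel. (y, x - y) \<notin> Z"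
    by (subst lborel_pair.AE_commute) measurable
qed

theorem theorem1p2:
  fixes K \<Gamma> :: "real \<Rightarrow> real \<Rightarrow> real"
    and \<phi> :: "real \<Rightarrow> real" and k1 \<mu> :: real
    and \<theta> :: real and k :: "real \<Rightarrow> real" and \<omega> :: "real \<Rightarrow> real \<Rightarrow> real"
    and N :: real and f0 :: "real \<Rightarrow> real"
  assumes H1_meas: "(\<lambda>(x, y). K x y) \<in> borel_measurable (lebesgue_on ({0..} \<times> {0..}))"
    and H1_nonneg: "\<And>x y. 0 \<le> x \<Longrightarrow> 0 \<le> y \<Longrightarrow> 0 \<le> K x y"
    and H1_sym: "\<And>x y. 0 < x \<Longrightarrow> 0 < y \<Longrightarrow> K x y = K y x"
    and H2_params: "0 \<le> \<mu>" "\<mu> < 1" "0 < k1"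
    and H2_phi: "\<And>x. 0 < x \<Longrightarrow> 0 \<le> \<phi> x \<and> \<phi> x \<le> k1 * (1 + x) powr \<mu>"
    and H2: "\<And>x y. 0 < x \<Longrightarrow> 0 < y \<Longrightarrow> K x y \<le> \<phi> x * \<phi> y"
    and H3_meas: "(\<lambda>(x, y). \<Gamma> x y) \<in> borel_measurable (lebesgue_on ({0<..} \<times> {0<..}))"
    and H3_nonneg: "\<And>x y. 0 < x \<Longrightarrow> 0 < y \<Longrightarrow> 0 \<le> \<Gamma> x y"
    and H3_supp: "\<And>x y. 0 < x \<Longrightarrow> x < y \<Longrightarrow> \<Gamma> x y = 0"
    and H3_mass: "\<And>y. 0 < y \<Longrightarrow>
      set_integrable lebesgue {0<..<y} (\<lambda>x. x * breakage \<Gamma> x y) \<and>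
      (LINT x:{0<..<y}|lebesgue. x * breakage \<Gamma> x y) = y"
    and H3_params: "0 \<le> \<theta>" "\<theta> < 1"
    and H3_k: "\<And>R. 0 < R \<Longrightarrow> 0 \<le> k R"
    and H3_omega: "\<And>R \<delta>. 0 < R \<Longrightarrow> 0 < \<delta> \<Longrightarrow> 0 \<le> \<omega> R \<delta>"
    and H4: "\<And>R x y. 1 \<le> R \<Longrightarrow> R < y \<Longrightarrow> 0 < x \<Longrightarrow> x < R \<Longrightarrow> \<Gamma> y x \<le> k R * y powr \<theta>"
    and H5: "\<And>R y E. 1 \<le> R \<Longrightarrow> 0 < y \<Longrightarrow> y < R \<Longrightarrow> E \<in> sets lebesgue \<Longrightarrow> E \<subseteq> {0<..<R} \<Longrightarrow>
      0 < measure lebesgue E \<Longrightarrow>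
      (\<integral>\<^sup>+x\<in>{0<..<y}. ennreal (indicator E x * \<Gamma> y x) \<partial>lebesgue) \<le> ennreal (\<omega> R (measure lebesgue E))"
    and H5_lim: "\<And>R. 1 \<le> R \<Longrightarrow> (\<omega> R \<longlongrightarrow> 0) (at_right 0)"
    and H6: "\<And>R. 1 \<le> R \<Longrightarrow> selection \<Gamma> \<in> Linfty_on {0<..<R}"
    and breakage_number: "\<And>y. 0 < y \<Longrightarrow>
      set_integrable lebesgue {0<..<y} (\<lambda>x. breakage \<Gamma> x y) \<and>
      (LINT x:{0<..<y}|lebesgue. breakage \<Gamma> x y) = N"
    and breakage_supp: "\<And>x y. 0 < y \<Longrightarrow> y < x \<Longrightarrow> breakage \<Gamma> x y = 0"
    and f0: "f0 \<in> X_pos"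
  shows "\<exists>f. weak_solution K (selection \<Gamma>) (breakage \<Gamma>) f0 \<infinity> f \<and>
    (\<forall>t\<ge>0. norm_x (f t) \<le> norm_x f0)"
proof -
  define S where "S = selection \<Gamma>"
  \<comment> \<open>One exponent below 1 for the growth of \<open>K\<close> in \<open>H2\<close> and
    of the fragment density in \<open>H4\<close>.\<close>
  define l where "l = max \<mu> \<theta>"
  have l: "0 \<le> l" "l < 1" "\<mu> \<le> l" "\<theta> \<le> l" using H2_params H3_params by (auto simp: l_def)

  have S_nonneg: "0 \<le> S y" if "0 < y" for y
  proof -
    have "0 \<le> (LINT x:{0<..<y}|lebesgue. x / y * \<Gamma> y x)"
      unfolding set_lebesgue_integral_def
      using that H3_nonneg by (intro Bochner_Integration.integral_nonneg) (auto split: split_indicator)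
    then show ?thesis by (simp add: S_def selection_def)
  qed
  \<comment> \<open>if \<open>S y = 0\<close>, then \<open>b(\<cdot>, y) = 0\<close> by the convention \<open>x / 0 = 0\<close>, contradicting mass conservation\<close>
  have S_pos: "0 < S y" if y: "0 < y" for y
  proof -
    have "S y \<noteq> 0"
    proof
      assume "S y = 0"
      then have "(LINT x:{0<..<y}|lebesgue. x * breakage \<Gamma> x y) = 0"
        by (simp add: breakage_def S_def)
      then show False using H3_mass[OF y] y by simp
    qed
    then show ?thesis using S_nonneg[OF y] by simp
  qed
  have b_S: "breakage \<Gamma> x y * S y = \<Gamma> y x" if "0 < y" for x y
    using S_pos[OF that] by (simp add: breakage_def S_def)
  have N_nonneg: "0 \<le> N"
  proof -
    have "0 \<le> (LINT x:{0<..<1}|lebesgue. breakage \<Gamma> x 1)"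
      unfolding set_lebesgue_integral_def using S_nonneg[of 1] H3_nonneg
      by (intro Bochner_Integration.integral_nonneg) (auto simp: breakage_def S_def split: split_indicator)
    then show ?thesis using breakage_number[of 1] by simp
  qed
  \<comment> \<open>The hypotheses speak of the breakage function; multiplied by S(y) they become
    statements about \<open>\<Gamma>\<close>, the form in which the locale needs them.\<close>
  have mass_int: "(\<integral>\<^sup>+x\<in>{0<..<y}. ennreal (x * \<Gamma> y x) \<partial>lebesgue) = ennreal (y * S y)"
    and num_int: "(\<integral>\<^sup>+x\<in>{0<..<y}. ennreal (\<Gamma> y x) \<partial>lebesgue) = ennreal (N * S y)" if y: "0 < y" for y
  proof -
    have nn: "(\<integral>\<^sup>+x\<in>{0<..<y}. ennreal (u x) \<partial>lebesgue) = ennreal (c * S y)"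
      if int: "set_integrable lebesgue {0<..<y} v" "(LINT x:{0<..<y}|lebesgue. v x) = c"
        and uv: "\<And>x. x \<in> {0<..<y} \<Longrightarrow> u x = S y * v x" and nn: "\<And>x. x \<in> {0<..<y} \<Longrightarrow> 0 \<le> u x" for u v c
    proof -
      have "integrable lebesgue (\<lambda>x. indicator {0<..<y} x *\<^sub>R v x)"
        using int by (simp add: set_integrable_def)
      then have iu: "integrable lebesgue (\<lambda>x. S y * (indicator {0<..<y} x *\<^sub>R v x))" by simp
      have "(\<integral>\<^sup>+x\<in>{0<..<y}. ennreal (u x) \<partial>lebesgue) =
          (\<integral>\<^sup>+x. ennreal (S y * (indicator {0<..<y} x *\<^sub>R v x)) \<partial>lebesgue)"
        using uv by (intro nn_integral_cong) (auto split: split_indicator)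
      also have "\<dots> = ennreal (LINT x|lebesgue. S y * (indicator {0<..<y} x *\<^sub>R v x))"
        using uv nn by (intro nn_integral_eq_integral iu AE_I2) (auto split: split_indicator)
      also have "(LINT x|lebesgue. S y * (indicator {0<..<y} x *\<^sub>R v x)) = c * S y"
        using int(2) by (simp add: set_lebesgue_integral_def)
      finally show ?thesis .
    qed
    show "(\<integral>\<^sup>+x\<in>{0<..<y}. ennreal (x * \<Gamma> y x) \<partial>lebesgue) = ennreal (y * S y)"
    proof (rule nn)
      show "x * \<Gamma> y x = S y * (x * breakage \<Gamma> x y)" for x using b_S[OF y, of x] by (simp add: ac_simps)
    qed (use H3_mass[OF y] H3_nonneg y in auto)
    show "(\<integral>\<^sup>+x\<in>{0<..<y}. ennreal (\<Gamma> y x) \<partial>lebesgue) = ennreal (N * S y)"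
    proof (rule nn)
      show "\<Gamma> y x = S y * breakage \<Gamma> x y" for x using b_S[OF y, of x] by (simp add: ac_simps)
    qed (use breakage_number[OF y] H3_nonneg y in auto)
  qed

  \<comment> \<open>Each essential bound in \<open>H6\<close> has its own null set; restricting to
    integer radii leaves countably many, which are later collected in \<open>Y\<close>.\<close>
  have "\<exists>c. \<forall>n\<ge>1. AE y in lborel. y \<in> {0<..<real n} \<longrightarrow> \<bar>S y\<bar> \<le> c n"
  proof -
    have "\<exists>c. AE y in lborel. y \<in> {0<..<real n} \<longrightarrow> \<bar>S y\<bar> \<le> c" if "1 \<le> n" for n
      using H6[of "real n"] that unfolding Linfty_on_def S_def
      by (auto simp: AE_restrict_space_iff AE_completion_iff)
    then have "\<forall>n. \<exists>c. 1 \<le> n \<longrightarrow> (AE y in lborel. y \<in> {0<..<real n} \<longrightarrow> \<bar>S y\<bar> \<le> c)" by blast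
    then show ?thesis by metis
  qed
  then obtain cS where cS: "\<And>n. 1 \<le> n \<Longrightarrow> AE y in lborel. y \<in> {0<..<real n} \<longrightarrow> \<bar>S y\<bar> \<le> cS n" by blast

  have "{0..} \<times> {0..} \<in> sets (borel :: (real \<times> real) measure)"
    unfolding borel_prod[symmetric] by measurable
  then obtain ZK where ZK: "ZK \<in> null_sets lborel"
    "\<And>B. B \<in> sets borel \<Longrightarrow> B \<subseteq> {0..} \<times> {0..} - ZK \<Longrightarrow>
      (\<lambda>p. indicator B p * (case p of (x, y) \<Rightarrow> K x y)) \<in> borel_measurable borel"
    using borel_modification[OF H1_meas] by blast
  have "{0<..} \<times> {0<..} \<in> sets (borel :: (real \<times> real) measure)"
    unfolding borel_prod[symmetric] by measurable
  then obtain ZG where ZG: "ZG \<in> null_sets lborel"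
    "\<And>B. B \<in> sets borel \<Longrightarrow> B \<subseteq> {0<..} \<times> {0<..} - ZG \<Longrightarrow>
      (\<lambda>p. indicator B p * (case p of (x, y) \<Rightarrow> \<Gamma> x y)) \<in> borel_measurable borel"
    using borel_modification[OF H3_meas] by blast
  have [measurable]: "ZK \<in> sets (borel \<Otimes>\<^sub>M borel)" "ZG \<in> sets (borel \<Otimes>\<^sub>M borel)"
    unfolding borel_prod using ZK(1) ZG(1) by (simp_all add: null_sets_def)

  have "AE y in lborel. \<forall>n. 1 \<le> n \<longrightarrow> y \<in> {0<..<real n} \<longrightarrow> \<bar>S y\<bar> \<le> cS n"
    unfolding AE_all_countable using cS by (metis (mono_tags, lifting) AE_I2 eventually_mono)
  then have "AE y in lborel. (AE x in lborel. (y, x) \<notin> ZG) \<and> (\<forall>n. 1 \<le> n \<longrightarrow> y \<in> {0<..<real n} \<longrightarrow> \<bar>S y\<bar> \<le> cS n)"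
    using null_set_sections(1)[OF ZG(1)] by eventually_elim simp
  then obtain Y where Y0: "{y \<in> space lborel. \<not> ((AE x in lborel. (y, x) \<notin> ZG) \<and>
      (\<forall>n. 1 \<le> n \<longrightarrow> y \<in> {0<..<real n} \<longrightarrow> \<bar>S y\<bar> \<le> cS n))} \<subseteq> Y" and Y: "Y \<in> null_sets lborel"
    unfolding eventually_ae_filter by blast
  have Y_sec: "AE x in lborel. (y, x) \<notin> ZG" if "y \<notin> Y" for y using Y0 that by (auto simp: subset_iff)
  have Y_S: "S y \<le> cS n" if "y \<notin> Y" "1 \<le> n" "0 < y" "y < real n" for y n
  proof -
    have "\<forall>n. 1 \<le> n \<longrightarrow> y \<in> {0<..<real n} \<longrightarrow> \<bar>S y\<bar> \<le> cS n"
      using Y0 that(1) by (auto simp: subset_iff)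
    then have "\<bar>S y\<bar> \<le> cS n" using that by simp
    then show ?thesis by simp
  qed
  have [measurable]: "Y \<in> sets borel" using Y by (auto simp: null_sets_def)

  \<comment> \<open>The transposed null set is removed too, because \<open>K'\<close> must be
    symmetric at every point and \<open>ZK\<close> need not be symmetric.\<close>
  define BK where "BK = {(x, y). 0 < x \<and> 0 < y \<and> (x, y) \<notin> ZK \<and> (y, x) \<notin> ZK}"
  define K' where "K' x y = ennreal (indicator BK (x, y) * K x y)" for x y
  \<comment> \<open>A parent in \<open>Y\<close>, where the section of \<open>ZG\<close> is not
    known to be null or a bound on S may fail, is removed together with all of its fragments, so
    that the mass and number identities hold for every parent.\<close>
  define BG where "BG = {(y, x). 0 < x \<and> x \<le> y \<and> y \<notin> Y \<and> (y, x) \<notin> ZG}"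
  define G where "G y x = ennreal (indicator BG (y, x) * \<Gamma> y x)" for y x
  \<comment> \<open>Read off from \<open>G\<close> through the mass identity: this makes it Borel
    and gives \<open>G_mass\<close> for every y. The selection function is only Lebesgue measurable;
    at positive sizes off \<open>Y\<close> the two agree.\<close>
  define S' where "S' y = indicator (- Y) y * (ennreal (1 / y) * (\<integral>\<^sup>+x. ennreal x * G y x \<partial>lborel))" for y
  define s where "s R = ennreal (cS (nat \<lceil>R\<rceil>))" for R :: real
  have BKs: "BK \<in> sets borel"
  proof -
    have "{p \<in> space (borel \<Otimes>\<^sub>M borel). 0 < fst p \<and> 0 < snd p \<and> p \<notin> ZK \<and> (snd p, fst p) \<notin> ZK}
        \<in> sets (borel \<Otimes>\<^sub>M borel)" by measurable
    also have "{p \<in> space (borel \<Otimes>\<^sub>M borel). 0 < fst p \<and> 0 < snd p \<and> p \<notin> ZK \<and> (snd p, fst p) \<notin> ZK} = BK"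
      by (auto simp: BK_def space_pair_measure)
    finally show ?thesis by (simp only: borel_prod)
  qed
  have BGs: "BG \<in> sets borel"
  proof -
    have "{p \<in> space (borel \<Otimes>\<^sub>M borel). 0 < snd p \<and> snd p \<le> fst p \<and> fst p \<notin> Y \<and> p \<notin> ZG}
        \<in> sets (borel \<Otimes>\<^sub>M borel)" by measurable
    also have "{p \<in> space (borel \<Otimes>\<^sub>M borel). 0 < snd p \<and> snd p \<le> fst p \<and> fst p \<notin> Y \<and> p \<notin> ZG} = BG"
      by (auto simp: BG_def space_pair_measure)
    finally show ?thesis by (simp only: borel_prod)
  qed
  have K_pair: "case_prod K' \<in> borel_measurable (borel \<Otimes>\<^sub>M borel)"
  proof -
    have "(\<lambda>p. indicator BK p * (case p of (x, y) \<Rightarrow> K x y)) \<in> borel_measurable borel"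
      by (rule ZK(2)[OF BKs]) (auto simp: BK_def)
    then have "(\<lambda>p. ennreal (indicator BK p * (case p of (x, y) \<Rightarrow> K x y))) \<in> borel_measurable borel" by measurable
    then show ?thesis unfolding K'_def borel_prod by (simp add: case_prod_beta')
  qed
  have G_pair: "case_prod G \<in> borel_measurable (borel \<Otimes>\<^sub>M borel)"
  proof -
    have "(\<lambda>p. indicator BG p * (case p of (x, y) \<Rightarrow> \<Gamma> x y)) \<in> borel_measurable borel"
      by (rule ZG(2)[OF BGs]) (auto simp: BG_def)
    then have "(\<lambda>p. ennreal (indicator BG p * (case p of (x, y) \<Rightarrow> \<Gamma> x y))) \<in> borel_measurable borel" by measurable
    then show ?thesis unfolding G_def borel_prod by (simp add: case_prod_beta')
  qed
  have [measurable]: "(\<lambda>p. G (fst p) (snd p)) \<in> borel_measurable (borel \<Otimes>\<^sub>M borel)"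
    using G_pair by (simp add: case_prod_beta')
  have G_le: "G y x \<le> ennreal (\<Gamma> y x)" if "0 < x" for x y
    using H3_nonneg[of y x] that by (auto simp: G_def BG_def split: split_indicator)
  have G_outside: "G y x = 0" if "x \<le> 0 \<or> y < x \<or> y \<in> Y" for x y
    using that by (auto simp: G_def BG_def)
  have G_section: "(\<integral>\<^sup>+x. h x * G y x \<partial>lborel) = (\<integral>\<^sup>+x\<in>{0<..<y}. h x * ennreal (\<Gamma> y x) \<partial>lebesgue)"
    if y: "0 < y" "y \<notin> Y" for y and h :: "real \<Rightarrow> ennreal"
  proof -
    have "(\<integral>\<^sup>+x. h x * G y x \<partial>lborel) = (\<integral>\<^sup>+x\<in>{0<..<y}. h x * ennreal (\<Gamma> y x) \<partial>lborel)"
    proof (rule nn_integral_cong_AE)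
      show "AE x in lborel. h x * G y x = h x * ennreal (\<Gamma> y x) * indicator {0<..<y} x"
        using Y_sec[OF y(2)] AE_lborel_singleton[of y]
        by eventually_elim (use y in \<open>auto simp: G_def BG_def split: split_indicator\<close>)
    qed
    then show ?thesis by (simp only: nn_integral_completion)
  qed
  have S'_good: "S' y = ennreal (S y)" if y: "0 < y" "y \<notin> Y" for y
  proof -
    have "(\<integral>\<^sup>+x. ennreal x * G y x \<partial>lborel) = (\<integral>\<^sup>+x\<in>{0<..<y}. ennreal (x * \<Gamma> y x) \<partial>lebesgue)"
      unfolding G_section[OF y]
      using H3_nonneg y by (intro nn_integral_cong) (auto simp: ennreal_mult split: split_indicator)
    then have "S' y = ennreal (1 / y) * ennreal (y * S y)"
      using y mass_int by (simp add: S'_def)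
    also have "\<dots> = ennreal (1 / y * (y * S y))"
      using y S_nonneg by (intro ennreal_mult[symmetric]) auto
    finally show ?thesis using y by simp
  qed
  have S'_bad: "S' y = 0" if "y \<le> 0 \<or> y \<in> Y" for y
    using that by (auto simp: S'_def ennreal_neg divide_nonpos_nonpos split: split_indicator)

  \<comment> \<open>The premises inside \<open>dP\<close> make it satisfiable for all R and e, so
    that \<open>d\<close> can be chosen as a total function. Only positive \<open>\<eta>\<close> are
    constrained, matching \<open>H5\<close>, which concerns sets of positive measure.\<close>
  define dP where "dP R e \<delta> \<longleftrightarrow> (1 \<le> R \<longrightarrow> 0 < e \<longrightarrow> 0 < \<delta> \<and> (\<forall>\<eta>. 0 < \<eta> \<longrightarrow> \<eta> \<le> \<delta> \<longrightarrow> \<omega> R \<eta> \<le> e))" for R e \<delta> :: real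
  have "\<exists>\<delta>. dP R e \<delta>" for R e
  proof (cases "1 \<le> R \<and> 0 < e")
    case True
    then have "\<forall>\<^sub>F \<eta> in at_right 0. \<omega> R \<eta> < e" using H5_lim[of R] by (intro order_tendstoD(2)) auto
    then obtain \<delta> where "0 < \<delta>" "\<forall>\<eta>>0. \<eta> < \<delta> \<longrightarrow> \<omega> R \<eta> < e"
      by (auto simp: eventually_at_right[of 0 1])
    then have "dP R e (\<delta> / 2)" by (auto simp: dP_def intro: less_imp_le)
    then show ?thesis by blast
  qed (auto simp: dP_def)
  then obtain d where d: "\<And>R e. dP R e (d R e)" by metis

  have "(\<lambda>x. indicator {0<..} x *\<^sub>R f0 x) \<in> borel_measurable lebesgue"
    using f0 by (auto simp: X_pos_def X_space_def set_integrable_def)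
  from completion_ex_borel_measurable_real[OF this] obtain h0 where
    h0: "h0 \<in> borel_measurable lborel" "AE x in lborel. indicator {0<..} x *\<^sub>R f0 x = h0 x" by blast
  define g0 where "g0 x = ennreal (h0 x) * indicator {0<..} x" for x
  have g0_f0: "AE x in lborel. x \<in> {0<..} \<longrightarrow> 0 \<le> f0 x \<and> g0 x = ennreal (f0 x)"
  proof -
    have "AE x in lborel. x \<in> {0<..} \<longrightarrow> 0 \<le> f0 x"
      using f0 by (auto simp: X_pos_def AE_restrict_space_iff AE_completion_iff)
    with h0(2) show ?thesis by eventually_elim (auto simp: g0_def)
  qed
  have g0_dens: "density_fun g0"
  proof -
    have [measurable]: "h0 \<in> borel_measurable borel" using h0(1) by simp
    have "g0 \<in> borel_measurable borel" unfolding g0_def by measurable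
    then show ?thesis by (simp add: density_fun_def g0_def)
  qed
  have g0_weight: "(\<integral>\<^sup>+x. w x * g0 x \<partial>lborel) = (\<integral>\<^sup>+x\<in>{0<..}. ennreal (u x * \<bar>f0 x\<bar>) \<partial>lebesgue)"
    if w: "\<And>x. 0 < x \<Longrightarrow> w x = ennreal (u x)" and u: "\<And>x. 0 < x \<Longrightarrow> 0 \<le> u x" for w u
  proof -
    have "(\<integral>\<^sup>+x. w x * g0 x \<partial>lborel) = (\<integral>\<^sup>+x\<in>{0<..}. ennreal (u x * \<bar>f0 x\<bar>) \<partial>lborel)"
    proof (rule nn_integral_cong_AE)
      show "AE x in lborel. w x * g0 x = ennreal (u x * \<bar>f0 x\<bar>) * indicator {0<..} x"
        using g0_f0
        by eventually_elim (use w u in \<open>auto simp: ennreal_mult density_fun_zero[OF g0_dens] split: split_indicator\<close>)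
    qed
    then show ?thesis by (simp only: nn_integral_completion)
  qed
  have g0_moment: "moment g0 < top"
  proof -
    have "moment g0 = X_norm f0"
      unfolding moment_def X_norm_def by (rule g0_weight) (auto simp: vt_def simp del: ennreal_plus)
    then show ?thesis using f0 by (simp add: X_pos_def X_space_def)
  qed
  have g0_mass: "mass g0 = norm_x f0"
    unfolding mass_def norm_x_def by (rule g0_weight) auto

  interpret cf: coag_frag_problem K' G S' l "ennreal (k1 ^ 2)" "ennreal N" s "\<lambda>R. ennreal (k R)" d g0
  proof
    show "case_prod K' \<in> borel_measurable (borel \<Otimes>\<^sub>M borel)" by (rule K_pair)
    show "case_prod G \<in> borel_measurable (borel \<Otimes>\<^sub>M borel)" by (rule G_pair)
    show "S' \<in> borel_measurable borel" unfolding S'_def by measurable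
    show "0 \<le> l" "l < 1" by (rule l)+
    show "K' x y = K' y x" for x y
      using H1_sym[of x y] by (auto simp: K'_def BK_def split: split_indicator)
    show "K' x y = 0" if "x \<le> 0" for x y using that by (auto simp: K'_def BK_def)
    show "K' x y \<le> ennreal (k1 ^ 2) * wt l x * wt l y" for x y
    proof (cases "0 < x \<and> 0 < y")
      case True
      have phi: "\<phi> z \<le> k1 * (1 + z) powr l" "0 \<le> \<phi> z" if "0 < z" for z
      proof -
        have "(1 + z) powr \<mu> \<le> (1 + z) powr l" using that l by (intro powr_mono) auto
        then have "k1 * (1 + z) powr \<mu> \<le> k1 * (1 + z) powr l" using H2_params by (intro mult_left_mono) auto
        then show "\<phi> z \<le> k1 * (1 + z) powr l" "0 \<le> \<phi> z" using H2_phi[OF that] by auto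
      qed
      have "K x y \<le> \<phi> x * \<phi> y" using H2 True by simp
      also have "\<dots> \<le> (k1 * (1 + x) powr l) * (k1 * (1 + y) powr l)"
        using phi[of x] phi[of y] True H2_params by (intro mult_mono) auto
      also have "\<dots> = k1 ^ 2 * (1 + x) powr l * (1 + y) powr l" by (simp add: power2_eq_square)
      finally have "K' x y \<le> ennreal (k1 ^ 2 * (1 + x) powr l * (1 + y) powr l)"
        by (auto simp: K'_def intro!: ennreal_leI split: split_indicator)
      also have "\<dots> = ennreal (k1 ^ 2) * wt l x * wt l y"
        using True by (simp add: wt_def ennreal_mult)
      finally show ?thesis .
    qed (auto simp: K'_def BK_def)
    show "G y x = 0" if "x \<le> 0 \<or> y < x" for x y using that by (intro G_outside) auto
    show "(\<integral>\<^sup>+x. ennreal x * G y x \<partial>lborel) = ennreal y * S' y" for y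
    proof (cases "0 < y \<and> y \<notin> Y")
      case True
      then have "ennreal y * S' y = ennreal (y * (1 / y)) * (\<integral>\<^sup>+x. ennreal x * G y x \<partial>lborel)"
        by (subst ennreal_mult) (auto simp: S'_def mult.assoc)
      then show ?thesis using True by simp
    next
      case False
      then have "G y x = 0" for x by (intro G_outside) auto
      then show ?thesis using False S'_bad[of y] by auto
    qed
    show "(\<integral>\<^sup>+x. G y x \<partial>lborel) = ennreal N * S' y" for y
    proof (cases "0 < y \<and> y \<notin> Y")
      case True
      have "(\<integral>\<^sup>+x. G y x \<partial>lborel) = ennreal (N * S y)"
        using G_section[of y "\<lambda>_. 1"] num_int True by simp
      then show ?thesis using True N_nonneg S_nonneg S'_good by (simp add: ennreal_mult)
    next
      case False
      then have "G y x = 0" for x by (intro G_outside) auto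
      then show ?thesis using False S'_bad[of y] by auto
    qed
    show "S' y \<le> s R" if "1 \<le> R" "y < R" for R y
    proof (cases "0 < y \<and> y \<notin> Y")
      case True
      have "1 \<le> nat \<lceil>R\<rceil>" "y < real (nat \<lceil>R\<rceil>)" using that by linarith+
      then show ?thesis using True S'_good Y_S by (auto simp: s_def intro: ennreal_leI)
    next
      case False
      then show ?thesis using S'_bad[of y] by auto
    qed
    show "G y x \<le> ennreal (k R) * wt l y" if "1 \<le> R" "R < y" "x < R" for R y x
    proof (cases "0 < x")
      case True
      have "\<Gamma> y x \<le> k R * y powr \<theta>" using H4 that True by simp
      also have "\<dots> \<le> k R * (1 + y) powr l"
      proof (intro mult_left_mono)
        have "y powr \<theta> \<le> y powr l" using that l by (intro powr_mono) auto
        also have "\<dots> \<le> (1 + y) powr l" using that l by (intro powr_mono2) auto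
        finally show "y powr \<theta> \<le> (1 + y) powr l" .
        show "0 \<le> k R" using H3_k that by simp
      qed
      finally have "ennreal (\<Gamma> y x) \<le> ennreal (k R) * wt l y"
        using that H3_k[of R] by (simp add: wt_def ennreal_mult[symmetric] ennreal_leI)
      with G_le[OF True] show ?thesis by (rule order_trans)
    qed (simp add: G_outside)
    show "0 < d R e" if "1 \<le> R" "0 < e" for R e using d[of R e] that by (simp add: dP_def)
    show "(\<integral>\<^sup>+x. indicator E x * G y x \<partial>lborel) \<le> ennreal e"
      if H: "1 \<le> R" "0 < e" "y < R" "E \<in> sets borel" "E \<subseteq> {0<..<R}" "emeasure lborel E \<le> ennreal (d R e)" for R e y E
    \<comment> \<open>Null sets are treated apart because \<open>H5\<close> says nothing about them;
      there the integral vanishes in any case.\<close>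
    proof (cases "0 < y \<and> y \<notin> Y \<and> emeasure lborel E \<noteq> 0")
      case True
      have [measurable]: "E \<in> sets borel" by fact
      have fin: "emeasure lborel E < top" using H(6) ennreal_less_top by (rule order.strict_trans1)
      have m: "measure lebesgue E = enn2real (emeasure lborel E)" by (simp add: measure_def)
      have mp: "0 < measure lebesgue E"
        using True fin by (simp add: m enn2real_positive_iff zero_less_iff_neq_zero)
      have "enn2real (emeasure lborel E) \<le> d R e"
        using H(6) d[of R e] H by (intro enn2real_leI) (auto simp: dP_def)
      then have "\<omega> R (measure lebesgue E) \<le> e"
        using d[of R e] H mp unfolding m by (simp add: dP_def)
      have "(\<integral>\<^sup>+x. indicator E x * G y x \<partial>lborel) = (\<integral>\<^sup>+x\<in>{0<..<y}. ennreal (indicator E x * \<Gamma> y x) \<partial>lebesgue)"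
        using True by (subst G_section) (auto intro!: nn_integral_cong split: split_indicator)
      also have "\<dots> \<le> ennreal (\<omega> R (measure lebesgue E))"
        using H True mp by (intro H5) auto
      also have "\<dots> \<le> ennreal e" by (rule ennreal_leI) fact
      finally show ?thesis .
    next
      case False
      have "AE x in lborel. indicator E x * G y x = 0"
      proof (cases "emeasure lborel E = 0")
        case True
        then have "E \<in> null_sets lborel" using H(4) by (auto simp: null_sets_def)
        from AE_not_in[OF this] show ?thesis by eventually_elim simp
      next
        case False
        then have "G y x = 0" for x using \<open>\<not> (0 < y \<and> y \<notin> Y \<and> emeasure lborel E \<noteq> 0)\<close> by (intro G_outside) auto
        then show ?thesis by simp
      qed
      then have "(\<integral>\<^sup>+x. indicator E x * G y x \<partial>lborel) = (\<integral>\<^sup>+x. 0 \<partial>(lborel :: real measure))"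
        by (rule nn_integral_cong_AE)
      then show ?thesis by simp
    qed
    show "density_fun g0" by (rule g0_dens)
    show "moment g0 < top" by (rule g0_moment)
  qed (auto simp: s_def)

  obtain f :: "real \<Rightarrow> real \<Rightarrow> ennreal" and F :: "real \<Rightarrow> real \<Rightarrow> real" 
    where f': "\<forall>t. density_fun (f t)" and F': "\<forall>t. F t \<in> borel_measurable borel"
    and fF': "\<forall>t\<ge>0. moment (f t) < top \<and> mass (f t) \<le> mass g0 \<and>
      (AE x in lborel. 0 \<le> F t x \<and> f t x = ennreal (F t x))"
    and eqn: "AE x in lborel. pointwise_solution K' G S' g0 f F x"
    using cf.exists_flow by (elim exE conjE)
  note f = f'[rule_format] and F = F'[rule_format] and fF = fF'[rule_format]
  have [measurable]: "f t \<in> borel_measurable borel" for t using f by (simp add: density_fun_def)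
  note [measurable] = F
  have ae: "AE x in lborel. 0 \<le> F t x \<and> f t x = ennreal (F t x)" if "0 \<le> t" for t using fF[OF that] by blast

  have weight: "(\<integral>\<^sup>+x\<in>{0<..}. ennreal (u x * \<bar>F t x\<bar>) \<partial>lebesgue) = (\<integral>\<^sup>+x. w x * f t x \<partial>lborel)"
    if t: "0 \<le> t" and w: "\<And>x. 0 < x \<Longrightarrow> w x = ennreal (u x)" and u: "\<And>x. 0 < x \<Longrightarrow> 0 \<le> u x" for t w u
  proof -
    have "(\<integral>\<^sup>+x. w x * f t x \<partial>lborel) = (\<integral>\<^sup>+x\<in>{0<..}. ennreal (u x * \<bar>F t x\<bar>) \<partial>lborel)"
    proof (rule nn_integral_cong_AE)
      show "AE x in lborel. w x * f t x = ennreal (u x * \<bar>F t x\<bar>) * indicator {0<..} x"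
        using ae[OF t]
      proof eventually_elim
        case (elim x)
        show ?case
        proof (cases "0 < x")
          case True
          then show ?thesis using elim w u by (simp add: ennreal_mult)
        qed (simp add: density_fun_zero[OF f])
      qed
    qed
    then show ?thesis by (simp only: nn_integral_completion)
  qed
  have F_X: "F t \<in> X_pos" if t: "0 \<le> t" for t
  proof -
    have X: "X_norm (F t) < \<infinity>"
    proof -
      have "X_norm (F t) = moment (f t)"
        unfolding moment_def X_norm_def by (rule weight[OF t]) (auto simp: vt_def simp del: ennreal_plus)
      then show ?thesis using fF[OF t] by simp
    qed
    have "set_integrable lebesgue {0<..} (F t)"
      unfolding set_integrable_def
    proof (rule integrableI_bounded)
      show "(\<lambda>x. indicator {0<..} x *\<^sub>R F t x) \<in> borel_measurable lebesgue"
        by (intro measurable_completion) measurable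
      have "(\<integral>\<^sup>+x. ennreal (norm (indicator {0<..} x *\<^sub>R F t x)) \<partial>lebesgue) \<le> X_norm (F t)"
        unfolding X_norm_def
        by (intro nn_integral_mono) (auto split: split_indicator intro!: ennreal_leI simp: mult_le_cancel_right1)
      then show "(\<integral>\<^sup>+x. ennreal (norm (indicator {0<..} x *\<^sub>R F t x)) \<partial>lebesgue) < \<infinity>"
        using X by (rule order.strict_trans1)
    qed
    moreover have "AE x in lebesgue_on {0<..}. 0 \<le> F t x"
    proof -
      have "AE x in lborel. x \<in> {0<..} \<longrightarrow> 0 \<le> F t x" using ae[OF t] by eventually_elim simp
      then show ?thesis by (simp add: AE_restrict_space_iff AE_completion_iff)
    qed
    ultimately show ?thesis using X by (simp add: X_pos_def X_space_def)
  qed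
  have F_mass: "norm_x (F t) \<le> norm_x f0" if t: "0 \<le> t" for t
  proof -
    have "norm_x (F t) = mass (f t)"
      unfolding mass_def norm_x_def by (rule weight[OF t]) auto
    then show ?thesis using fF[OF t] g0_mass by simp
  qed

  have AE_Y: "AE x in lborel. x \<notin> Y" using AE_not_in[OF Y] .
  have main: "AE x in lborel. 0 < x \<longrightarrow>
      continuous_on {t. 0 \<le> t \<and> ereal t < \<infinity>} (\<lambda>s. F s x) \<and>
      (\<forall>t. 0 \<le> t \<and> ereal t < \<infinity> \<longrightarrow>
         0 \<le> F t x \<and>
         (\<integral>\<^sup>+s\<in>{0<..<t}. (\<integral>\<^sup>+y\<in>{0<..<x}. ennreal (K (x - y) y * F s (x - y) * F s y) \<partial>lebesgue) \<partial>lebesgue) < \<infinity> \<and>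
         (\<integral>\<^sup>+s\<in>{0<..<t}. (\<integral>\<^sup>+y\<in>{0<..}. ennreal (K x y * F s y) \<partial>lebesgue) \<partial>lebesgue) < \<infinity> \<and>
         (\<integral>\<^sup>+s\<in>{0<..<t}. (\<integral>\<^sup>+y\<in>{x<..}. ennreal (breakage \<Gamma> x y * selection \<Gamma> y * F s y) \<partial>lebesgue) \<partial>lebesgue) < \<infinity> \<and>
         F t x = f0 x + (LINT s:{0<..<t}|lebesgue. coag_frag_rhs K (selection \<Gamma>) (breakage \<Gamma>) (F s) x))"
    (is "AE x in lborel. 0 < x \<longrightarrow> ?P x")
    using eqn g0_f0 AE_Y null_set_sections[OF ZK(1)] null_set_sections(2)[OF ZG(1)]
  proof eventually_elim
    case (elim x)
    show ?case
    proof
      assume x: "0 < x"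
      have coag_term: "(\<integral>\<^sup>+y\<in>{0<..<x}. ennreal (K (x - y) y * F u (x - y) * F u y) \<partial>lebesgue) = coag K' (f u) x"
        "(LINT y:{0<..<x}|lebesgue. K (x - y) y * F u (x - y) * F u y) = enn2real (coag K' (f u) x)" if u: "0 \<le> u" for u
      proof -
        \<comment> \<open>The gain evaluates the density at x - y; the reflection of y to x - y
          preserves null sets, so the almost everywhere identity carries over.\<close>
        have "Measurable.pred borel (\<lambda>y. 0 \<le> F u y \<and> f u y = ennreal (F u y))" by measurable
        then have refl: "AE y in lborel. 0 \<le> F u (x - y) \<and> f u (x - y) = ennreal (F u (x - y))"
          using AE_borel_affine[of "- 1" "\<lambda>y. 0 \<le> F u y \<and> f u y = ennreal (F u y)" x] ae[OF u] by simp
        have H: "(\<lambda>y. K' (x - y) y * f u (x - y) * f u y) \<in> borel_measurable borel" by measurable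
        have "AE y in lborel. (y \<in> {0<..<x} \<longrightarrow> 0 \<le> K (x - y) y * F u (x - y) * F u y \<and>
            ennreal (K (x - y) y * F u (x - y) * F u y) = K' (x - y) y * f u (x - y) * f u y) \<and>
          (y \<notin> {0<..<x} \<longrightarrow> K' (x - y) y * f u (x - y) * f u y = 0)"
          using refl ae[OF u] elim(6) elim(7)
        proof eventually_elim
          case (elim y)
          show ?case
          proof (cases "y \<in> {0<..<x}")
            case True
            have "0 \<le> K (x - y) y" using H1_nonneg True by simp
            then show ?thesis using True elim by (simp add: K'_def BK_def ennreal_mult)
          qed (auto simp: density_fun_zero[OF f])
        qed
        note tr = set_integral_lebesgue_transfer[OF H this]
        show "(\<integral>\<^sup>+y\<in>{0<..<x}. ennreal (K (x - y) y * F u (x - y) * F u y) \<partial>lebesgue) = coag K' (f u) x"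
          "(LINT y:{0<..<x}|lebesgue. K (x - y) y * F u (x - y) * F u y) = enn2real (coag K' (f u) x)"
          unfolding coag_def by (rule tr(1), rule tr(2))
      qed
      have loss_term: "(\<integral>\<^sup>+y\<in>{0<..}. ennreal (K x y * F u y) \<partial>lebesgue) = (\<integral>\<^sup>+y. K' x y * f u y \<partial>lborel)"
        "(LINT y:{0<..}|lebesgue. K x y * F u y) = enn2real (\<integral>\<^sup>+y. K' x y * f u y \<partial>lborel)" if u: "0 \<le> u" for u
      proof -
        have H: "(\<lambda>y. K' x y * f u y) \<in> borel_measurable borel" by measurable
        have "AE y in lborel. (y \<in> {0<..} \<longrightarrow> 0 \<le> K x y * F u y \<and> ennreal (K x y * F u y) = K' x y * f u y) \<and>
          (y \<notin> {0<..} \<longrightarrow> K' x y * f u y = 0)"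
          using ae[OF u] elim(4) elim(5)
        proof eventually_elim
          case (elim y)
          show ?case
          proof (cases "y \<in> {0<..}")
            case True
            have "0 \<le> K x y" using H1_nonneg True x by simp
            then show ?thesis using True elim x by (simp add: K'_def BK_def ennreal_mult)
          qed (auto simp: density_fun_zero[OF f])
        qed
        note tr = set_integral_lebesgue_transfer[OF H this]
        show "(\<integral>\<^sup>+y\<in>{0<..}. ennreal (K x y * F u y) \<partial>lebesgue) = (\<integral>\<^sup>+y. K' x y * f u y \<partial>lborel)"
          "(LINT y:{0<..}|lebesgue. K x y * F u y) = enn2real (\<integral>\<^sup>+y. K' x y * f u y \<partial>lborel)"
          by (rule tr(1), rule tr(2))
      qed
      have frag_term: "(\<integral>\<^sup>+y\<in>{x<..}. ennreal (breakage \<Gamma> x y * S y * F u y) \<partial>lebesgue) = frag G (f u) x"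
        "(LINT y:{x<..}|lebesgue. breakage \<Gamma> x y * S y * F u y) = enn2real (frag G (f u) x)" if u: "0 \<le> u" for u
      proof -
        have H: "(\<lambda>y. G y x * f u y) \<in> borel_measurable borel" by measurable
        have "AE y in lborel. (y \<in> {x<..} \<longrightarrow> 0 \<le> breakage \<Gamma> x y * S y * F u y \<and>
            ennreal (breakage \<Gamma> x y * S y * F u y) = G y x * f u y) \<and>
          (y \<notin> {x<..} \<longrightarrow> G y x * f u y = 0)"
          \<comment> \<open>The point y = x must be excluded: \<open>G x x\<close> may be nonzero,
            while the integral runs over y > x only.\<close>
          using ae[OF u] elim(8) AE_Y AE_lborel_singleton[of x]
        proof eventually_elim
          case (elim y)
          show ?case
          proof (cases "y \<in> {x<..}")
            case True
            have "0 \<le> \<Gamma> y x" using H3_nonneg True x by simp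
            then show ?thesis using True elim x b_S[of y x] by (simp add: G_def BG_def ennreal_mult)
          next
            case False
            then have "y < x" using elim by simp
            then show ?thesis using False by (simp add: G_outside)
          qed
        qed
        note tr = set_integral_lebesgue_transfer[OF H this]
        show "(\<integral>\<^sup>+y\<in>{x<..}. ennreal (breakage \<Gamma> x y * S y * F u y) \<partial>lebesgue) = frag G (f u) x"
          "(LINT y:{x<..}|lebesgue. breakage \<Gamma> x y * S y * F u y) = enn2real (frag G (f u) x)"
          unfolding frag_def by (rule tr(1), rule tr(2))
      qed
      have Sx: "enn2real (S' x) = S x" using S'_good[OF x elim(3)] S_nonneg[OF x] by simp
      have f0x: "enn2real (g0 x) = f0 x" using elim(2) x by simp
      have rhs: "coag_frag_rhs K S (breakage \<Gamma>) (F u) x =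
          net_rate K' G S' f F x u" if u: "0 \<le> u" for u
      proof -
        \<comment> \<open>\<open>coag_frag_rhs\<close> keeps the constant factor
          \<open>F u x\<close> under the integral, \<open>net_rate\<close> has it outside.\<close>
        have "(LINT y:{0<..}|lebesgue. K x y * F u x * F u y) = (LINT y:{0<..}|lebesgue. F u x * (K x y * F u y))"
          by (simp only: ac_simps)
        also have "\<dots> = F u x * enn2real (\<integral>\<^sup>+y. K' x y * f u y \<partial>lborel)"
          by (simp add: loss_term(2)[OF u])
        finally show ?thesis
          unfolding coag_frag_rhs_def net_rate_def coag_term(2)[OF u] frag_term(2)[OF u] Sx by simp
      qed
      have time: "(\<integral>\<^sup>+s\<in>{0<..<t}. \<psi> s \<partial>lebesgue) < \<infinity>"
        if "(\<integral>\<^sup>+u. indicator {0<..<t} u * \<psi>' u \<partial>lborel) < top" "\<And>u. 0 \<le> u \<Longrightarrow> \<psi> u = \<psi>' u"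
        for t :: real and \<psi> \<psi>' :: "real \<Rightarrow> ennreal"
      proof -
        have "(\<integral>\<^sup>+s\<in>{0<..<t}. \<psi> s \<partial>lborel) = (\<integral>\<^sup>+u. indicator {0<..<t} u * \<psi>' u \<partial>lborel)"
          using that(2) by (intro nn_integral_cong) (auto split: split_indicator)
        then show ?thesis using that(1) by (simp only: nn_integral_completion infinity_ennreal_def)
      qed
      have times: "{t. 0 \<le> t \<and> ereal t < \<infinity>} = {0..}" by auto
      note sol = elim(1)[unfolded pointwise_solution_def]
      show "?P x"
        unfolding times S_def[symmetric]
      proof (intro conjI allI impI)
        show "continuous_on {0..} (\<lambda>s. F s x)" using sol by blast
        fix t assume "0 \<le> t \<and> ereal t < \<infinity>"
        then have t: "0 \<le> t" by simp
        note E = sol[THEN conjunct2, rule_format, OF t]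
        show "0 \<le> F t x" using E by blast
        show "(\<integral>\<^sup>+s\<in>{0<..<t}. (\<integral>\<^sup>+y\<in>{0<..<x}. ennreal (K (x - y) y * F s (x - y) * F s y) \<partial>lebesgue) \<partial>lebesgue) < \<infinity>"
          by (rule time[OF E[THEN conjunct2, THEN conjunct1] coag_term(1)])
        show "(\<integral>\<^sup>+s\<in>{0<..<t}. (\<integral>\<^sup>+y\<in>{0<..}. ennreal (K x y * F s y) \<partial>lebesgue) \<partial>lebesgue) < \<infinity>"
          by (rule time[OF E[THEN conjunct2, THEN conjunct2, THEN conjunct1] loss_term(1)])
        show "(\<integral>\<^sup>+s\<in>{0<..<t}. (\<integral>\<^sup>+y\<in>{x<..}. ennreal (breakage \<Gamma> x y * S y * F s y) \<partial>lebesgue) \<partial>lebesgue) < \<infinity>"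
          by (rule time[OF E[THEN conjunct2, THEN conjunct2, THEN conjunct2, THEN conjunct1] frag_term(1)])
        show "F t x = f0 x + (LINT s:{0<..<t}|lebesgue. coag_frag_rhs K S (breakage \<Gamma>) (F s) x)"
        proof -
          let ?R = "net_rate K' G S' f F x"
          have int: "set_integrable lborel {0<..<t} ?R" and eq: "F t x = f0 x + (LINT u:{0<..<t}|lborel. ?R u)"
            using E f0x by simp_all
          have "(LINT s:{0<..<t}|lebesgue. coag_frag_rhs K S (breakage \<Gamma>) (F s) x) = (LINT s:{0<..<t}|lebesgue. ?R s)"
            unfolding set_lebesgue_integral_def
            by (intro Bochner_Integration.integral_cong) (auto simp: rhs split: split_indicator)
          \<comment> \<open>Passing from Lebesgue to Borel measure requires a Borel measurable
            integrand; this is supplied by the integrability clause of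
            \<open>pointwise_solution\<close>.\<close>
          also have "\<dots> = (LINT s:{0<..<t}|lborel. ?R s)"
            using int unfolding set_lebesgue_integral_def set_integrable_def
            by (intro integral_completion) auto
          finally show ?thesis using eq by simp
        qed
      qed
    qed
  qed
  have "weak_solution K (selection \<Gamma>) (breakage \<Gamma>) f0 \<infinity> F"
    unfolding weak_solution_def
  proof (intro conjI allI impI)
    show "(0::ereal) < \<infinity>" by simp
    show "F t \<in> X_pos" if "0 \<le> t \<and> ereal t < \<infinity>" for t using F_X that by simp
    show "AE x in lebesgue_on {0<..}. ?P x"
      by (rule AE_restrict_space_iff[THEN iffD2], simp)
         (use AE_completion[OF main] in \<open>simp only: greaterThan_iff\<close>)
  qed
  then show ?thesis using F_mass by blast
qed

end
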